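(* For an algebra $A$, the following are equivalent: (1) there exists some $d\in\mathbb{Z}_{>0}$ for which the set $\mathrm{brick}(A,d)$ of isomorphism classes of bricks of dimension $d$ is infinite; (2) for some $d\in\mathbb{Z}_{>0}$, $A$ admits an infinite semibrick consisting of bricks of dimension $d$; (3) for some $d'\in\mathbb{Z}_{>0}$, some irreducible component $\mathcal{Z}$ of the varieties of $d'$-dimensional $A$-modules contains modules $X$ and $Y$ with $\mathrm{Hom}_A(X,Y)=0$; (4) for some $d'\in\mathbb{Z}_{>0}$, some irreducible component $\mathcal{Z}$ of the varieties of $d'$-dimensional $A$-modules has infinitely many (pairwise) orthogonal orbits.
   Context: Throughout, $k$ is an algebraically closed field and $A$ is a finite dimensional, unital, associative, basic and connected $k$-algebra of rank $n$ (with $n$ isomorphism classes of simple modules). Modules are finitely generated left $A$-modules. A brick is a module $X$ with $\mathrm{End}_A(X)\simeq k$. A semibrick is a non-empty set of pairwise non-isomorphic bricks such that $\mathrm{Hom}_A(X,Y)=0=\mathrm{Hom}_A(Y,X)$ for distinct $X,Y$ in the set. For $\underline{d}\in\mathbb{Z}_{\ge0}^n$, $\mathrm{rep}(A,\underline{d})$ is the affine variety parametrizing modules of dimension vector $\underline{d}$, on which $\mathrm{GL}(\underline{d})$ acts by conjugation with orbits $O_X$ the isomorphism classes. The irreducible components of the varieties of $d'$-dimensional modules are the irreducible components of the varieties $\mathrm{rep}(A,\underline{d})$ where $\underline{d}$ is a dimension vector of total dimension $d'$. Two orbits $O_X,O_Y$ in a component are orthogonal if $\mathrm{Hom}_A(X,Y)=0=\mathrm{Hom}_A(Y,X)$.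 *)

theory Defs
  imports
    "HOL-Computational_Algebra.Polynomial"
    "HOL-Analysis.Abstract_Topology"
    "Jordan_Normal_Form.Matrix"
begin

section \<open>Basic connected algebras\<close>

text \<open>The algebra is the whole type \<open>'a\<close>, with the ring operations of class \<open>ring_1\<close> and scalar
  multiplication \<open>scale\<close>.\<close>

locale fd_algebra = vector_space scale
  for scale :: "'k::field \<Rightarrow> 'a::ring_1 \<Rightarrow> 'a" +
  assumes scale_mult_left: "scale c a * b = scale c (a * b)"
    and scale_mult_right: "a * scale c b = scale c (a * b)"
    and finite_dimensional: "\<exists>B. finite B \<and> span B = UNIV"

definition two_sided_ideal :: "'a::ring_1 set \<Rightarrow> bool" where
  "two_sided_ideal I \<longleftrightarrow>
     0 \<in> I \<and> (\<forall>x\<in>I. \<forall>y\<in>I. x + y \<in> I) \<and> (\<forall>a. \<forall>x\<in>I. a * x \<in> I \<and> x * a \<in> I)"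

text \<open>\<open>A\<close> is not a direct product of two nonzero algebras: the factors of a product decomposition of
  \<open>A\<close> are two-sided ideals of which \<open>A\<close> is the internal direct sum. (Ideals are automatically closed
  under scalars, since \<open>scale c x = scale c 1 * x\<close>.)\<close>

definition connected_algebra :: "'a::ring_1 itself \<Rightarrow> bool" where
  "connected_algebra _ \<longleftrightarrow>
     \<not> (\<exists>I J :: 'a set. two_sided_ideal I \<and> two_sided_ideal J \<and> I \<noteq> {0} \<and> J \<noteq> {0} \<and>
          I \<inter> J = {0} \<and> {x + y | x y. x \<in> I \<and> y \<in> J} = UNIV)"

definition idempotent :: "'a::ring_1 \<Rightarrow> bool" where
  "idempotent e \<longleftrightarrow> e * e = e"

definition primitive_idempotent :: "'a::ring_1 \<Rightarrow> bool" where
  "primitive_idempotent e \<longleftrightarrow> idempotent e \<and> e \<noteq> 0 \<and>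
     \<not> (\<exists>f g. idempotent f \<and> idempotent g \<and> f \<noteq> 0 \<and> g \<noteq> 0 \<and> f * g = 0 \<and> g * f = 0 \<and> e = f + g)"

definition complete_primitive_orthogonal :: "nat \<Rightarrow> (nat \<Rightarrow> 'a::ring_1) \<Rightarrow> bool" where
  "complete_primitive_orthogonal n e \<longleftrightarrow>
     (\<forall>i<n. primitive_idempotent (e i)) \<and>
     (\<forall>i<n. \<forall>j<n. i \<noteq> j \<longrightarrow> e i * e j = 0) \<and>
     (\<Sum>i<n. e i) = 1"

definition left_ideal_gen :: "'a::ring_1 \<Rightarrow> 'a set" where
  "left_ideal_gen x = range (\<lambda>a. a * x)"

definition left_ideals_isomorphic :: "'a::ring_1 set \<Rightarrow> 'a set \<Rightarrow> bool" where
  "left_ideals_isomorphic I J \<longleftrightarrow>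
     (\<exists>f. bij_betw f I J \<and> (\<forall>x\<in>I. \<forall>y\<in>I. f (x + y) = f x + f y) \<and> (\<forall>a. \<forall>x\<in>I. f (a * x) = a * f x))"

text \<open>\<open>A\<close> is basic, as witnessed by the complete set \<open>e 0, \<dots>, e (n - 1)\<close> of primitive orthogonal
  idempotents: the indecomposable projectives \<open>A e\<^sub>i\<close> are pairwise non-isomorphic.\<close>

definition basic_algebra :: "nat \<Rightarrow> (nat \<Rightarrow> 'a::ring_1) \<Rightarrow> bool" where
  "basic_algebra n e \<longleftrightarrow> complete_primitive_orthogonal n e \<and>
     (\<forall>i<n. \<forall>j<n. i \<noteq> j \<longrightarrow>
        \<not> left_ideals_isomorphic (left_ideal_gen (e i)) (left_ideal_gen (e j)))"


section \<open>Modules\<close>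

text \<open>A finitely generated (equivalently, finite dimensional) left module of dimension \<open>m\<close> is given,
  up to the choice of a basis, by a unital \<open>k\<close>-algebra homomorphism from \<open>A\<close> to the \<open>m \<times> m\<close> matrices.\<close>

definition modules :: "('k::field \<Rightarrow> 'a::ring_1 \<Rightarrow> 'a) \<Rightarrow> nat \<Rightarrow> ('a \<Rightarrow> 'k mat) set" where
  "modules scale m = {X.
     (\<forall>a. X a \<in> carrier_mat m m) \<and>
     (\<forall>a b. X (a + b) = X a + X b) \<and>
     (\<forall>c a. X (scale c a) = c \<cdot>\<^sub>m X a) \<and>
     (\<forall>a b. X (a * b) = X a * X b) \<and>
     X 1 = 1\<^sub>m m}"

definition is_module :: "('k::field \<Rightarrow> 'a::ring_1 \<Rightarrow> 'a) \<Rightarrow> ('a \<Rightarrow> 'k mat) \<Rightarrow> bool" where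
  "is_module scale X \<longleftrightarrow> (\<exists>m. X \<in> modules scale m)"

definition mdim :: "('a::ring_1 \<Rightarrow> 'k::field mat) \<Rightarrow> nat" where
  "mdim X = dim_row (X 1)"

definition Hom :: "('a::ring_1 \<Rightarrow> 'k::field mat) \<Rightarrow> ('a \<Rightarrow> 'k mat) \<Rightarrow> 'k mat set" where
  "Hom X Y = {T \<in> carrier_mat (mdim Y) (mdim X). \<forall>a. T * X a = Y a * T}"

definition Hom_zero :: "('a::ring_1 \<Rightarrow> 'k::field mat) \<Rightarrow> ('a \<Rightarrow> 'k mat) \<Rightarrow> bool" where
  "Hom_zero X Y \<longleftrightarrow> Hom X Y = {0\<^sub>m (mdim Y) (mdim X)}"

definition mod_iso :: "('a::ring_1 \<Rightarrow> 'k::field mat) \<Rightarrow> ('a \<Rightarrow> 'k mat) \<Rightarrow> bool" where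
  "mod_iso X Y \<longleftrightarrow> (\<exists>T \<in> Hom X Y. invertible_mat T)"

definition iso_class ::
    "('k::field \<Rightarrow> 'a::ring_1 \<Rightarrow> 'a) \<Rightarrow> ('a \<Rightarrow> 'k mat) \<Rightarrow> ('a \<Rightarrow> 'k mat) set" where
  "iso_class scale X = {Y. is_module scale Y \<and> mod_iso X Y}"

text \<open>Closure of submodules under scalars is implied by closure under the action.\<close>

definition submodule_of :: "('a::ring_1 \<Rightarrow> 'k::field mat) \<Rightarrow> 'k vec set \<Rightarrow> bool" where
  "submodule_of X W \<longleftrightarrow> W \<subseteq> carrier_vec (mdim X) \<and> 0\<^sub>v (mdim X) \<in> W \<and>
     (\<forall>v\<in>W. \<forall>w\<in>W. v + w \<in> W) \<and> (\<forall>a. \<forall>v\<in>W. X a *\<^sub>v v \<in> W)"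

definition simple_module ::
    "('k::field \<Rightarrow> 'a::ring_1 \<Rightarrow> 'a) \<Rightarrow> ('a \<Rightarrow> 'k mat) \<Rightarrow> bool" where
  "simple_module scale X \<longleftrightarrow> is_module scale X \<and> mdim X > 0 \<and>
     (\<forall>W. submodule_of X W \<longrightarrow> W = {0\<^sub>v (mdim X)} \<or> W = carrier_vec (mdim X))"

definition algebra_rank :: "('k::field \<Rightarrow> 'a::ring_1 \<Rightarrow> 'a) \<Rightarrow> nat" where
  "algebra_rank scale = card (iso_class scale ` {X. simple_module scale X})"


section \<open>Bricks and semibricks\<close>

text \<open>\<open>End(X)\<close> is isomorphic to \<open>k\<close> as a \<open>k\<close>-algebra.\<close>

definition End_iso_field :: "('a::ring_1 \<Rightarrow> 'k::field mat) \<Rightarrow> bool" where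
  "End_iso_field X \<longleftrightarrow>
     (\<exists>f :: 'k \<Rightarrow> 'k mat. bij_betw f UNIV (Hom X X) \<and>
        (\<forall>x y. f (x + y) = f x + f y) \<and> (\<forall>c x. f (c * x) = c \<cdot>\<^sub>m f x) \<and>
        (\<forall>x y. f (x * y) = f x * f y) \<and> f 1 = 1\<^sub>m (mdim X))"

definition brick :: "('k::field \<Rightarrow> 'a::ring_1 \<Rightarrow> 'a) \<Rightarrow> ('a \<Rightarrow> 'k mat) \<Rightarrow> bool" where
  "brick scale X \<longleftrightarrow> is_module scale X \<and> End_iso_field X"

definition brick_classes ::
    "('k::field \<Rightarrow> 'a::ring_1 \<Rightarrow> 'a) \<Rightarrow> nat \<Rightarrow> ('a \<Rightarrow> 'k mat) set set" where
  "brick_classes scale m = iso_class scale ` {X \<in> modules scale m. brick scale X}"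

definition semibrick :: "('k::field \<Rightarrow> 'a::ring_1 \<Rightarrow> 'a) \<Rightarrow> ('a \<Rightarrow> 'k mat) set \<Rightarrow> bool" where
  "semibrick scale S \<longleftrightarrow> S \<noteq> {} \<and> (\<forall>X\<in>S. brick scale X) \<and>
     (\<forall>X\<in>S. \<forall>Y\<in>S. X \<noteq> Y \<longrightarrow> \<not> mod_iso X Y \<and> Hom_zero X Y \<and> Hom_zero Y X)"


section \<open>Representation varieties\<close>

text \<open>A dimension vector is a function \<open>d\<close> of which only the values at \<open>0, \<dots>, n - 1\<close> matter; \<open>d i\<close>
  is the dimension of \<open>e i \<cdot> X\<close>, i.e. the multiplicity of the \<open>i\<close>-th simple module in \<open>X\<close>. The index
  set of the matrices is cut into consecutive blocks of lengths \<open>d 0, \<dots>, d (n - 1)\<close>, and a point of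
  \<open>rep_variety\<close> is a module structure on \<open>k^(d 0) \<oplus> \<dots> \<oplus> k^(d (n - 1))\<close> for which \<open>e i\<close> acts as the projection
  onto the \<open>i\<close>-th summand. For a bound quiver algebra these are the representations of the bound
  quiver, with \<open>e i\<close> the idempotent of the \<open>i\<close>-th vertex.\<close>

definition total_dim :: "nat \<Rightarrow> (nat \<Rightarrow> nat) \<Rightarrow> nat" where
  "total_dim n d = (\<Sum>i<n. d i)"

definition block_proj :: "nat \<Rightarrow> (nat \<Rightarrow> nat) \<Rightarrow> nat \<Rightarrow> 'k::field mat" where
  "block_proj n d i = mat (total_dim n d) (total_dim n d)
     (\<lambda>(r, c). if r = c \<and> (\<Sum>j<i. d j) \<le> r \<and> r < (\<Sum>j<Suc i. d j) then 1 else 0)"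

definition rep_variety ::
    "('k::field \<Rightarrow> 'a::ring_1 \<Rightarrow> 'a) \<Rightarrow> nat \<Rightarrow> (nat \<Rightarrow> 'a) \<Rightarrow> (nat \<Rightarrow> nat) \<Rightarrow> ('a \<Rightarrow> 'k mat) set" where
  "rep_variety scale n e d =
     {X \<in> modules scale (total_dim n d). \<forall>i<n. X (e i) = block_proj n d i}"

text \<open>The matrices commuting with all block projections are the block diagonal ones, so this is
  the product of the groups \<open>GL(d i)\<close>.\<close>

definition GL :: "nat \<Rightarrow> (nat \<Rightarrow> nat) \<Rightarrow> 'k::field mat set" where
  "GL n d = {g \<in> carrier_mat (total_dim n d) (total_dim n d).
     invertible_mat g \<and> (\<forall>i<n. g * block_proj n d i = block_proj n d i * g)}"

definition orbit ::
    "nat \<Rightarrow> (nat \<Rightarrow> nat) \<Rightarrow> ('a \<Rightarrow> 'k::field mat) \<Rightarrow> ('a \<Rightarrow> 'k mat) set" where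
  "orbit n d X = {(\<lambda>a. g * X a * h) | g h. g \<in> GL n d \<and> h \<in> GL n d \<and>
     g * h = 1\<^sub>m (total_dim n d) \<and> h * g = 1\<^sub>m (total_dim n d)}"

text \<open>The orbits are the isomorphism classes.\<close>

lemma orbit_iff_mod_iso:
  assumes X: "X \<in> rep_variety scale n e d" and Y: "Y \<in> rep_variety scale n e d"
  shows "Y \<in> orbit n d X \<longleftrightarrow> mod_iso X Y"
proof -
  let ?m = "total_dim n d"
  have cX: "X a \<in> carrier_mat ?m ?m" and cY: "Y a \<in> carrier_mat ?m ?m" for a
    using X Y by (auto simp: rep_variety_def modules_def)
  have dims: "mdim X = ?m" "mdim Y = ?m"
    using cX[of 1] cY[of 1] by (auto simp: mdim_def)
  have pX: "X (e i) = block_proj n d i" and pY: "Y (e i) = block_proj n d i" if "i < n" for i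
    using X Y that by (auto simp: rep_variety_def)
  show ?thesis
  proof
    assume "Y \<in> orbit n d X"
    then obtain g h where gh: "Y = (\<lambda>a. g * X a * h)" "g \<in> GL n d" "h \<in> GL n d" "h * g = 1\<^sub>m ?m"
      by (auto simp: orbit_def)
    have cg: "g \<in> carrier_mat ?m ?m" and ch: "h \<in> carrier_mat ?m ?m" and inv: "invertible_mat g"
      using gh by (auto simp: GL_def)
    have "g * X a = Y a * g" for a
    proof -
      have "Y a * g = g * X a * (h * g)"
        unfolding gh(1) by (rule assoc_mult_mat) (use cg ch cX[of a] in auto)
      also have "\<dots> = g * X a"
        unfolding gh(4) by (rule right_mult_one_mat) (use cg cX[of a] in auto)
      finally show ?thesis by simp
    qed
    then show "mod_iso X Y"
      using cg inv unfolding mod_iso_def Hom_def dims by blast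
  next
    assume "mod_iso X Y"
    then obtain T where T: "T \<in> carrier_mat ?m ?m" "\<And>a. T * X a = Y a * T" "invertible_mat T"
      unfolding mod_iso_def Hom_def dims by blast
    then obtain B where B: "T * B = 1\<^sub>m (dim_row T)" "B * T = 1\<^sub>m (dim_row B)"
      unfolding invertible_mat_def inverts_mat_def by blast
    have TB: "T * B = 1\<^sub>m ?m"
      using B(1) T(1) by simp
    have "dim_col B = ?m"
      using arg_cong[OF TB, of dim_col] by simp
    moreover have "dim_row B = ?m"
      using arg_cong[OF B(2), of dim_col] T(1) by simp
    ultimately have cB: "B \<in> carrier_mat ?m ?m"
      by auto
    have BT: "B * T = 1\<^sub>m ?m"
      using B(2) cB by simp
    have Yeq: "Y a = T * X a * B" for a
    proof -
      have "T * X a * B = Y a * (T * B)"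
        unfolding T(2) by (rule assoc_mult_mat[OF cY T(1) cB])
      also have "\<dots> = Y a"
        unfolding TB by (rule right_mult_one_mat[OF cY])
      finally show ?thesis by simp
    qed
    have Bcomm: "B * Y a = X a * B" for a
    proof -
      have "B * Y a = B * (T * (X a * B))"
        unfolding Yeq by (subst assoc_mult_mat[OF T(1) cX cB]) simp
      also have "\<dots> = B * T * (X a * B)"
        by (rule assoc_mult_mat[symmetric, OF cB T(1)]) (rule mult_carrier_mat[OF cX cB])
      also have "\<dots> = X a * B"
        unfolding BT by (rule left_mult_one_mat) (rule mult_carrier_mat[OF cX cB])
      finally show ?thesis .
    qed
    have "invertible_mat B"
      unfolding invertible_mat_def inverts_mat_def using B cB T(1) by auto
    then have "T \<in> GL n d" "B \<in> GL n d"
      using T cB T(2)[of "e _"] Bcomm[of "e _"] pX pY unfolding GL_def by (auto, metis+)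
    then show "Y \<in> orbit n d X"
      unfolding orbit_def using Yeq TB BT by blast
  qed
qed

definition orthogonal_orbits ::
    "('a::ring_1 \<Rightarrow> 'k::field mat) set \<Rightarrow> ('a \<Rightarrow> 'k mat) set \<Rightarrow> bool" where
  "orthogonal_orbits P Q \<longleftrightarrow> (\<forall>X\<in>P. \<forall>Y\<in>Q. Hom_zero X Y \<and> Hom_zero Y X)"

text \<open>Polynomial functions in the matrix entries. Since representations are linear in \<open>a\<close>, the
  entries of \<open>X a\<close> for \<open>a\<close> in a (finite) basis of the algebra generate the same functions.\<close>

inductive_set polyfuns :: "nat \<Rightarrow> (('a \<Rightarrow> 'k::field mat) \<Rightarrow> 'k) set" for m :: nat where
  const: "(\<lambda>_. c) \<in> polyfuns m"
| coord: "\<lbrakk>i < m; j < m\<rbrakk> \<Longrightarrow> (\<lambda>X. X a $$ (i, j)) \<in> polyfuns m"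
| add: "\<lbrakk>f \<in> polyfuns m; g \<in> polyfuns m\<rbrakk> \<Longrightarrow> (\<lambda>X. f X + g X) \<in> polyfuns m"
| mult: "\<lbrakk>f \<in> polyfuns m; g \<in> polyfuns m\<rbrakk> \<Longrightarrow> (\<lambda>X. f X * g X) \<in> polyfuns m"

definition zariski :: "nat \<Rightarrow> ('a \<Rightarrow> 'k::field mat) set \<Rightarrow> ('a \<Rightarrow> 'k mat) topology" where
  "zariski m V = topology (\<lambda>U. \<exists>F \<subseteq> polyfuns m. U = V - {X \<in> V. \<forall>f\<in>F. f X = 0})"

lemma istopology_zariski:
  "istopology (\<lambda>U. \<exists>F \<subseteq> polyfuns m. U = V - {X \<in> V. \<forall>f\<in>F. f X = (0::'k::field)})"
  unfolding istopology_def
proof (intro conjI allI impI)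
  fix S T :: "('a \<Rightarrow> 'k mat) set"
  assume "\<exists>F \<subseteq> polyfuns m. S = V - {X \<in> V. \<forall>f\<in>F. f X = 0}"
    and "\<exists>F \<subseteq> polyfuns m. T = V - {X \<in> V. \<forall>f\<in>F. f X = 0}"
  then obtain F G where F: "F \<subseteq> polyfuns m" "S = V - {X \<in> V. \<forall>f\<in>F. f X = 0}"
    and G: "G \<subseteq> polyfuns m" "T = V - {X \<in> V. \<forall>f\<in>G. f X = 0}"
    by (elim exE conjE)
  let ?H = "{(\<lambda>X. f X * g X) | f g. f \<in> F \<and> g \<in> G}"
  have "?H \<subseteq> polyfuns m"
    using F(1) G(1) by (auto intro: polyfuns.mult)
  moreover have "S \<inter> T = V - {X \<in> V. \<forall>f\<in>?H. f X = 0}"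
  proof (rule Set.set_eqI)
    fix X
    have "(\<exists>h\<in>?H. h X \<noteq> 0) \<longleftrightarrow> (\<exists>f\<in>F. f X \<noteq> 0) \<and> (\<exists>g\<in>G. g X \<noteq> 0)"
      by (auto; force)
    then show "X \<in> S \<inter> T \<longleftrightarrow> X \<in> V - {X \<in> V. \<forall>f\<in>?H. f X = 0}"
      unfolding F(2) G(2) by simp blast
  qed
  ultimately show "\<exists>F \<subseteq> polyfuns m. S \<inter> T = V - {X \<in> V. \<forall>f\<in>F. f X = 0}"
    by (intro exI[of _ ?H] conjI)
next
  fix \<K> :: "('a \<Rightarrow> 'k mat) set set"
  assume "\<forall>K\<in>\<K>. \<exists>F \<subseteq> polyfuns m. K = V - {X \<in> V. \<forall>f\<in>F. f X = 0}"
  from bchoice[OF this] obtain \<F> where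
    \<F>: "\<forall>K\<in>\<K>. \<F> K \<subseteq> polyfuns m \<and> K = V - {X \<in> V. \<forall>f\<in>\<F> K. f X = 0}" ..
  have "\<Union>\<K> = (\<Union>K\<in>\<K>. K)"
    by simp
  also have "\<dots> = (\<Union>K\<in>\<K>. V - {X \<in> V. \<forall>f\<in>\<F> K. f X = 0})"
    by (rule SUP_cong[OF refl], rule bspec[OF \<F>, THEN conjunct2])
  also have "\<dots> = V - {X \<in> V. \<forall>f\<in>(\<Union>K\<in>\<K>. \<F> K). f X = 0}"
    by blast
  finally show "\<exists>F \<subseteq> polyfuns m. \<Union>\<K> = V - {X \<in> V. \<forall>f\<in>F. f X = 0}"
    by (intro exI[of _ "\<Union>K\<in>\<K>. \<F> K"] conjI UN_least) (rule bspec[OF \<F>, THEN conjunct1])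
qed

lemma openin_zariski:
  "openin (zariski m V) U \<longleftrightarrow> (\<exists>F \<subseteq> polyfuns m. U = V - {X \<in> V. \<forall>f\<in>F. f X = 0})"
  unfolding zariski_def by (subst topology_inverse'[OF istopology_zariski]) simp

lemma topspace_zariski: "topspace (zariski m V) = (V :: ('a \<Rightarrow> 'k::field mat) set)"
proof
  show "topspace (zariski m V) \<subseteq> V"
    using openin_topspace[of "zariski m V"] unfolding openin_zariski by auto
  have "openin (zariski m V) V"
    unfolding openin_zariski by (intro exI[of _ "{\<lambda>_. 1}"]) (auto intro: polyfuns.const)
  then show "V \<subseteq> topspace (zariski m V)"
    by (rule openin_subset)
qed

lemma closedin_zariski:
  "closedin (zariski m V) C \<longleftrightarrow> (\<exists>F \<subseteq> polyfuns m. C = {X \<in> V. \<forall>f\<in>F. f X = 0})"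
proof
  assume "closedin (zariski m V) C"
  then have "C \<subseteq> V" "openin (zariski m V) (V - C)"
    unfolding closedin_def topspace_zariski by simp_all
  then obtain F where F: "F \<subseteq> polyfuns m" "V - C = V - {X \<in> V. \<forall>f\<in>F. f X = 0}"
    unfolding openin_zariski by auto
  have "C = V - (V - C)"
    using \<open>C \<subseteq> V\<close> by (rule double_diff[OF _ subset_refl, symmetric])
  also have "\<dots> = {X \<in> V. \<forall>f\<in>F. f X = 0}"
    unfolding F(2) by (rule double_diff[OF _ subset_refl]) simp
  finally show "\<exists>F \<subseteq> polyfuns m. C = {X \<in> V. \<forall>f\<in>F. f X = 0}"
    using F(1) by (intro exI[of _ F] conjI)
next
  assume "\<exists>F \<subseteq> polyfuns m. C = {X \<in> V. \<forall>f\<in>F. f X = 0}"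
  then obtain F where F: "F \<subseteq> polyfuns m" "C = {X \<in> V. \<forall>f\<in>F. f X = 0}"
    by auto
  have "openin (zariski m V) (V - C)"
    unfolding openin_zariski F(2) by (intro exI[of _ F] conjI F(1) refl)
  moreover have "C \<subseteq> V"
    unfolding F(2) by simp
  ultimately show "closedin (zariski m V) C"
    unfolding closedin_def topspace_zariski by (intro conjI)
qed

definition irreducible_in :: "'b topology \<Rightarrow> 'b set \<Rightarrow> bool" where
  "irreducible_in T Z \<longleftrightarrow> Z \<subseteq> topspace T \<and> Z \<noteq> {} \<and>
     (\<forall>C D. closedin T C \<and> closedin T D \<and> Z \<subseteq> C \<union> D \<longrightarrow> Z \<subseteq> C \<or> Z \<subseteq> D)"

definition irreducible_components :: "'b topology \<Rightarrow> 'b set set" where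
  "irreducible_components T =
     {Z. irreducible_in T Z \<and> (\<forall>Z'. irreducible_in T Z' \<and> Z \<subseteq> Z' \<longrightarrow> Z' = Z)}"

definition rep_components ::
    "('k::field \<Rightarrow> 'a::ring_1 \<Rightarrow> 'a) \<Rightarrow> nat \<Rightarrow> (nat \<Rightarrow> 'a) \<Rightarrow> (nat \<Rightarrow> nat) \<Rightarrow> ('a \<Rightarrow> 'k mat) set set" where
  "rep_components scale n e d =
     irreducible_components (zariski (total_dim n d) (rep_variety scale n e d))"

end

theory Submission
  imports Defs "Jordan_Normal_Form.Char_Poly" "HOL-Library.Function_Algebras"
begin

text \<open>
  Every nonzero module \<open>M\<close> has a brick that is both a quotient and a submodule of \<open>M\<close>: as long as \<open>M\<close> is
  not a brick, some endomorphism is neither zero nor invertible, and one passes to its image. On the other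
  hand, a brick of smaller dimension is never both a quotient and a submodule of a brick.

  (1) \<open>\<Longrightarrow>\<close> (2): for the least \<open>d\<close> with infinitely many bricks of dimension \<open>d\<close>, only finitely many bricks are
  smaller, so infinitely many bricks of dimension \<open>d\<close> have the same smaller bricks as quotients and the
  same ones as submodules. A nonzero map between two of these would have such a brick in its image.

  (2) \<open>\<Longrightarrow>\<close> (4): by Hilbert's basis theorem an infinite set of points of an affine variety has an infinite
  irreducible subset. The component containing it is a union of orbits since the group is irreducible.

  (3) \<open>\<Longrightarrow>\<close> (1): if there are finitely many bricks of each dimension, then one brick is a quotient and a
  submodule of all modules in a dense subset of \<open>Z\<close>. As \<open>Hom(X, N) = 0\<close> and \<open>Hom(M, N) = 0\<close> are open
  conditions on \<open>N\<close> and on \<open>M\<close>, such modules \<open>M\<close> and \<open>N\<close> with \<open>Hom(M, N) = 0\<close> exist, which is absurd.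
\<close>

section \<open>Linear algebra\<close>

text \<open>Both uses of bricks rest on one composite: if the same brick B is a quotient of M and a
  submodule of N, then M -> B -> N is nonzero and factors through dimension dim B. When there are
  finitely many candidates for B, they are either compared by pigeonhole or used as labels of a
  finite covering of an irreducible set. Of the piece of that covering only density is used; it need
  not be open or closed. Two obstacles shape the geometric part. The coordinates
  \<open>X a $$ (i, j)\<close> range over all a in A, so Noetherianity has to be reduced to a finite
  spanning set of A. And a component is just a maximal irreducible set, so its stability under the
  group must be derived; this works because conjugation by g is polynomial in g up to powers of det
  g. Modules are matrix-valued functions, so images of homomorphisms need coordinates: these come
  from rank factorizations, whose one-sided inverse matrices witness surjectivity and
  injectivity.\<close>

lemma assoc_mult_mat_dim:
  "dim_col A = dim_row B \<Longrightarrow> dim_col B = dim_row C \<Longrightarrow> A * B * C = A * (B * C :: 'k::semiring_0 mat)"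
  by (rule assoc_mult_mat) auto

lemma det_mat_eq_0_iff:
  fixes f :: "nat \<Rightarrow> nat \<Rightarrow> 'k::field"
  shows "det (mat p p (\<lambda>(i, j). f i j)) = 0 \<longleftrightarrow>
    (\<exists>u. (\<exists>j<p. u j \<noteq> 0) \<and> (\<forall>i<p. (\<Sum>j<p. f i j * u j) = 0))"
proof -
  let ?M = "mat p p (\<lambda>(i, j). f i j)"
  have "det ?M = 0 \<longleftrightarrow> (\<exists>v. v \<in> carrier_vec p \<and> v \<noteq> 0\<^sub>v p \<and> ?M *\<^sub>v v = 0\<^sub>v p)"
    by (rule det_0_iff_vec_prod_zero_field) simp
  also have "\<dots> \<longleftrightarrow> (\<exists>u. (\<exists>j<p. u j \<noteq> 0) \<and> (\<forall>i<p. (\<Sum>j<p. f i j * u j) = 0))"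
  proof
    assume "\<exists>v. v \<in> carrier_vec p \<and> v \<noteq> 0\<^sub>v p \<and> ?M *\<^sub>v v = 0\<^sub>v p"
    then obtain v where v: "v \<in> carrier_vec p" "v \<noteq> 0\<^sub>v p" "?M *\<^sub>v v = 0\<^sub>v p" by auto
    have "\<exists>j<p. v $ j \<noteq> 0" using v(1,2) by (metis eq_vecI carrier_vecD index_zero_vec)
    moreover have "(\<Sum>j<p. f i j * v $ j) = 0" if "i < p" for i
      using arg_cong[OF v(3), of "\<lambda>w. w $ i"] that v(1)
      by (simp add: scalar_prod_def lessThan_atLeast0)
    ultimately show "\<exists>u. (\<exists>j<p. u j \<noteq> 0) \<and> (\<forall>i<p. (\<Sum>j<p. f i j * u j) = 0)" by blast
  next
    assume "\<exists>u. (\<exists>j<p. u j \<noteq> 0) \<and> (\<forall>i<p. (\<Sum>j<p. f i j * u j) = 0)"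
    then obtain u where u: "\<exists>j<p. u j \<noteq> 0" "\<forall>i<p. (\<Sum>j<p. f i j * u j) = 0" by auto
    have "vec p u \<noteq> 0\<^sub>v p" using u(1) by (metis index_vec index_zero_vec(1))
    moreover have "?M *\<^sub>v vec p u = 0\<^sub>v p"
      using u(2) by (intro eq_vecI) (auto simp: scalar_prod_def lessThan_atLeast0)
    ultimately show "\<exists>v. v \<in> carrier_vec p \<and> v \<noteq> 0\<^sub>v p \<and> ?M *\<^sub>v v = 0\<^sub>v p"
      by (intro exI[of _ "vec p u"]) simp
  qed
  finally show ?thesis .
qed

text \<open>Padding the system with zero rows gives a square matrix; its row \<open>q\<close>
  vanishes, so it is singular and has a kernel vector.\<close>

lemma underdetermined_system:
  fixes v :: "nat \<Rightarrow> nat \<Rightarrow> 'k::field"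
  assumes "q < p"
  shows "\<exists>u. (\<exists>j<p. u j \<noteq> 0) \<and> (\<forall>i<q. (\<Sum>j<p. v i j * u j) = 0)"
proof -
  let ?f = "\<lambda>i j. if i < q then v i j else 0"
  have "mat p p (\<lambda>(i, j). ?f i j) = mat\<^sub>r p p (\<lambda>i. if i = q then 0\<^sub>v p else vec p (?f i))"
    by (intro eq_matI) (auto simp: mat_of_rows_def)
  also have "det \<dots> = 0" using assms by (intro det_row_0) auto
  finally obtain u where u: "\<exists>j<p. u j \<noteq> 0" "\<forall>i<p. (\<Sum>j<p. ?f i j * u j) = 0"
    unfolding det_mat_eq_0_iff by blast
  moreover have "(\<Sum>j<p. v i j * u j) = 0" if "i < q" for i
    using u(2)[rule_format, of i] that assms by simp
  ultimately show ?thesis by blast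
qed

text \<open>Greedily chosen rows \<open>v (s 0), v (s 1), \<dots>\<close> and vectors \<open>w 0, w 1, \<dots>\<close> such that the matrix of
  their products is triangular.\<close>

lemma exists_nonsingular_rows:
  fixes v :: "'s \<Rightarrow> nat \<Rightarrow> 'k::field"
  assumes triv: "\<And>u. (\<And>x. x \<in> S \<Longrightarrow> (\<Sum>j<p. v x j * u j) = 0) \<Longrightarrow> \<forall>j<p. u j = 0"
  shows "\<exists>s. (\<forall>i<p. s i \<in> S) \<and> det (mat p p (\<lambda>(i, j). v (s i) j)) \<noteq> 0"
proof -
  have "\<exists>s w. (\<forall>i<q. s i \<in> S \<and> (\<Sum>j<p. v (s i) j * w i j) \<noteq> 0) \<and>
     (\<forall>i l. i < l \<and> l < q \<longrightarrow> (\<Sum>j<p. v (s i) j * w l j) = 0)" if "q \<le> p" for q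
    using that
  proof (induction q)
    case (Suc q)
    then obtain s w where sw: "\<forall>i<q. s i \<in> S \<and> (\<Sum>j<p. v (s i) j * w i j) \<noteq> 0"
      "\<forall>i l. i < l \<and> l < q \<longrightarrow> (\<Sum>j<p. v (s i) j * w l j) = 0" by auto
    \<comment> \<open>The \<open>q\<close> rows found so far have a common nonzero solution
      \<open>u\<close>, and \<open>triv\<close> yields a row not vanishing on it. This keeps the
      diagonal nonzero and everything above it zero.\<close>
    from underdetermined_system[of q p "\<lambda>i. v (s i)"] Suc.prems obtain u where
      u: "\<exists>j<p. u j \<noteq> 0" "\<forall>i<q. (\<Sum>j<p. v (s i) j * u j) = 0" by auto
    from triv[of u] u(1) obtain x where x: "x \<in> S" "(\<Sum>j<p. v x j * u j) \<noteq> 0" by blast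
    show ?case
      by (rule exI[of _ "s(q := x)"], rule exI[of _ "w(q := u)"])
        (use sw u x in \<open>auto simp: less_Suc_eq\<close>)
  qed auto
  then obtain s w where sw: "\<forall>i<p. s i \<in> S \<and> (\<Sum>j<p. v (s i) j * w i j) \<noteq> 0"
     "\<forall>i l. i < l \<and> l < p \<longrightarrow> (\<Sum>j<p. v (s i) j * w l j) = 0" by blast
  let ?A = "mat p p (\<lambda>(i, j). v (s i) j)" and ?B = "mat p p (\<lambda>(j, i). w i j)"
  have AB: "?A * ?B \<in> carrier_mat p p" by (rule mult_carrier_mat[of _ p p]) auto
  have ent: "(?A * ?B) $$ (i, l) = (\<Sum>j<p. v (s i) j * w l j)" if "i < p" "l < p" for i l
    using that by (simp add: scalar_prod_def lessThan_atLeast0)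
  have "det (?A * ?B) = prod_list (diag_mat (?A * ?B))"
    using ent sw(2) by (intro det_lower_triangular[OF _ AB]) auto
  also have "\<dots> \<noteq> 0"
    using ent sw(1) by (auto simp: prod_list_zero_iff diag_mat_def)
  finally have "det ?A \<noteq> 0" by (subst (asm) det_mult[of _ p]) auto
  then show ?thesis using sw(1) by blast
qed

text \<open>Trivial kernel yields \<open>r\<close> rows of \<open>L\<close> with nonzero
  determinant. The matrix \<open>?S\<close> selects these rows, and the inverse of
  \<open>?S * L\<close> times \<open>?S\<close> is a left inverse.\<close>

lemma mat_left_inverse:
  fixes L :: "'k::field mat"
  assumes L: "L \<in> carrier_mat m r"
    and inj: "\<And>u. (\<And>i. i < m \<Longrightarrow> (\<Sum>j<r. L $$ (i, j) * u j) = 0) \<Longrightarrow> \<forall>j<r. u j = 0"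
  shows "\<exists>L'. L' \<in> carrier_mat r m \<and> L' * L = 1\<^sub>m r"
proof -
  obtain s where s: "\<forall>i<r. s i < m" "det (mat r r (\<lambda>(i, j). L $$ (s i, j))) \<noteq> 0"
    using exists_nonsingular_rows[where S = "{..<m}" and p = r and v = "\<lambda>i j. L $$ (i, j)"] inj by auto
  let ?S = "mat r m (\<lambda>(i, l). if l = s i then 1 else 0) :: 'k mat"
  have "?S * L = mat r r (\<lambda>(i, j). L $$ (s i, j))"
    using L s(1) by (intro eq_matI) (auto simp: scalar_prod_def if_distrib[of "\<lambda>x. x * _"] cong: if_cong)
  with s(2) have d: "det (?S * L) \<noteq> 0" by simp
  have c: "?S * L \<in> carrier_mat r r" using L by auto
  from det_non_zero_imp_unit[OF c d, of "()"] obtain B where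
    B: "B \<in> carrier_mat r r" "B * (?S * L) = 1\<^sub>m r"
    unfolding Units_def ring_mat_def by auto
  have "B * ?S * L = B * (?S * L)" using B(1) L by (intro assoc_mult_mat_dim) auto
  with B show ?thesis by (intro exI[of _ "B * ?S"]) auto
qed

lemma mat_right_inverse:
  fixes R :: "'k::field mat"
  assumes R: "R \<in> carrier_mat r m"
    and inj: "\<And>u. (\<And>j. j < m \<Longrightarrow> (\<Sum>i<r. u i * R $$ (i, j)) = 0) \<Longrightarrow> \<forall>i<r. u i = 0"
  shows "\<exists>R'. R' \<in> carrier_mat m r \<and> R * R' = 1\<^sub>m r"
proof -
  have "\<exists>L'. L' \<in> carrier_mat r m \<and> L' * R\<^sup>T = 1\<^sub>m r"
  proof (rule mat_left_inverse)
    fix u assume u: "\<And>i. i < m \<Longrightarrow> (\<Sum>j<r. R\<^sup>T $$ (i, j) * u j) = 0"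
    show "\<forall>j<r. u j = 0" 
    proof (rule inj)
      fix j assume "j < m"
      then show "(\<Sum>i<r. u i * R $$ (i, j)) = 0" using u[of j] R by (simp add: mult.commute)
    qed
  qed (use R in auto)
  then obtain L' where L': "L' \<in> carrier_mat r m" "L' * R\<^sup>T = 1\<^sub>m r" by blast
  have "R * L'\<^sup>T = (L' * R\<^sup>T)\<^sup>T" using R L'(1) by (subst transpose_mult[of _ r m _ r]) auto
  with L' show ?thesis by (intro exI[of _ "L'\<^sup>T"]) auto
qed

lemma index_sum_prod:
  assumes "A \<in> carrier_mat m r" "B \<in> carrier_mat r p" "i < m" "j < p"
  shows "(A * B) $$ (i, j) = (\<Sum>l<r. A $$ (i, l) * B $$ (l, j))"
  using assms by (simp add: scalar_prod_def lessThan_atLeast0)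

text \<open>Column \<open>k\<close> of \<open>L\<close> is a combination of the others, so it can be
  eliminated if the rows of \<open>R\<close> absorb the relation. This is why a factorization of
  least inner dimension has full rank.\<close>

lemma drop_dependent_column:
  fixes L :: "nat \<Rightarrow> nat \<Rightarrow> 'k::field"
  assumes f: "\<And>i j. i < m \<Longrightarrow> j < p \<Longrightarrow> f i j = (\<Sum>l<r. L i l * R l j)"
    and dep: "\<And>i. i < m \<Longrightarrow> (\<Sum>l<r. L i l * u l) = 0" and u: "k < r" "u k \<noteq> 0"
  shows "\<exists>r' L' R'. r' < r \<and> (\<forall>i<m. \<forall>j<p. f i j = (\<Sum>l<r'. L' i l * (R' l j :: 'k)))"
proof -
  \<comment> \<open>The corrected row \<open>?R k\<close> is zero, so dropping the index
    \<open>k\<close> loses nothing; the correction itself contributes a multiple of the relation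
    \<open>dep\<close>.\<close>
  let ?I = "{..<r} - {k}" and ?R = "\<lambda>l j. R l j - u l / u k * R k j"
  from ex_bij_betw_nat_finite[of ?I] obtain b where
    b: "bij_betw b {..<card ?I} ?I" by (auto simp: lessThan_atLeast0)
  have "f i j = (\<Sum>l<card ?I. L i (b l) * ?R (b l) j)" if "i < m" "j < p" for i j
  proof -
    have "(\<Sum>l<card ?I. L i (b l) * ?R (b l) j) = (\<Sum>l\<in>?I. L i l * ?R l j)"
      by (rule sum.reindex_bij_betw[OF b])
    also have "\<dots> = (\<Sum>l<r. L i l * ?R l j)"
      using u by (subst sum.remove[of "{..<r}" k]) auto
    also have "\<dots> = (\<Sum>l<r. L i l * R l j) - (\<Sum>l<r. L i l * u l) * (R k j / u k)"
      unfolding sum_distrib_right sum_subtractf[symmetric]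
      by (intro sum.cong) (auto simp: algebra_simps)
    finally show ?thesis using f[OF that] dep[OF that(1)] by simp
  qed
  moreover have "card ?I < r" using u by simp
  ultimately show ?thesis
    by (intro exI[of _ "card ?I"] exI[of _ "\<lambda>i l. L i (b l)"] exI[of _ "\<lambda>l. ?R (b l)"]) blast
qed

text \<open>A factorization with the least inner dimension has factors of full rank.\<close>

lemma rank_factorization:
  fixes F :: "'k::field mat"
  assumes F: "F \<in> carrier_mat m p"
  shows "\<exists>r L R L' R'. L \<in> carrier_mat m r \<and> R \<in> carrier_mat r p \<and>
     L' \<in> carrier_mat r m \<and> R' \<in> carrier_mat p r \<and> F = L * R \<and> L' * L = 1\<^sub>m r \<and> R * R' = 1\<^sub>m r"
proof -
  define P where "P (r::nat) \<longleftrightarrow> (\<exists>L R. \<forall>i<m. \<forall>j<p. F $$ (i, j) = (\<Sum>l<r. L i l * (R l j :: 'k)))" for r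
  have "P p"
    unfolding P_def
    by (intro exI[of _ "\<lambda>i l. F $$ (i, l)"] exI[of _ "\<lambda>l j. if l = j then 1 else 0"])
      (auto simp: if_distrib cong: if_cong)
  define r where "r = (LEAST r. P r)"
  have "P r" unfolding r_def using \<open>P p\<close> by (rule LeastI)
  have least: "\<not> P r'" if "r' < r" for r' using that not_less_Least unfolding r_def by blast
  from \<open>P r\<close> obtain L R where LR: "\<And>i j. i < m \<Longrightarrow> j < p \<Longrightarrow> F $$ (i, j) = (\<Sum>l<r. L i l * (R l j :: 'k))"
    unfolding P_def by blast
  have L0: "\<forall>l<r. u l = 0" if "\<And>i. i < m \<Longrightarrow> (\<Sum>l<r. L i l * u l) = 0" for u
    using drop_dependent_column[where f = "\<lambda>i j. F $$ (i, j)" and m = m and p = p, OF LR that] least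
    unfolding P_def by (metis (full_types))
  have R0: "\<forall>l<r. u l = 0" if "\<And>j. j < p \<Longrightarrow> (\<Sum>l<r. R l j * u l) = 0" for u
  proof (rule ccontr)
    assume "\<not> (\<forall>l<r. u l = 0)"
    then obtain k where k: "k < r" "u k \<noteq> 0" by blast
    \<comment> \<open>A relation among the rows of \<open>R\<close> is one among the columns of its
      transpose, so the elimination is applied to the transposed factorization.\<close>
    have "\<exists>r' L' R'. r' < r \<and> (\<forall>j<p. \<forall>i<m. F $$ (i, j) = (\<Sum>l<r'. L' j l * (R' l i :: 'k)))"
      by (rule drop_dependent_column[where L = "\<lambda>j l. R l j" and R = "\<lambda>l i. L i l", OF _ that k])
        (auto simp: LR mult.commute)
    then obtain r' L' R' where r': "r' < r"
      "\<forall>j<p. \<forall>i<m. F $$ (i, j) = (\<Sum>l<r'. L' j l * (R' l i :: 'k))" by blast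
    have "P r'" unfolding P_def
      by (intro exI[of _ "\<lambda>i l. R' l i"] exI[of _ "\<lambda>l j. L' j l"]) (use r'(2) in \<open>simp add: mult.commute\<close>)
    with least r'(1) show False by blast
  qed
  let ?L = "mat m r (\<lambda>(i, l). L i l)" and ?R = "mat r p (\<lambda>(l, j). R l j)"
  have "\<exists>L'. L' \<in> carrier_mat r m \<and> L' * ?L = 1\<^sub>m r"
    by (rule mat_left_inverse) (use L0 in auto)
  moreover have "\<exists>R'. R' \<in> carrier_mat p r \<and> ?R * R' = 1\<^sub>m r"
    by (rule mat_right_inverse) (use R0 in \<open>auto simp: mult.commute\<close>)
  moreover have "F = ?L * ?R"
    using F by (intro eq_matI) (auto simp: LR scalar_prod_def lessThan_atLeast0)
  ultimately show ?thesis
    by (metis mat_carrier)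
qed

text \<open>If \<open>m < r\<close>, the matrix \<open>B\<close> has a nonzero kernel vector, which
  \<open>A * B = 1\<close> forbids.\<close>

lemma left_inverse_dim_le:
  fixes A :: "'k::field mat"
  assumes A: "A \<in> carrier_mat r m" and B: "B \<in> carrier_mat m r" and AB: "A * B = 1\<^sub>m r"
  shows "r \<le> m"
proof (rule ccontr)
  assume "\<not> r \<le> m"
  then obtain u where u: "\<exists>j<r. u j \<noteq> 0" "\<forall>i<m. (\<Sum>j<r. B $$ (i, j) * u j) = 0"
    using underdetermined_system[of m r "\<lambda>i j. B $$ (i, j)"] by auto
  have B0: "B *\<^sub>v vec r u = 0\<^sub>v m"
    using u(2) B by (intro eq_vecI) (auto simp: scalar_prod_def lessThan_atLeast0)
  have "vec r u = A * B *\<^sub>v vec r u" using AB by simp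
  also have "\<dots> = A *\<^sub>v (B *\<^sub>v vec r u)" by (rule assoc_mult_mat_vec[OF A B]) simp
  also have "\<dots> = 0\<^sub>v r" unfolding B0 using A by auto
  finally have "\<forall>j<r. u j = 0" by (metis index_vec index_zero_vec(1))
  with u(1) show False by blast
qed

section \<open>Algebraically closed fields: infinitude and eigenvalues\<close>

text \<open>Over a finite field, 1 plus the product of all \<open>[:-a, 1:]\<close> takes only the
  value 1, although it has positive degree.\<close>

lemma infinite_UNIV_alg_closed: "infinite (UNIV :: 'k::alg_closed_field set)"
proof
  assume fin: "finite (UNIV :: 'k set)"
  let ?p = "(\<Prod>a\<in>(UNIV::'k set). [:-a, 1:]) + 1 :: 'k poly"
  have val: "poly ?p x = 1" for x
    using fin by (simp add: poly_prod)
  have "degree (\<Prod>a\<in>(UNIV::'k set). [:-a, 1:]) = card (UNIV :: 'k set)"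
    by (subst degree_prod_eq_sum_degree) auto
  moreover have "card (UNIV :: 'k set) > 0" using fin by (simp add: card_gt_0_iff)
  ultimately have "degree ?p > 0" by (subst degree_add_eq_left) auto
  from alg_closed_imp_poly_has_root[OF this] val show False by simp
qed

text \<open>The characteristic polynomial has degree \<open>m > 0\<close>, hence a root. Subtracting
  that eigenvalue from a module endomorphism gives a non-invertible endomorphism.\<close>

lemma singular_shift:
  fixes T :: "'k::alg_closed_field mat"
  assumes T: "T \<in> carrier_mat m m" and m: "m > 0"
  shows "\<exists>c. det (T - c \<cdot>\<^sub>m 1\<^sub>m m) = 0"
proof -
  have "degree (char_poly T) > 0" using degree_monic_char_poly[OF T] m by simp
  from alg_closed_imp_poly_has_root[OF this] obtain c where "eigenvalue T c"
    using eigenvalue_root_char_poly[OF T] by blast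
  then have "det (char_matrix T c) = 0" using eigenvalue_det[OF T] by simp
  moreover have "char_matrix T c = T - c \<cdot>\<^sub>m 1\<^sub>m m"
    using T by (intro eq_matI) (auto simp: char_matrix_def)
  ultimately show ?thesis by auto
qed

section \<open>Hilbert's basis theorem\<close>

text \<open>Rings are subsets of one ambient type, so generators can be adjoined one after another
  without changing the type.\<close>

definition subring_set :: "'b::comm_ring_1 set \<Rightarrow> bool" where
  "subring_set R \<longleftrightarrow> 0 \<in> R \<and> 1 \<in> R \<and> (\<forall>x\<in>R. - x \<in> R) \<and> (\<forall>x\<in>R. \<forall>y\<in>R. x + y \<in> R \<and> x * y \<in> R)"

inductive_set ideal_span :: "'b::comm_ring_1 set \<Rightarrow> 'b set \<Rightarrow> 'b set" for R F where
  zero: "0 \<in> ideal_span R F"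
| step: "r \<in> R \<Longrightarrow> f \<in> F \<Longrightarrow> x \<in> ideal_span R F \<Longrightarrow> r * f + x \<in> ideal_span R F"

text \<open>The ascending chain condition, tested on the ideals generated by initial segments of a
  sequence. In this form it directly makes some member of a sequence of equations redundant.\<close>

definition noetherian_set :: "'b::comm_ring_1 set \<Rightarrow> bool" where
  "noetherian_set R \<longleftrightarrow> (\<forall>f :: nat \<Rightarrow> 'b. range f \<subseteq> R \<longrightarrow> (\<exists>n. f n \<in> ideal_span R (f ` {..<n})))"

lemma ideal_span_add:
  assumes "x \<in> ideal_span R F" "y \<in> ideal_span R F"
  shows "x + y \<in> ideal_span R F"
  using assms by induction (auto simp: add.assoc intro: ideal_span.step)

lemma ideal_span_mult:
  assumes "subring_set R" "r \<in> R" "x \<in> ideal_span R F"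
  shows "r * x \<in> ideal_span R F"
  using assms(3)
proof induction
  case (step s f x)
  have "r * s \<in> R" using step assms by (auto simp: subring_set_def)
  then show ?case
    using ideal_span.step[OF \<open>r * s \<in> R\<close> step.hyps(2) step.IH] by (simp add: distrib_left mult.assoc)
qed (simp add: ideal_span.zero)

lemma ideal_span_base:
  assumes "subring_set R" "f \<in> F"
  shows "f \<in> ideal_span R F"
  using ideal_span.step[of 1 R f F 0] assms by (auto simp: subring_set_def intro: ideal_span.zero)

lemma ideal_span_diff:
  assumes "subring_set R" "x \<in> ideal_span R F" "y \<in> ideal_span R F"
  shows "x - y \<in> ideal_span R F"
proof -
  have "- 1 \<in> R" using assms(1) by (auto simp: subring_set_def)
  from ideal_span_add[OF assms(2) ideal_span_mult[OF assms(1) this assms(3)]] show ?thesis by simp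
qed

lemma ideal_span_minimal:
  assumes "subring_set R" "F \<subseteq> ideal_span R G"
  shows "ideal_span R F \<subseteq> ideal_span R G"
proof
  fix x assume "x \<in> ideal_span R F"
  then show "x \<in> ideal_span R G"
    by induction (use assms in \<open>auto intro: ideal_span.zero ideal_span_add ideal_span_mult\<close>)
qed

lemma ideal_span_mono: "F \<subseteq> G \<Longrightarrow> ideal_span R F \<subseteq> ideal_span R G"
proof
  fix x assume "F \<subseteq> G" "x \<in> ideal_span R F"
  from this(2,1) show "x \<in> ideal_span R G" by induction (auto intro: ideal_span.intros)
qed

lemma ideal_span_subset:
  assumes "subring_set R" "F \<subseteq> R"
  shows "ideal_span R F \<subseteq> R"
proof
  fix x assume "x \<in> ideal_span R F"
  then show "x \<in> R" by induction (use assms in \<open>auto simp: subring_set_def\<close>)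
qed

lemma ideal_span_range_bounded:
  assumes "x \<in> ideal_span R (range f)"
  shows "\<exists>n::nat. x \<in> ideal_span R (f ` {..<n})"
  using assms
proof induction
  case (step r g x)
  then obtain n k where n: "x \<in> ideal_span R (f ` {..<n})" and k: "g = f k" by auto
  let ?N = "max n (Suc k)"
  have "x \<in> ideal_span R (f ` {..<?N})"
    by (rule subsetD[OF ideal_span_mono n]) auto
  then have "r * g + x \<in> ideal_span R (f ` {..<?N})"
    using step(1) k by (intro ideal_span.step) auto
  then show ?case by blast
qed (auto intro: ideal_span.zero)

text \<open>The values at \<open>t\<close> of the polynomials of degree less than \<open>d\<close> with coefficients in \<open>R\<close>.\<close>

primrec adjoin_below :: "'b::comm_ring_1 set \<Rightarrow> 'b \<Rightarrow> nat \<Rightarrow> 'b set" where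
  "adjoin_below R t 0 = {0}"
| "adjoin_below R t (Suc d) = {p + a * t ^ d | p a. p \<in> adjoin_below R t d \<and> a \<in> R}"

text \<open>An image of the polynomial ring over \<open>R\<close>: \<open>t\<close> may satisfy
  relations, so elements have no intrinsic coefficients, and membership in the sets
  \<open>adjoin_below R t d\<close> replaces the degree.\<close>

definition adjoin :: "'b::comm_ring_1 set \<Rightarrow> 'b \<Rightarrow> 'b set" where
  "adjoin R t = (\<Union>d. adjoin_below R t d)"

context
  fixes R :: "'b::comm_ring_1 set" and t :: 'b
  assumes R: "subring_set R"
begin

lemma adjoin_below_SucI:
  "p \<in> adjoin_below R t d \<Longrightarrow> a \<in> R \<Longrightarrow> p + a * t ^ d \<in> adjoin_below R t (Suc d)"
  by auto

lemma adjoin_below_mono: "d \<le> e \<Longrightarrow> adjoin_below R t d \<subseteq> adjoin_below R t e"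
proof (induction rule: dec_induct)
  case (step e)
  have "adjoin_below R t e \<subseteq> adjoin_below R t (Suc e)"
    using adjoin_below_SucI[of _ e 0] R by (auto simp: subring_set_def)
  with step show ?case by blast
qed simp

lemma adjoin_below_zero: "0 \<in> adjoin_below R t d"
  using adjoin_below_mono[of 0 d] by auto

lemma adjoin_below_add:
  "p \<in> adjoin_below R t d \<Longrightarrow> q \<in> adjoin_below R t d \<Longrightarrow> p + q \<in> adjoin_below R t d"
proof (induction d arbitrary: p q)
  case (Suc d)
  then obtain p' a q' b where "p = p' + a * t ^ d" "q = q' + b * t ^ d"
    "p' \<in> adjoin_below R t d" "q' \<in> adjoin_below R t d" "a \<in> R" "b \<in> R" by auto
  then show ?case
    using adjoin_below_SucI[OF Suc.IH[of p' q'], of "a + b"] R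
    by (auto simp: algebra_simps subring_set_def simp del: adjoin_below.simps)
qed simp

lemma adjoin_below_scale:
  "p \<in> adjoin_below R t d \<Longrightarrow> r \<in> R \<Longrightarrow> r * p \<in> adjoin_below R t d"
proof (induction d arbitrary: p)
  case (Suc d)
  then obtain p' a where "p = p' + a * t ^ d" "p' \<in> adjoin_below R t d" "a \<in> R" by auto
  then show ?case
    using adjoin_below_SucI[OF Suc.IH[of p'], of "r * a"] R Suc.prems
    by (auto simp: algebra_simps subring_set_def simp del: adjoin_below.simps)
qed simp

lemma adjoin_below_shift:
  "p \<in> adjoin_below R t d \<Longrightarrow> p * t ^ k \<in> adjoin_below R t (d + k)"
proof (induction d arbitrary: p)
  case 0 then show ?case by (simp add: adjoin_below_zero)
next
  case (Suc d)
  then obtain p' a where "p = p' + a * t ^ d" "p' \<in> adjoin_below R t d" "a \<in> R" by auto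
  then show ?case
    using adjoin_below_SucI[OF Suc.IH[of p'], of a]
    by (auto simp: algebra_simps power_add simp del: adjoin_below.simps)
qed

lemma adjoin_below_mult:
  "p \<in> adjoin_below R t d \<Longrightarrow> q \<in> adjoin_below R t e \<Longrightarrow> p * q \<in> adjoin_below R t (e + d)"
proof (induction d arbitrary: p)
  case 0 then show ?case by (simp add: adjoin_below_zero)
next
  case (Suc d)
  then obtain p' a where p: "p = p' + a * t ^ d" "p' \<in> adjoin_below R t d" "a \<in> R" by auto
  have "p' * q \<in> adjoin_below R t (e + Suc d)"
    using Suc.IH[OF p(2) Suc.prems(2)] adjoin_below_mono[of "e + d" "e + Suc d"] by auto
  moreover have "a * q * t ^ d \<in> adjoin_below R t (e + Suc d)"
    using adjoin_below_shift[OF adjoin_below_scale[OF Suc.prems(2) p(3)], of d]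
      adjoin_below_mono[of "e + d" "e + Suc d"] by auto
  ultimately show ?case
    using adjoin_below_add unfolding p(1) by (metis add.commute distrib_right mult.assoc mult.commute)
qed

lemma subset_adjoin: "R \<subseteq> adjoin R t"
proof
  fix r assume "r \<in> R"
  then have "r \<in> adjoin_below R t 1" by auto
  then show "r \<in> adjoin R t" unfolding adjoin_def by blast
qed

lemma mem_adjoin: "t \<in> adjoin R t"
proof -
  have "0 + 1 * t ^ 1 \<in> adjoin_below R t (Suc 1)"
    by (rule adjoin_below_SucI[OF adjoin_below_zero]) (use R in \<open>auto simp: subring_set_def\<close>)
  then have "t \<in> adjoin_below R t (Suc 1)" by (simp only: add_0_left mult_1_left power_one_right)
  then show ?thesis unfolding adjoin_def by blast
qed

lemma subring_adjoin: "subring_set (adjoin R t)"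
proof -
  have "- x \<in> adjoin R t" if "x \<in> adjoin R t" for x
    using that adjoin_below_scale[of x _ "- 1"] R by (auto simp: adjoin_def subring_set_def)
  moreover have "x + y \<in> adjoin R t \<and> x * y \<in> adjoin R t" if "x \<in> adjoin R t" "y \<in> adjoin R t" for x y
  proof -
    from that obtain d e where de: "x \<in> adjoin_below R t d" "y \<in> adjoin_below R t e"
      by (auto simp: adjoin_def)
    have "x + y \<in> adjoin_below R t (max d e)"
      using de adjoin_below_mono[of d "max d e"] adjoin_below_mono[of e "max d e"]
      by (intro adjoin_below_add) auto
    with adjoin_below_mult[OF de] show ?thesis by (auto simp: adjoin_def)
  qed
  moreover have "0 \<in> adjoin R t" "1 \<in> adjoin R t" using subset_adjoin R by (auto simp: subring_set_def)
  ultimately show ?thesis by (auto simp: subring_set_def)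
qed

lemma adjoin_power: "t ^ k \<in> adjoin R t"
  using mem_adjoin subring_adjoin by (induction k) (auto simp: subring_set_def)

text \<open>If the sequence \<open>f\<close> never enters the ideal of its predecessors, choose \<open>h n\<close> in the ideal
  of all \<open>f i\<close>, outside the ideal of \<open>h 0, \<dots>, h (n - 1)\<close>, of least degree. When the leading
  coefficient of \<open>h n\<close> is a combination of the previous ones, the degree of \<open>h n\<close> can be lowered.\<close>

theorem noetherian_adjoin:
  assumes N: "noetherian_set R"
  shows "noetherian_set (adjoin R t)"
  unfolding noetherian_set_def
proof (intro allI impI, rule ccontr)
  fix f :: "nat \<Rightarrow> 'b"
  let ?A = "adjoin R t"
  note A = subring_adjoin
  assume f: "range f \<subseteq> ?A" and "\<not> (\<exists>n. f n \<in> ideal_span ?A (f ` {..<n}))"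
  then have fn: "f n \<notin> ideal_span ?A (f ` {..<n})" for n by blast
  define I where "I = ideal_span ?A (range f)"
  \<comment> \<open>Finitely many elements of \<open>I\<close> involve only finitely many of the
    \<open>f i\<close>; if they generated \<open>I\<close>, some \<open>f N\<close> would lie in the
    ideal of its predecessors.\<close>
  have not_fg: "\<exists>x\<in>I. x \<notin> ideal_span ?A (h ` {..<n})" if h: "\<And>i. i < n \<Longrightarrow> h i \<in> I" for h and n :: nat
  proof -
    have "\<exists>N. h ` {..<n} \<subseteq> ideal_span ?A (f ` {..<N})" using h
    proof (induction n)
      case (Suc n)
      then obtain N where N: "h ` {..<n} \<subseteq> ideal_span ?A (f ` {..<N})" by auto
      obtain M where M: "h n \<in> ideal_span ?A (f ` {..<M})"
        using ideal_span_range_bounded Suc.prems[of n] unfolding I_def by blast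
      have "ideal_span ?A (f ` {..<N}) \<subseteq> ideal_span ?A (f ` {..<max N M})"
        "ideal_span ?A (f ` {..<M}) \<subseteq> ideal_span ?A (f ` {..<max N M})"
        by (intro ideal_span_mono; auto)+
      with N M have "h ` {..<Suc n} \<subseteq> ideal_span ?A (f ` {..<max N M})"
        unfolding lessThan_Suc image_insert by blast
      then show ?case by blast
    qed auto
    then obtain N where "h ` {..<n} \<subseteq> ideal_span ?A (f ` {..<N})" by blast
    from ideal_span_minimal[OF A this] fn[of N] have "f N \<notin> ideal_span ?A (h ` {..<n})" by blast
    moreover have "f N \<in> I" unfolding I_def by (intro ideal_span_base A) auto
    ultimately show ?thesis by blast
  qed
  have IA: "I \<subseteq> ?A" unfolding I_def by (rule ideal_span_subset[OF A f])
  \<comment> \<open>The number \<open>d\<close> is the least strict degree bound among the elements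
    of \<open>I\<close> outside the ideal of \<open>G\<close>, and \<open>x\<close> attains
    it.\<close>
  define Q where "Q G x d \<longleftrightarrow> x \<in> I \<and> x \<notin> ideal_span ?A G \<and> x \<in> adjoin_below R t d \<and>
     (\<forall>y\<in>I. y \<notin> ideal_span ?A G \<longrightarrow> (\<forall>d'. y \<in> adjoin_below R t d' \<longrightarrow> d \<le> d'))" for G x d
  have Qex: "\<exists>x d. Q (h ` {..<n}) x d" if "\<And>i. i < n \<Longrightarrow> h i \<in> I" for h and n :: nat
  proof -
    let ?P = "\<lambda>d. \<exists>x\<in>I. x \<notin> ideal_span ?A (h ` {..<n}) \<and> x \<in> adjoin_below R t d"
    from not_fg[of n h, OF that] obtain y where y: "y \<in> I" "y \<notin> ideal_span ?A (h ` {..<n})" by blast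
    with IA obtain e where "y \<in> adjoin_below R t e" by (auto simp: adjoin_def)
    with y have "?P e" by blast
    define d where "d = (LEAST d. ?P d)"
    have "?P d" unfolding d_def using \<open>?P e\<close> by (rule LeastI)
    moreover have "d \<le> d'" if "?P d'" for d' unfolding d_def using that by (rule Least_le)
    ultimately show ?thesis unfolding Q_def by blast
  qed
  \<comment> \<open>Each choice depends on all earlier elements, so the pairs of element and bound
    are built by well-founded recursion.\<close>
  have "\<exists>H. \<forall>n::nat. Q ((\<lambda>i. fst (H i)) ` {..<n}) (fst (H n)) (snd (H n))"
  proof (rule dependent_wf_choice[OF wf_less_than, of "\<lambda>H n z. Q ((\<lambda>i. fst (H i)) ` {..<n}) (fst z) (snd z)"])
    fix H :: "nat \<Rightarrow> 'b \<times> nat" and H' n r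
    assume "\<And>z. (z, n) \<in> less_than \<Longrightarrow> H z = H' z"
    then have "(\<lambda>i. fst (H i)) ` {..<n} = (\<lambda>i. fst (H' i)) ` {..<n}" by (intro image_cong) auto
    then show "Q ((\<lambda>i. fst (H i)) ` {..<n}) (fst r) (snd r) = Q ((\<lambda>i. fst (H' i)) ` {..<n}) (fst r) (snd r)"
      by simp
  next
    fix n and H :: "nat \<Rightarrow> 'b \<times> nat"
    assume "\<And>k. (k, n) \<in> less_than \<Longrightarrow> Q ((\<lambda>i. fst (H i)) ` {..<k}) (fst (H k)) (snd (H k))"
    then have "\<And>k. k < n \<Longrightarrow> fst (H k) \<in> I" by (auto simp: Q_def)
    from Qex[of n "\<lambda>i. fst (H i)", OF this]
    show "\<exists>z. Q ((\<lambda>i. fst (H i)) ` {..<n}) (fst z) (snd z)" by simp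
  qed
  then obtain H where H: "\<And>n::nat. Q ((\<lambda>i. fst (H i)) ` {..<n}) (fst (H n)) (snd (H n))" by blast
  define h where "h n = fst (H n)" for n
  define d where "d n = snd (H n)" for n
  have Q: "Q (h ` {..<n}) (h n) (d n)" for n using H[of n] unfolding h_def d_def .
  have hI: "h n \<in> I" and hnot: "h n \<notin> ideal_span ?A (h ` {..<n})" and hd: "h n \<in> adjoin_below R t (d n)"
    and hmin: "\<And>y d'. y \<in> I \<Longrightarrow> y \<notin> ideal_span ?A (h ` {..<n}) \<Longrightarrow> y \<in> adjoin_below R t d' \<Longrightarrow> d n \<le> d'"
    for n using Q[of n] unfolding Q_def by auto
  \<comment> \<open>\<open>h n\<close> also avoids the smaller ideal of the \<open>h j\<close> with
    \<open>j < i\<close>, so it competes in the minimum defining \<open>d i\<close>.\<close>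
  have dmono: "d i \<le> d n" if "i \<le> n" for i n
  proof (rule hmin[OF hI _ hd])
    show "h n \<notin> ideal_span ?A (h ` {..<i})"
      using hnot[of n] ideal_span_mono[OF image_mono[of "{..<i}" "{..<n}" h]] that by auto
  qed
  \<comment> \<open>The bound is strict, so 0 admits only the zero element; thus
    \<open>d n - 1\<close> is a true exponent, that of the top coefficient
    \<open>a n\<close>.\<close>
  have d0: "d n \<noteq> 0" for n
  proof
    assume "d n = 0"
    then have "h n = 0" using hd[of n] by simp
    with hnot[of n] show False by (simp add: ideal_span.zero)
  qed
  have "\<exists>p a. h n = p + a * t ^ (d n - 1) \<and> p \<in> adjoin_below R t (d n - 1) \<and> a \<in> R" for n
    using hd[of n] d0[of n] by (cases "d n") auto
  then obtain p a where pa: "\<And>n. h n = p n + a n * t ^ (d n - 1)"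
    "\<And>n. p n \<in> adjoin_below R t (d n - 1)" "\<And>n. a n \<in> R" by metis
  from N obtain n where n: "a n \<in> ideal_span R (a ` {..<n})"
    unfolding noetherian_set_def using pa(3) by (metis image_subsetI)
  \<comment> \<open>A relation between leading coefficients is lifted to the \<open>h i\<close>:
    multiplying \<open>h i\<close> by \<open>t ^ (d n - d i)\<close> moves its top term to exponent
    \<open>d n - 1\<close>. By \<open>dmono\<close> the difference is not truncated.\<close>
  have "\<exists>g. g \<in> ideal_span ?A (h ` {..<n}) \<and> g - x * t ^ (d n - 1) \<in> adjoin_below R t (d n - 1)"
    if "x \<in> ideal_span R (a ` {..<n})" for x
    using that
  proof induction
    case zero
    show ?case by (rule exI[of _ 0]) (auto intro: ideal_span.zero adjoin_below_zero)
  next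
    case (step r b x)
    then obtain g i where g: "g \<in> ideal_span ?A (h ` {..<n})"
      "g - x * t ^ (d n - 1) \<in> adjoin_below R t (d n - 1)" and i: "i < n" "b = a i" by auto
    let ?k = "d n - d i"
    have k: "d n - 1 = (d i - 1) + ?k" using dmono[of i n] i d0[of i] by simp
    have "r * t ^ ?k \<in> ?A"
      using A subset_adjoin step(1) adjoin_power[of ?k] by (auto simp: subring_set_def)
    then have 1: "r * t ^ ?k * h i + g \<in> ideal_span ?A (h ` {..<n})"
      using i g(1) by (intro ideal_span.step) auto
    have 2: "r * p i * t ^ ?k \<in> adjoin_below R t (d n - 1)"
      unfolding k by (intro adjoin_below_shift adjoin_below_scale pa step(1))
    have tk: "t ^ (d n - 1) = t ^ (d i - 1) * t ^ ?k" by (subst k, rule power_add)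
    have "r * t ^ ?k * h i + g - (r * b + x) * t ^ (d n - 1) =
       r * p i * t ^ ?k + (g - x * t ^ (d n - 1))"
      unfolding pa(1)[of i] i(2) tk by (simp add: algebra_simps)
    also have "\<dots> \<in> adjoin_below R t (d n - 1)" by (rule adjoin_below_add[OF 2 g(2)])
    finally show ?case using 1 by blast
  qed
  from this[OF n] obtain g where g: "g \<in> ideal_span ?A (h ` {..<n})"
    "g - a n * t ^ (d n - 1) \<in> adjoin_below R t (d n - 1)" by blast
  \<comment> \<open>The top terms cancel, but \<open>?y\<close> stays outside the ideal since
    \<open>g\<close> lies in it; this contradicts the minimality of \<open>d n\<close>.\<close>
  let ?y = "h n - g"
  have "g \<in> I" using ideal_span_minimal[OF A, of "h ` {..<n}" "range f"] hI g(1) unfolding I_def by blast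
  then have "?y \<in> I" using hI unfolding I_def by (intro ideal_span_diff A)
  moreover have "?y \<notin> ideal_span ?A (h ` {..<n})"
    using hnot[of n] ideal_span_add[OF _ g(1), of ?y] by auto
  moreover have "?y \<in> adjoin_below R t (d n - 1)"
  proof -
    have "- 1 \<in> R" using R by (auto simp: subring_set_def)
    from adjoin_below_add[OF pa(2) adjoin_below_scale[OF g(2) this]]
    have "p n + - 1 * (g - a n * t ^ (d n - 1)) \<in> adjoin_below R t (d n - 1)" .
    then show ?thesis using pa(1)[of n] by (simp add: algebra_simps)
  qed
  ultimately have "d n \<le> d n - 1" by (rule hmin)
  with d0[of n] show False by simp
qed

end

section \<open>Homomorphisms\<close>

lemma modulesD:
  assumes "X \<in> modules scale m"
  shows "X a \<in> carrier_mat m m" "X (a + b) = X a + X b" "X (scale c a) = c \<cdot>\<^sub>m X a"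
    "X (a * b) = X a * X b" "X 1 = 1\<^sub>m m" "mdim X = m"
  using assms by (auto simp: modules_def mdim_def)

lemma modules_is_module: "X \<in> modules scale m \<Longrightarrow> is_module scale X"
  by (auto simp: is_module_def)

lemma mem_Hom_iff:
  assumes "X \<in> modules scale m" "Y \<in> modules scale p"
  shows "T \<in> Hom X Y \<longleftrightarrow> T \<in> carrier_mat p m \<and> (\<forall>a. T * X a = Y a * T)"
  using assms by (auto simp: Hom_def modulesD)

lemma zero_mem_Hom:
  assumes "X \<in> modules scale m" "Y \<in> modules scale p"
  shows "0\<^sub>m p m \<in> Hom X Y"
  by (simp add: mem_Hom_iff[OF assms] left_mult_zero_mat[OF modulesD(1)[OF assms(1)]]
      right_mult_zero_mat[OF modulesD(1)[OF assms(2)]])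

lemma Hom_zero_iff:
  assumes "X \<in> modules scale m" "Y \<in> modules scale p"
  shows "Hom_zero X Y \<longleftrightarrow> (\<forall>T\<in>Hom X Y. T = 0\<^sub>m p m)"
  using zero_mem_Hom[OF assms] assms by (auto simp: Hom_zero_def modulesD)

lemma Hom_comp:
  assumes X: "X \<in> modules scale m" and Y: "Y \<in> modules scale p" and Z: "Z \<in> modules scale q"
    and T: "T \<in> Hom X Y" and U: "U \<in> Hom Y Z"
  shows "U * T \<in> Hom X Z"
proof -
  have cT: "T \<in> carrier_mat p m" "\<And>a. T * X a = Y a * T"
    and cU: "U \<in> carrier_mat q p" "\<And>a. U * Y a = Z a * U"
    using T U by (auto simp: mem_Hom_iff[OF X Y] mem_Hom_iff[OF Y Z])
  note car = modulesD(1)[OF X] modulesD(1)[OF Y] modulesD(1)[OF Z]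
  have "U * T * X a = Z a * (U * T)" for a
  proof -
    have "U * T * X a = U * (T * X a)" by (rule assoc_mult_mat[OF cU(1) cT(1) car(1)])
    also have "\<dots> = U * Y a * T" unfolding cT(2) by (rule assoc_mult_mat[symmetric, OF cU(1) car(2) cT(1)])
    also have "\<dots> = Z a * (U * T)" unfolding cU(2) by (rule assoc_mult_mat[OF car(3) cU(1) cT(1)])
    finally show ?thesis .
  qed
  then show ?thesis using cT(1) cU(1) by (auto simp: mem_Hom_iff[OF X Z])
qed

lemma one_mem_Hom: "X \<in> modules scale m \<Longrightarrow> 1\<^sub>m m \<in> Hom X X"
  using modulesD(1)[of X scale m] by (auto simp: mem_Hom_iff left_mult_one_mat[of _ m m] right_mult_one_mat[of _ m m])

lemma smult_one_mem_Hom: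
  assumes X: "X \<in> modules scale m"
  shows "c \<cdot>\<^sub>m 1\<^sub>m m \<in> Hom X X"
proof -
  have "c \<cdot>\<^sub>m 1\<^sub>m m * X a = X a * (c \<cdot>\<^sub>m 1\<^sub>m m)" for a
    using modulesD(1)[OF X, of a]
    by (simp add: mult_smult_assoc_mat[of _ m m _ m] mult_smult_distrib[of _ m m _ m])
  then show ?thesis by (simp add: mem_Hom_iff[OF X X])
qed

lemma Hom_diff:
  assumes X: "X \<in> modules scale m" and Y: "Y \<in> modules scale p"
    and T: "T \<in> Hom X Y" and U: "U \<in> Hom X Y"
  shows "T - U \<in> Hom X Y"
proof -
  have c: "T \<in> carrier_mat p m" "U \<in> carrier_mat p m" "\<And>a. T * X a = Y a * T" "\<And>a. U * X a = Y a * U"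
    using T U by (auto simp: mem_Hom_iff[OF X Y])
  have "(T - U) * X a = Y a * (T - U)" for a
    by (simp add: minus_mult_distrib_mat[OF c(1,2) modulesD(1)[OF X]]
        mult_minus_distrib_mat[OF modulesD(1)[OF Y] c(1,2)] c(3,4))
  then show ?thesis using c by (auto simp: mem_Hom_iff[OF X Y])
qed

text \<open>\<open>invertible_mat\<close> leaves the shape of the inverse open; comparing dimensions
  with the identity matrices fixes it. Multiplying the intertwining relation by the inverse on both
  sides then shows that the inverse is a homomorphism.\<close>

lemma mod_iso_inverse:
  assumes X: "X \<in> modules scale m" and Y: "Y \<in> modules scale p" and iso: "mod_iso X Y"
  shows "\<exists>T T'. T \<in> Hom X Y \<and> T' \<in> Hom Y X \<and> T * T' = 1\<^sub>m p \<and> T' * T = 1\<^sub>m m \<and> p = m"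
proof -
  from iso obtain T where T: "T \<in> Hom X Y" "invertible_mat T" by (auto simp: mod_iso_def)
  then have c: "T \<in> carrier_mat p m" "\<And>a. T * X a = Y a * T" by (auto simp: mem_Hom_iff[OF X Y])
  from T(2) obtain B where pm: "p = m" and B: "T * B = 1\<^sub>m p" "B * T = 1\<^sub>m (dim_row B)"
    using c(1) by (auto simp: invertible_mat_def inverts_mat_def)
  have "dim_col B = p" using arg_cong[OF B(1), of dim_col] by simp
  moreover have "dim_row B = m" using arg_cong[OF B(2), of dim_col] c(1) by simp
  ultimately have cB: "B \<in> carrier_mat m p" by auto
  have BT: "B * T = 1\<^sub>m m" using B(2) cB by simp
  have "B * Y a = X a * B" for a
  proof -
    note car = modulesD(1)[OF X, of a] modulesD(1)[OF Y, of a]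
    have "B * Y a = B * (Y a * (T * B))" unfolding B(1) using car cB by simp
    also have "\<dots> = B * (T * X a * B)" using assoc_mult_mat[OF car(2) c(1) cB] unfolding c(2) by simp
    also have "\<dots> = B * T * (X a * B)"
      using car cB c(1) by (simp add: assoc_mult_mat_dim)
    also have "\<dots> = X a * B" unfolding BT using car cB by simp
    finally show ?thesis .
  qed
  then have "B \<in> Hom Y X" using cB by (auto simp: mem_Hom_iff[OF Y X])
  with T(1) B(1) BT pm show ?thesis by blast
qed

lemma mod_isoI:
  assumes X: "X \<in> modules scale m" and Y: "Y \<in> modules scale m"
    and T: "T \<in> Hom X Y" and B: "B \<in> carrier_mat m m" "T * B = 1\<^sub>m m"
  shows "mod_iso X Y"
proof -
  have c: "T \<in> carrier_mat m m" using T by (auto simp: mem_Hom_iff[OF X Y])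
  have BT: "B * T = 1\<^sub>m m" by (rule mat_mult_left_right_inverse[OF c B])
  have "dim_row T = m" "dim_row B = m" "square_mat T" using c B(1) by auto
  then have "invertible_mat T"
    unfolding invertible_mat_def inverts_mat_def using B(2) BT by (intro conjI exI[of _ B]) simp_all
  then show ?thesis using T by (auto simp: mod_iso_def)
qed

lemma mod_iso_refl:
  assumes X: "X \<in> modules scale m"
  shows "mod_iso X X"
  by (rule mod_isoI[OF X X one_mem_Hom[OF X] one_carrier_mat]) simp

lemma mod_iso_sym:
  assumes X: "X \<in> modules scale m" and Y: "Y \<in> modules scale p" and iso: "mod_iso X Y"
  shows "mod_iso Y X"
proof -
  obtain T T' where T: "T \<in> Hom X Y" "T' \<in> Hom Y X" "T' * T = 1\<^sub>m m" "p = m"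
    using mod_iso_inverse[OF X Y iso] by blast
  have Y': "Y \<in> modules scale m" using Y T(4) by simp
  show ?thesis
    using mod_isoI[OF Y' X T(2) _ T(3)] T(1) by (simp add: mem_Hom_iff[OF X Y'])
qed

lemma mod_iso_trans:
  assumes X: "X \<in> modules scale m" and Y: "Y \<in> modules scale p" and Z: "Z \<in> modules scale q"
    and XY: "mod_iso X Y" and YZ: "mod_iso Y Z"
  shows "mod_iso X Z"
proof -
  obtain T T' where T: "T \<in> Hom X Y" "T' \<in> Hom Y X" "T * T' = 1\<^sub>m p" "p = m"
    using mod_iso_inverse[OF X Y XY] by blast
  obtain U U' where U: "U \<in> Hom Y Z" "U' \<in> Hom Z Y" "U * U' = 1\<^sub>m q" "q = p"
    using mod_iso_inverse[OF Y Z YZ] by blast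
  have Y': "Y \<in> modules scale m" and Z': "Z \<in> modules scale m" using Y Z T(4) U(4) by auto
  have c: "T \<in> carrier_mat m m" "T' \<in> carrier_mat m m" "U \<in> carrier_mat m m" "U' \<in> carrier_mat m m"
    using T(1,2) U(1,2) by (auto simp: mem_Hom_iff[OF X Y'] mem_Hom_iff[OF Y' X] mem_Hom_iff[OF Y' Z'] mem_Hom_iff[OF Z' Y'])
  have "U * T * (T' * U') = U * (T * T') * U'"
    using c by (simp add: assoc_mult_mat_dim)
  also have "\<dots> = 1\<^sub>m m" using T(3,4) U(3,4) c by simp
  finally show ?thesis
    using c by (intro mod_isoI[OF X Z' Hom_comp[OF X Y Z T(1) U(1)], of "T' * U'"]) auto
qed

lemma Hom_zero_iso:
  assumes X: "X \<in> modules scale m" and Y: "Y \<in> modules scale p"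
    and X': "X' \<in> modules scale m'" and Y': "Y' \<in> modules scale p'"
    and iX: "mod_iso X X'" and iY: "mod_iso Y Y'" and z: "Hom_zero X Y"
  shows "Hom_zero X' Y'"
  unfolding Hom_zero_iff[OF X' Y']
proof
  fix T assume T: "T \<in> Hom X' Y'"
  obtain A A' where A: "A \<in> Hom X X'" "A' \<in> Hom X' X" "A * A' = 1\<^sub>m m'" "m' = m"
    using mod_iso_inverse[OF X X' iX] by blast
  obtain B B' where B: "B \<in> Hom Y Y'" "B' \<in> Hom Y' Y" "B * B' = 1\<^sub>m p'" "p' = p"
    using mod_iso_inverse[OF Y Y' iY] by blast
  have c: "A \<in> carrier_mat m m" "A' \<in> carrier_mat m m" "B \<in> carrier_mat p p" "B' \<in> carrier_mat p p"
    "T \<in> carrier_mat p m"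
    using A B T by (auto simp: mem_Hom_iff[OF X X'] mem_Hom_iff[OF X' X] mem_Hom_iff[OF Y Y'] 
        mem_Hom_iff[OF Y' Y] mem_Hom_iff[OF X' Y'])
  have "B' * (T * A) \<in> Hom X Y"
    by (rule Hom_comp[OF X Y' Y Hom_comp[OF X X' Y' A(1) T] B(2)])
  then have 0: "B' * (T * A) = 0\<^sub>m p m" using z by (simp add: Hom_zero_iff[OF X Y])
  have "T = B * B' * T * (A * A')" using A(3,4) B(3,4) c by simp
  also have "\<dots> = B * (B' * (T * A)) * A'" using c by (simp add: assoc_mult_mat_dim)
  also have "\<dots> = 0\<^sub>m p m" unfolding 0 using c by simp
  finally show "T = 0\<^sub>m p' m'" using A(4) B(4) by simp
qed

lemma iso_class_eq_iff:
  assumes X: "X \<in> modules scale m" and Y: "Y \<in> modules scale p"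
  shows "iso_class scale X = iso_class scale Y \<longleftrightarrow> mod_iso X Y"
proof
  assume "iso_class scale X = iso_class scale Y"
  moreover have "Y \<in> iso_class scale Y"
    using mod_iso_refl[OF Y] modules_is_module[OF Y] by (simp add: iso_class_def)
  ultimately show "mod_iso X Y" by (auto simp: iso_class_def)
next
  assume XY: "mod_iso X Y"
  show "iso_class scale X = iso_class scale Y"
    using mod_iso_trans[OF X Y _ XY] mod_iso_trans[OF Y X _ mod_iso_sym[OF X Y XY]]
    by (auto simp: iso_class_def is_module_def)
qed

section \<open>Bricks as common quotients and submodules\<close>

text \<open>Linearity and \<open>f 1 = 1\<close> force \<open>f c\<close> to be the scalar matrix of
  \<open>c\<close>; injectivity of \<open>f\<close> excludes \<open>m = 0\<close>, where all scalar
  matrices coincide.\<close>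

lemma brick_iff:
  fixes X :: "'a::ring_1 \<Rightarrow> 'k::field mat"
  assumes X: "X \<in> modules scale m"
  shows "brick scale X \<longleftrightarrow> m > 0 \<and> (\<forall>T\<in>Hom X X. \<exists>c. T = c \<cdot>\<^sub>m 1\<^sub>m m)"
proof
  assume "brick scale X"
  then obtain f :: "'k \<Rightarrow> 'k mat" where f: "bij_betw f UNIV (Hom X X)" "\<And>c x. f (c * x) = c \<cdot>\<^sub>m f x" "f 1 = 1\<^sub>m m"
    using X by (auto simp: brick_def End_iso_field_def modulesD)
  have fc: "f c = c \<cdot>\<^sub>m 1\<^sub>m m" for c using f(2)[of c 1] f(3) by simp
  have "m > 0"
  proof (rule ccontr)
    assume "\<not> m > 0"
    then have "f 0 = f 1" unfolding fc by (intro eq_matI) auto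
    with f(1) show False by (auto simp: bij_betw_def dest: injD)
  qed
  moreover have "\<forall>T\<in>Hom X X. \<exists>c. T = c \<cdot>\<^sub>m 1\<^sub>m m"
    using f(1) fc by (auto simp: bij_betw_def)
  ultimately show "m > 0 \<and> (\<forall>T\<in>Hom X X. \<exists>c. T = c \<cdot>\<^sub>m 1\<^sub>m m)" ..
next
  assume *: "m > 0 \<and> (\<forall>T\<in>Hom X X. \<exists>c. T = c \<cdot>\<^sub>m 1\<^sub>m m)"
  let ?f = "\<lambda>c::'k. c \<cdot>\<^sub>m 1\<^sub>m m"
  have "inj ?f"
  proof (rule injI)
    fix x y :: 'k assume "x \<cdot>\<^sub>m 1\<^sub>m m = y \<cdot>\<^sub>m 1\<^sub>m m"
    from arg_cong[OF this, of "\<lambda>M. M $$ (0, 0)"] * show "x = y" by simp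
  qed
  moreover have "range ?f = Hom X X" using * smult_one_mem_Hom[OF X] by auto
  ultimately have "bij_betw ?f UNIV (Hom X X)" by (simp add: bij_betw_def)
  moreover have smult: "?f (x * y) = x \<cdot>\<^sub>m ?f y" for x y
    by (intro eq_matI) auto
  moreover have "?f (x * y) = ?f x * ?f y" for x y
    unfolding smult by (simp add: mult_smult_assoc_mat[of _ m m _ m])
  moreover have "?f 1 = 1\<^sub>m m" by (intro eq_matI) auto
  ultimately have "End_iso_field X"
    unfolding End_iso_field_def modulesD(6)[OF X]
    by (intro exI[of _ ?f]) (simp add: add_smult_distrib_right_mat[of _ m m])
  then show "brick scale X" using X by (auto simp: brick_def is_module_def)
qed

text \<open>The one-sided inverse is only a matrix, not a homomorphism: over a field, surjectivity
  amounts to a linear splitting, which can be composed and cancelled. \<open>Monos\<close> treats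
  injectivity in the same way.\<close>

definition Epis :: "('a::ring_1 \<Rightarrow> 'k::field mat) \<Rightarrow> ('a \<Rightarrow> 'k mat) \<Rightarrow> 'k mat set" where
  "Epis X Y = {R \<in> Hom X Y. \<exists>R'\<in>carrier_mat (mdim X) (mdim Y). R * R' = 1\<^sub>m (mdim Y)}"

definition Monos :: "('a::ring_1 \<Rightarrow> 'k::field mat) \<Rightarrow> ('a \<Rightarrow> 'k mat) \<Rightarrow> 'k mat set" where
  "Monos X Y = {L \<in> Hom X Y. \<exists>L'\<in>carrier_mat (mdim X) (mdim Y). L' * L = 1\<^sub>m (mdim X)}"

lemma Epi_comp:
  assumes X: "X \<in> modules scale m" and Y: "Y \<in> modules scale p" and Z: "Z \<in> modules scale q"
    and T: "T \<in> Epis X Y" and U: "U \<in> Epis Y Z"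
  shows "U * T \<in> Epis X Z"
proof -
  obtain T' where T': "T' \<in> carrier_mat m p" "T * T' = 1\<^sub>m p" and T: "T \<in> Hom X Y"
    using T by (auto simp: Epis_def modulesD(6)[OF X] modulesD(6)[OF Y])
  obtain U' where U': "U' \<in> carrier_mat p q" "U * U' = 1\<^sub>m q" and U: "U \<in> Hom Y Z"
    using U by (auto simp: Epis_def modulesD(6)[OF Y] modulesD(6)[OF Z])
  have c: "T \<in> carrier_mat p m" "U \<in> carrier_mat q p"
    using T U by (auto simp: mem_Hom_iff[OF X Y] mem_Hom_iff[OF Y Z])
  have "U * T * (T' * U') = U * (T * T') * U'" using c T'(1) U'(1) by (simp add: assoc_mult_mat_dim)
  also have "\<dots> = 1\<^sub>m q" using T' U' c by simp
  finally show ?thesis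
    using Hom_comp[OF X Y Z T U] T' U'
    unfolding Epis_def modulesD(6)[OF X] modulesD(6)[OF Z] by (auto intro!: bexI[of _ "T' * U'"])
qed

lemma Mono_comp:
  assumes X: "X \<in> modules scale m" and Y: "Y \<in> modules scale p" and Z: "Z \<in> modules scale q"
    and T: "T \<in> Monos X Y" and U: "U \<in> Monos Y Z"
  shows "U * T \<in> Monos X Z"
proof -
  obtain T' where T': "T' \<in> carrier_mat m p" "T' * T = 1\<^sub>m m" and T: "T \<in> Hom X Y"
    using T by (auto simp: Monos_def modulesD(6)[OF X] modulesD(6)[OF Y])
  obtain U' where U': "U' \<in> carrier_mat p q" "U' * U = 1\<^sub>m p" and U: "U \<in> Hom Y Z"
    using U by (auto simp: Monos_def modulesD(6)[OF Y] modulesD(6)[OF Z])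
  have c: "T \<in> carrier_mat p m" "U \<in> carrier_mat q p"
    using T U by (auto simp: mem_Hom_iff[OF X Y] mem_Hom_iff[OF Y Z])
  have "T' * U' * (U * T) = T' * (U' * U * T)" using c T'(1) U'(1) by (simp add: assoc_mult_mat_dim)
  also have "\<dots> = 1\<^sub>m m" using T' U' c by simp
  finally show ?thesis
    using Hom_comp[OF X Y Z T U] T' U'
    unfolding Monos_def modulesD(6)[OF X] modulesD(6)[OF Z] by (auto intro!: bexI[of _ "T' * U'"])
qed

lemma one_mem_Epi_Mono:
  assumes X: "X \<in> modules scale m"
  shows "1\<^sub>m m \<in> Epis X X" "1\<^sub>m m \<in> Monos X X"
  using one_mem_Hom[OF X] modulesD(6)[OF X] by (auto simp: Epis_def Monos_def intro!: bexI[of _ "1\<^sub>m m"])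

text \<open>A rank factorization \<open>T = L * R\<close> identifies the image with the space of
  dimension \<open>r\<close>. The action is transported by \<open>M a = R * X a * R'\<close>, and
  the one-sided inverses show that \<open>R\<close> and \<open>L\<close> respect it.\<close>

lemma Hom_image:
  fixes X Y :: "'a::ring_1 \<Rightarrow> 'k::field mat"
  assumes X: "X \<in> modules scale m" and Y: "Y \<in> modules scale p" and T: "T \<in> Hom X Y"
  shows "\<exists>r M L R. M \<in> modules scale r \<and> R \<in> Epis X M \<and> L \<in> Monos M Y \<and> T = L * R"
proof -
  have cT: "T \<in> carrier_mat p m" "\<And>a. T * X a = Y a * T" using T by (auto simp: mem_Hom_iff[OF X Y])
  obtain r L R L' R' where c: "L \<in> carrier_mat p r" "R \<in> carrier_mat r m" "L' \<in> carrier_mat r p"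
    "R' \<in> carrier_mat m r" and LR: "T = L * R" "L' * L = 1\<^sub>m r" "R * R' = 1\<^sub>m r"
    using rank_factorization[OF cT(1)] by blast
  note cX = modulesD(1)[OF X] and cY = modulesD(1)[OF Y]
  define M where "M a = R * X a * R'" for a
  have cM: "M a \<in> carrier_mat r r" for a unfolding M_def using c cX[of a] by auto
  \<comment> \<open>Inserting \<open>L' * L\<close> produces \<open>T * X a\<close>, to which the
    intertwining relation applies; so \<open>R\<close> is equivariant for the action
    \<open>L' * Y a * L\<close>.\<close>
  have RX: "R * X a = L' * Y a * L * R" for a
  proof -
    have "R * X a = L' * L * R * X a" using c cX[of a] LR(2) by simp
    also have "\<dots> = L' * (T * X a)" using c cX[of a] LR(1) by (simp add: assoc_mult_mat_dim)
    also have "\<dots> = L' * Y a * L * R" unfolding cT(2) using c cY[of a] LR(1) by (simp add: assoc_mult_mat_dim)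
    finally show ?thesis .
  qed
  have M2: "M a = L' * Y a * L" for a
  proof -
    have "M a = L' * Y a * L * (R * R')" unfolding M_def RX using c cY[of a] by (simp add: assoc_mult_mat_dim)
    then show ?thesis using LR(3) c cY[of a] by simp
  qed
  have MR: "M a * R = R * X a" for a unfolding M2 RX ..
  have LM: "L * M a = Y a * L" for a
  proof -
    have "L * M a = T * X a * R'" unfolding M_def LR(1) using c cX[of a] by (simp add: assoc_mult_mat_dim)
    also have "\<dots> = Y a * T * R'" unfolding cT(2) ..
    also have "\<dots> = Y a * L * (R * R')" unfolding LR(1) using c cY[of a] by (simp add: assoc_mult_mat_dim)
    also have "\<dots> = Y a * L" using LR(3) c cY[of a] by simp
    finally show ?thesis .
  qed
  have "M (a * b) = M a * M b" for a b
  proof -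
    have "M (a * b) = R * X a * (X b * R')"
      unfolding M_def modulesD(4)[OF X] using c cX[of a] cX[of b] by (simp add: assoc_mult_mat_dim)
    also have "\<dots> = M a * R * (X b * R')" unfolding MR ..
    also have "\<dots> = M a * (R * X b * R')"
      using c cM[of a] cX[of b] by (simp add: assoc_mult_mat_dim)
    finally show ?thesis by (simp add: M_def)
  qed
  moreover have "M (a + b) = M a + M b" for a b
    unfolding M_def modulesD(2)[OF X]
    using c cX[of a] cX[of b]
    by (simp add: mult_add_distrib_mat[of _ r m _ m] add_mult_distrib_mat[of _ r m _ _ r])
  moreover have "M (scale k a) = k \<cdot>\<^sub>m M a" for k a
    unfolding M_def modulesD(3)[OF X]
    using c cX[of a]
    by (simp add: mult_smult_distrib[of _ r m _ m] mult_smult_assoc_mat[of _ r m _ r])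
  moreover have "M 1 = 1\<^sub>m r" unfolding M_def modulesD(5)[OF X] using c LR(3) by simp
  ultimately have M: "M \<in> modules scale r" using cM by (simp add: modules_def)
  have "R \<in> Epis X M" "L \<in> Monos M Y"
    using c LR MR LM unfolding Epis_def Monos_def mem_Hom_iff[OF X M] mem_Hom_iff[OF M Y]
      modulesD(6)[OF X] modulesD(6)[OF Y] modulesD(6)[OF M] by auto
  with M LR(1) show ?thesis by blast
qed

lemma Epi_dim_le:
  assumes X: "X \<in> modules scale m" and Y: "Y \<in> modules scale p" and T: "T \<in> Epis X Y"
  shows "p \<le> m"
  using T left_inverse_dim_le[of T p m]
  by (auto simp: Epis_def modulesD(6)[OF X] modulesD(6)[OF Y] mem_Hom_iff[OF X Y])

text \<open>If \<open>M\<close> is not a brick, subtract an eigenvalue from a non-scalar endomorphism: the image of the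
  difference is a smaller quotient of \<open>M\<close> that is also a submodule.\<close>

lemma brick_quotient_and_submodule:
  fixes M :: "'a::ring_1 \<Rightarrow> 'k::alg_closed_field mat"
  assumes "M \<in> modules scale m" "m > 0"
  shows "\<exists>b B. 0 < b \<and> b \<le> m \<and> B \<in> modules scale b \<and> brick scale B \<and> Epis M B \<noteq> {} \<and> Monos B M \<noteq> {}"
  using assms
proof (induction m arbitrary: M rule: less_induct)
  case (less m)
  note M = less.prems(1)
  show ?case
  proof (cases "brick scale M")
    case True
    then show ?thesis using less.prems one_mem_Epi_Mono[OF M] by blast
  next
    case False
    then obtain T where T: "T \<in> Hom M M" "\<And>c. T \<noteq> c \<cdot>\<^sub>m 1\<^sub>m m"
      using brick_iff[OF M] less.prems(2) by auto
    have cT: "T \<in> carrier_mat m m" using T(1) by (auto simp: mem_Hom_iff[OF M M])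
    obtain c where c: "det (T - c \<cdot>\<^sub>m 1\<^sub>m m) = 0" using singular_shift[OF cT less.prems(2)] by blast
    let ?U = "T - c \<cdot>\<^sub>m 1\<^sub>m m"
    have U: "?U \<in> Hom M M" by (rule Hom_diff[OF M M T(1) smult_one_mem_Hom[OF M]])
    from Hom_image[OF M M U] obtain r N L R where N: "N \<in> modules scale r" "R \<in> Epis M N" "L \<in> Monos N M"
      "?U = L * R" by blast
    then obtain L' R' where LR: "L \<in> carrier_mat m r" "R \<in> carrier_mat r m" 
      "L' \<in> carrier_mat r m" "L' * L = 1\<^sub>m r" "R' \<in> carrier_mat m r" "R * R' = 1\<^sub>m r"
      by (auto simp: Epis_def Monos_def modulesD(6)[OF M] modulesD(6)[OF N(1)] mem_Hom_iff[OF M N(1)] mem_Hom_iff[OF N(1) M])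
    \<comment> \<open>With \<open>r = m\<close> both factors would be invertible, yet the shift by
      an eigenvalue is singular; \<open>r = 0\<close> would make \<open>T\<close> scalar. So the
      induction hypothesis applies to the image.\<close>
    have "r \<noteq> m"
    proof
      assume rm: "r = m"
      have "det L' * det L = 1" "det R * det R' = 1"
        using det_mult[OF LR(3,1)[unfolded rm]] det_mult[OF LR(2,5)[unfolded rm]] LR(4,6) by simp_all
      then have "det L \<noteq> 0" "det R \<noteq> 0" by auto
      then have "det (L * R) \<noteq> 0" using det_mult[OF LR(1,2)[unfolded rm]] by simp
      with c N(4) show False by simp
    qed
    with Epi_dim_le[OF M N(1,2)] have "r < m" by simp
    moreover have "r \<noteq> 0"
    proof
      assume "r = 0"
      then have "?U = 0\<^sub>m m m" unfolding N(4) using LR by (intro eq_matI) (auto simp: scalar_prod_def)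
      then have "\<forall>i<m. \<forall>j<m. ?U $$ (i, j) = 0" by simp
      then have "T = c \<cdot>\<^sub>m 1\<^sub>m m" using cT by (intro eq_matI) auto
      with T(2) show False by blast
    qed
    ultimately obtain b B where B: "0 < b" "b \<le> r" "B \<in> modules scale b" "brick scale B"
      "Epis N B \<noteq> {}" "Monos B N \<noteq> {}"
      using less.IH[OF _ N(1)] by auto
    moreover have "Epis M B \<noteq> {}" using Epi_comp[OF M N(1) B(3) N(2)] B(5) by blast
    moreover have "Monos B M \<noteq> {}" using Mono_comp[OF B(3) N(1) M _ N(3)] B(6) by blast
    ultimately show ?thesis using \<open>r < m\<close> by (meson le_less_trans less_imp_le)
  qed
qed

section \<open>Isomorphism classes of bricks as quotients and submodules\<close>

definition has_quotient :: "('a::ring_1 \<Rightarrow> 'k::field mat) \<Rightarrow> ('a \<Rightarrow> 'k mat) set \<Rightarrow> bool" where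
  "has_quotient X c \<longleftrightarrow> (\<exists>B\<in>c. Epis X B \<noteq> {})"

definition has_submodule :: "('a::ring_1 \<Rightarrow> 'k::field mat) \<Rightarrow> ('a \<Rightarrow> 'k mat) set \<Rightarrow> bool" where
  "has_submodule X c \<longleftrightarrow> (\<exists>B\<in>c. Monos B X \<noteq> {})"

text \<open>The composite X -> B -> D -> Y through two isomorphic members of \<open>c\<close> is
  nonzero: cancelling the outer maps by their splittings recovers the identity of size
  \<open>b > 0\<close>. The factors are kept so that the rank is visibly at most
  \<open>b\<close>.\<close>

lemma nonzero_Hom_through_class:
  fixes X Y :: "'a::ring_1 \<Rightarrow> 'k::field mat"
  assumes c: "c \<in> brick_classes scale b" and X: "X \<in> modules scale m" and Y: "Y \<in> modules scale p"
    and q: "has_quotient X c" and s: "has_submodule Y c"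
  shows "\<exists>V U. V \<in> carrier_mat p b \<and> U \<in> carrier_mat b m \<and> V * U \<in> Hom X Y \<and> V * U \<noteq> 0\<^sub>m p m"
proof -
  obtain B0 where B0: "B0 \<in> modules scale b" "brick scale B0" "c = iso_class scale B0"
    using c by (auto simp: brick_classes_def)
  obtain B R where BR: "B \<in> c" "R \<in> Epis X B" using q by (auto simp: has_quotient_def)
  obtain D L where DL: "D \<in> c" "L \<in> Monos D Y" using s by (auto simp: has_submodule_def)
  obtain b1 b2 where B': "B \<in> modules scale b1" "mod_iso B0 B" and D': "D \<in> modules scale b2" "mod_iso B0 D"
    using BR(1) DL(1) unfolding B0(3) by (auto simp: iso_class_def is_module_def)
  have BD: "mod_iso B D" by (rule mod_iso_trans[OF B'(1) B0(1) D'(1) mod_iso_sym[OF B0(1) B'] D'(2)])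
  have b: "b1 = b" "b2 = b"
    using mod_iso_inverse[OF B0(1) B'(1,2)] mod_iso_inverse[OF B0(1) D'(1,2)] by blast+
  note B = B'(1)[unfolded b] and D = D'(1)[unfolded b]
  obtain T T' where T: "T \<in> Hom B D" "T' \<in> Hom D B" "T' * T = 1\<^sub>m b"
    using mod_iso_inverse[OF B D BD] by blast
  obtain R' where R': "R' \<in> carrier_mat m b" "R * R' = 1\<^sub>m b" and R: "R \<in> Hom X B"
    using BR(2) by (auto simp: Epis_def modulesD(6)[OF X] modulesD(6)[OF B])
  obtain L' where L': "L' \<in> carrier_mat b p" "L' * L = 1\<^sub>m b" and L: "L \<in> Hom D Y"
    using DL(2) by (auto simp: Monos_def modulesD(6)[OF D] modulesD(6)[OF Y])
  have car: "R \<in> carrier_mat b m" "L \<in> carrier_mat p b" "T \<in> carrier_mat b b" "T' \<in> carrier_mat b b"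
    using R L T by (auto simp: mem_Hom_iff[OF X B] mem_Hom_iff[OF D Y] mem_Hom_iff[OF B D] mem_Hom_iff[OF D B])
  have "L * (T * R) \<noteq> 0\<^sub>m p m"
  proof
    assume 0: "L * (T * R) = 0\<^sub>m p m"
    have "1\<^sub>m b = T' * (L' * L * T * (R * R'))" using T(3) L'(2) R'(2) car by simp
    also have "\<dots> = T' * (L' * (L * (T * R)) * R')" using car L'(1) R'(1) by (simp add: assoc_mult_mat_dim)
    also have "\<dots> = 0\<^sub>m b b" unfolding 0 using car L'(1) R'(1) by simp
    finally have "(1\<^sub>m b :: 'k mat) $$ (0, 0) = 0\<^sub>m b b $$ (0, 0)" by simp
    with B0(2) brick_iff[OF B0(1)] show False by simp
  qed
  moreover have "L * (T * R) \<in> Hom X Y" by (rule Hom_comp[OF X D Y Hom_comp[OF X B D R T(1)] L])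
  ultimately show ?thesis using car by (intro exI[of _ L] exI[of _ "T * R"]) auto
qed

text \<open>The composite through the class would be a nonzero scalar endomorphism, hence of rank
  \<open>m\<close>, although it factors through dimension \<open>b < m\<close>.\<close>

lemma brick_not_quotient_and_submodule:
  assumes c: "c \<in> brick_classes scale b" and X: "X \<in> modules scale m" and "brick scale X" and "b < m"
    and q: "has_quotient X c" and s: "has_submodule X c"
  shows False
proof -
  from nonzero_Hom_through_class[OF c X X q s] obtain V U where VU: "V \<in> carrier_mat m b"
    "U \<in> carrier_mat b m" "V * U \<in> Hom X X" "V * U \<noteq> 0\<^sub>m m m" by blast
  from VU(3) assms(3) obtain k where k: "V * U = k \<cdot>\<^sub>m 1\<^sub>m m" using brick_iff[OF X] by blast
  have "k \<noteq> 0" 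
  proof
    assume "k = 0"
    then have "V * U = 0\<^sub>m m m" unfolding k by (intro eq_matI) auto
    with VU(4) show False by blast
  qed
  have "(inverse k \<cdot>\<^sub>m V) * U = inverse k \<cdot>\<^sub>m (V * U)"
    by (rule mult_smult_assoc_mat[OF VU(1,2)])
  also have "\<dots> = 1\<^sub>m m" unfolding k using \<open>k \<noteq> 0\<close> by (intro eq_matI) auto
  finally have "m \<le> b" using VU by (intro left_inverse_dim_le[of "inverse k \<cdot>\<^sub>m V" m b U]) auto
  with \<open>b < m\<close> show False by simp
qed

lemma brick_class_quotient_and_submodule:
  fixes M :: "'a::ring_1 \<Rightarrow> 'k::alg_closed_field mat"
  assumes M: "M \<in> modules scale m" "m > 0"
  shows "\<exists>b\<in>{0<..m}. \<exists>c\<in>brick_classes scale b. has_quotient M c \<and> has_submodule M c"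
proof -
  obtain b B where B: "0 < b" "b \<le> m" "B \<in> modules scale b" "brick scale B" "Epis M B \<noteq> {}" "Monos B M \<noteq> {}"
    using brick_quotient_and_submodule[OF M] by blast
  have "B \<in> iso_class scale B" using mod_iso_refl[OF B(3)] B(3) by (auto simp: iso_class_def is_module_def)
  then show ?thesis
    using B by (intro bexI[of _ b] bexI[of _ "iso_class scale B"])
      (auto simp: has_quotient_def has_submodule_def brick_classes_def)
qed

theorem infinite_semibrick_of_infinite_brick_classes:
  fixes scale :: "'k::alg_closed_field \<Rightarrow> 'a::ring_1 \<Rightarrow> 'a"
  assumes "d0 > 0" "infinite (brick_classes scale d0)"
  shows "\<exists>d>0. \<exists>S. semibrick scale S \<and> infinite S \<and> S \<subseteq> modules scale d"
proof -
  define d where "d = (LEAST d. d > 0 \<and> infinite (brick_classes scale d))"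
  have d: "d > 0" "infinite (brick_classes scale d)"
    unfolding d_def using LeastI[of "\<lambda>d. d > 0 \<and> infinite (brick_classes scale d)" d0] assms by auto
  have small: "finite (brick_classes scale b)" if "b < d" "b > 0" for b
    using that not_less_Least[of b "\<lambda>d. d > 0 \<and> infinite (brick_classes scale d)"] unfolding d_def by blast
  define C where "C = (\<Union>b\<in>{0<..<d}. brick_classes scale b)"
  have "finite C" unfolding C_def using small by auto
  \<comment> \<open>One representative per class: distinct elements of \<open>G\<close> are then
    non-isomorphic, as a semibrick requires.\<close>
  obtain G where G: "G \<subseteq> {X \<in> modules scale d. brick scale X}" "inj_on (iso_class scale) G"
    "brick_classes scale d = iso_class scale ` G"
    using subset_image_inj[of "brick_classes scale d" "iso_class scale" "{X \<in> modules scale d. brick scale X}"]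
    unfolding brick_classes_def by auto
  have "infinite G" using d(2) G(3) by auto
  define \<phi> where "\<phi> X = ({c \<in> C. has_quotient X c}, {c \<in> C. has_submodule X c})" for X :: "'a \<Rightarrow> 'k mat"
  have "\<phi> ` G \<subseteq> Pow C \<times> Pow C" by (auto simp: \<phi>_def)
  with \<open>finite C\<close> have "finite (\<phi> ` G)" by (meson finite_Pow_iff finite_SigmaI finite_subset)
  from pigeonhole_infinite[OF \<open>infinite G\<close> this] obtain X0 where
    X0: "infinite {X \<in> G. \<phi> X = \<phi> X0}" by blast
  let ?S = "{X \<in> G. \<phi> X = \<phi> X0}"
  have Smod: "X \<in> modules scale d" "brick scale X" if "X \<in> ?S" for X using that G(1) by auto
  have niso: "\<not> mod_iso X Y" if "X \<in> ?S" "Y \<in> ?S" "X \<noteq> Y" for X Y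
    using that G(2) iso_class_eq_iff[OF Smod(1)[OF that(1)] Smod(1)[OF that(2)]] by (auto dest: inj_onD)
  have zero: "Hom_zero X Y" if XY: "X \<in> ?S" "Y \<in> ?S" "X \<noteq> Y" for X Y
  proof (rule ccontr)
    note X = Smod(1)[OF XY(1)] and Y = Smod(1)[OF XY(2)]
    assume "\<not> Hom_zero X Y"
    then obtain T where T: "T \<in> Hom X Y" "T \<noteq> 0\<^sub>m d d" using Hom_zero_iff[OF X Y] by blast
    from Hom_image[OF X Y T(1)] obtain r M L R where M: "M \<in> modules scale r" "R \<in> Epis X M" "L \<in> Monos M Y"
      "T = L * R" by blast
    then obtain L' R' where LR: "L \<in> carrier_mat d r" "R \<in> carrier_mat r d" 
      "L' \<in> carrier_mat r d" "L' * L = 1\<^sub>m r" "R' \<in> carrier_mat d r" "R * R' = 1\<^sub>m r"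
      by (auto simp: Epis_def Monos_def modulesD(6)[OF X] modulesD(6)[OF Y] modulesD(6)[OF M(1)]
          mem_Hom_iff[OF X M(1)] mem_Hom_iff[OF M(1) Y])
    have "r \<noteq> 0"
    proof
      assume "r = 0"
      then have "T = 0\<^sub>m d d" unfolding M(4) using LR by (intro eq_matI) (auto simp: scalar_prod_def)
      with T(2) show False by blast
    qed
    \<comment> \<open>A map of full rank would be an isomorphism, excluded by \<open>niso\<close>;
      so the image is smaller and contributes a class in \<open>C\<close>.\<close>
    have "r \<noteq> d"
    proof
      assume rd: "r = d"
      have "L * L' = 1\<^sub>m d" using LR rd by (intro mat_mult_left_right_inverse[of L']) auto
      moreover have "T * (R' * L') = L * (R * R') * L'" unfolding M(4) using LR(1-3,5) by (simp add: assoc_mult_mat_dim)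
      ultimately have "T * (R' * L') = 1\<^sub>m d" using LR rd by simp
      then have "mod_iso X Y" using LR rd by (intro mod_isoI[OF X Y T(1), of "R' * L'"]) auto
      with niso[OF XY] show False by blast
    qed
    with Epi_dim_le[OF X M(1,2)] have "r < d" by simp
    obtain b c where bc: "b \<in> {0<..r}" "c \<in> brick_classes scale b" "has_quotient M c" "has_submodule M c"
      using brick_class_quotient_and_submodule[OF M(1)] \<open>r \<noteq> 0\<close> by auto
    have cmod: "\<exists>q. B \<in> modules scale q" if "B \<in> c" for B
      using bc(2) that by (auto simp: brick_classes_def iso_class_def is_module_def)
    have "has_quotient X c"
      using bc(3) Epi_comp[OF X M(1) _ M(2)] cmod unfolding has_quotient_def by blast
    moreover have "has_submodule Y c"
      using bc(4) Mono_comp[OF _ M(1) Y _ M(3)] cmod unfolding has_submodule_def by blast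
    moreover have "c \<in> C" unfolding C_def using bc(1,2) \<open>r < d\<close> by auto
    \<comment> \<open>Equal profiles turn a submodule class of \<open>Y\<close> into one of
      \<open>X\<close>; as it is also a quotient class of \<open>X\<close>, this contradicts that
      \<open>X\<close> is a brick.\<close>
    moreover have "snd (\<phi> X) = snd (\<phi> Y)" using XY by simp
    ultimately have "has_submodule X c" unfolding \<phi>_def by auto
    then show False
      using brick_not_quotient_and_submodule[OF bc(2) X Smod(2)[OF XY(1)] _ \<open>has_quotient X c\<close>]
        bc(1) \<open>r < d\<close> by auto
  qed
  have "?S \<noteq> {}" using infinite_imp_nonempty[OF X0] .
  moreover have "\<And>X. X \<in> ?S \<Longrightarrow> brick scale X" using Smod(2) .
  ultimately have "semibrick scale ?S"
    unfolding semibrick_def using niso zero by blast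
  with X0 Smod(1) d(1) show ?thesis by blast
qed

theorem infinite_brick_classes_of_infinite_semibrick:
  assumes "semibrick scale S" "infinite S" "S \<subseteq> modules scale d"
  shows "infinite (brick_classes scale d)"
proof
  assume "finite (brick_classes scale d)"
  moreover have "iso_class scale ` S \<subseteq> brick_classes scale d"
    using assms by (auto simp: semibrick_def brick_classes_def)
  ultimately have "finite (iso_class scale ` S)" by (rule rev_finite_subset)
  moreover have "inj_on (iso_class scale) S"
    using assms(1,3) iso_class_eq_iff[of _ scale d _ d] unfolding semibrick_def inj_on_def by blast
  ultimately show False using assms(2) finite_imageD by blast
qed

section \<open>Zariski topology\<close>

lemma polyfuns_sum:
  assumes "\<And>i. i \<in> I \<Longrightarrow> f i \<in> polyfuns m"
  shows "(\<lambda>X. \<Sum>i\<in>I. f i X) \<in> polyfuns m"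
  using assms by (induction I rule: infinite_finite_induct) (auto intro: polyfuns.intros)

lemma polyfuns_prod:
  assumes "\<And>i. i \<in> I \<Longrightarrow> f i \<in> polyfuns m"
  shows "(\<lambda>X. \<Prod>i\<in>I. f i X) \<in> polyfuns m"
  using assms by (induction I rule: infinite_finite_induct) (auto intro: polyfuns.intros)

lemma polyfuns_diff:
  assumes "f \<in> polyfuns m" "g \<in> polyfuns m"
  shows "(\<lambda>X. f X - g X) \<in> polyfuns m"
proof -
  have "(\<lambda>X. f X + (- 1) * g X) \<in> polyfuns m" by (intro polyfuns.intros assms)
  then show ?thesis by simp
qed

lemma polyfuns_if: "(c \<Longrightarrow> f \<in> polyfuns m) \<Longrightarrow> (\<lambda>X. if c then f X else 0) \<in> polyfuns m"
  by (cases c) (auto intro: polyfuns.const)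

lemma polyfuns_det:
  assumes "\<And>i j. i < p \<Longrightarrow> j < p \<Longrightarrow> (\<lambda>X. f X i j) \<in> polyfuns m"
  shows "(\<lambda>X. det (mat p p (\<lambda>(i, j). f X i j))) \<in> polyfuns m"
proof -
  have "det (mat p p (\<lambda>(i, j). f X i j)) =
      (\<Sum>\<pi>\<in>{\<pi>. \<pi> permutes {0..<p}}. signof \<pi> * (\<Prod>i = 0..<p. f X i (\<pi> i)))" for X
    unfolding det_def'[OF mat_carrier] by (intro sum.cong arg_cong2[of _ _ _ _ "(*)"] prod.cong) auto
  then show ?thesis
    by (simp only:) (intro polyfuns_sum polyfuns.mult polyfuns.const polyfuns_prod assms, auto)
qed

text \<open>The coefficient of the unknown \<open>T $$ (k div m, k mod m)\<close> in the entry \<open>(i, j)\<close> of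
  \<open>T * X a - Y a * T\<close>.\<close>

definition hom_coeff :: "('a \<Rightarrow> 'k::field mat) \<Rightarrow> ('a \<Rightarrow> 'k mat) \<Rightarrow> nat \<Rightarrow> 'a \<times> nat \<times> nat \<Rightarrow> nat \<Rightarrow> 'k" where
  "hom_coeff X Y m = (\<lambda>(a, i, j) k. (if k div m = i then X a $$ (k mod m, j) else 0) -
     (if k mod m = j then Y a $$ (i, k div m) else 0))"

section \<open>Homomorphisms as solutions of a linear system\<close>

text \<open>Flattens the matrix positions row by row into one index, so that a matrix unknown
  becomes a vector unknown.\<close>

lemma sum_div_mod:
  fixes g :: "nat \<Rightarrow> nat \<Rightarrow> 'b::comm_monoid_add"
  shows "(\<Sum>k<m * m. g (k div m) (k mod m)) = (\<Sum>u<m. \<Sum>v<m. g u v)"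
proof -
  have "(\<Sum>k<m * m. g (k div m) (k mod m)) = (\<Sum>(u, v)\<in>{..<m} \<times> {..<m}. g u v)"
  proof (rule sum.reindex_bij_witness[of _ "\<lambda>(u, v). u * m + v" "\<lambda>k. (k div m, k mod m)"])
    fix k assume k: "k \<in> {..<m * m}"
    then have "m > 0" by (cases m) auto
    then show "(k div m, k mod m) \<in> {..<m} \<times> {..<m}" using k by (auto simp: less_mult_imp_div_less)
  next
    fix b assume "b \<in> {..<m} \<times> {..<m}"
    then obtain u v where uv: "b = (u, v)" "u < m" "v < m" by auto
    have "u * m + v < Suc u * m" using uv by simp
    also have "\<dots> \<le> m * m" using uv by (intro mult_le_mono1) auto
    finally show "(case b of (u, v) \<Rightarrow> u * m + v) \<in> {..<m * m}" using uv by simp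
  qed auto
  then show ?thesis by (simp add: sum.cartesian_product)
qed

lemma mem_Hom_iff_system:
  fixes X Y :: "'a::ring_1 \<Rightarrow> 'k::field mat"
  assumes X: "X \<in> modules scale m" and Y: "Y \<in> modules scale m" and T: "T \<in> carrier_mat m m"
  shows "T \<in> Hom X Y \<longleftrightarrow> (\<forall>x\<in>UNIV \<times> {..<m} \<times> {..<m}.
    (\<Sum>k<m * m. hom_coeff X Y m x k * T $$ (k div m, k mod m)) = 0)"
proof -
  have sys: "(\<Sum>k<m * m. hom_coeff X Y m (a, i, j) k * T $$ (k div m, k mod m)) =
      (T * X a) $$ (i, j) - (Y a * T) $$ (i, j)" if "i < m" "j < m" for a i j
  proof -
    let ?g = "\<lambda>u v. ((if u = i then X a $$ (v, j) else 0) - (if v = j then Y a $$ (i, u) else 0)) * T $$ (u, v)"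
    have "(\<Sum>k<m * m. hom_coeff X Y m (a, i, j) k * T $$ (k div m, k mod m)) = (\<Sum>u<m. \<Sum>v<m. ?g u v)"
      unfolding sum_div_mod[symmetric] by (simp add: hom_coeff_def)
    also have "\<dots> = (\<Sum>u<m. \<Sum>v<m. if u = i then X a $$ (v, j) * T $$ (u, v) else 0)
        - (\<Sum>u<m. \<Sum>v<m. if v = j then Y a $$ (i, u) * T $$ (u, v) else 0)"
      unfolding sum_subtractf[symmetric] by (intro sum.cong) (auto simp: algebra_simps)
    also have "(\<Sum>u<m. \<Sum>v<m. if u = i then X a $$ (v, j) * T $$ (u, v) else 0) = (T * X a) $$ (i, j)"
      using that by (subst sum.swap)
        (simp add: index_sum_prod[OF T modulesD(1)[OF X]] mult.commute)
    also have "(\<Sum>u<m. \<Sum>v<m. if v = j then Y a $$ (i, u) * T $$ (u, v) else 0) = (Y a * T) $$ (i, j)"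
      using that by (simp add: index_sum_prod[OF modulesD(1)[OF Y] T])
    finally show ?thesis .
  qed
  have "T * X a \<in> carrier_mat m m" "Y a * T \<in> carrier_mat m m" for a
    using T modulesD(1)[OF X, of a] modulesD(1)[OF Y, of a] by auto
  then have "T * X a = Y a * T \<longleftrightarrow> (\<forall>i<m. \<forall>j<m. (T * X a) $$ (i, j) - (Y a * T) $$ (i, j) = 0)" for a
    unfolding right_minus_eq by (metis carrier_matD eq_matI)
  then show ?thesis using T sys by (auto simp: mem_Hom_iff[OF X Y])
qed

text \<open>Hom is the solution space of a system in \<open>m * m\<close> unknowns with one equation
  per algebra element and matrix position. A nonzero solution exists exactly when all maximal minors
  vanish; \<open>exists_nonsingular_rows\<close> gives this even for infinitely many rows.\<close>

lemma Hom_zero_iff_det: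
  fixes X Y :: "'a::ring_1 \<Rightarrow> 'k::field mat"
  assumes X: "X \<in> modules scale m" and Y: "Y \<in> modules scale m"
  shows "\<not> Hom_zero X Y \<longleftrightarrow> (\<forall>s. (\<forall>k<m * m. s k \<in> UNIV \<times> {..<m} \<times> {..<m}) \<longrightarrow>
    det (mat (m * m) (m * m) (\<lambda>(l, k). hom_coeff X Y m (s l) k)) = 0)"
proof
  assume "\<not> Hom_zero X Y"
  then obtain T where T: "T \<in> Hom X Y" "T \<noteq> 0\<^sub>m m m" by (auto simp: Hom_zero_iff[OF X Y])
  have c: "T \<in> carrier_mat m m" using T(1) by (auto simp: mem_Hom_iff[OF X Y])
  with T(2) have "\<exists>i<m. \<exists>j<m. T $$ (i, j) \<noteq> 0"
    by (metis (no_types, lifting) carrier_matD eq_matI index_zero_mat)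
  then obtain i j where ij: "i < m" "j < m" "T $$ (i, j) \<noteq> 0" by blast
  have "i * m + j < Suc i * m" using ij by simp
  also have "\<dots> \<le> m * m" using ij by (intro mult_le_mono1) auto
  finally have k: "i * m + j < m * m" .
  have "\<exists>k<m * m. T $$ (k div m, k mod m) \<noteq> 0"
    by (rule exI[of _ "i * m + j"]) (use k ij in simp)
  moreover have "(\<Sum>k<m * m. hom_coeff X Y m x k * T $$ (k div m, k mod m)) = 0"
    if "x \<in> UNIV \<times> {..<m} \<times> {..<m}" for x
    using T(1) that unfolding mem_Hom_iff_system[OF X Y c] by blast
  ultimately show "\<forall>s. (\<forall>k<m * m. s k \<in> UNIV \<times> {..<m} \<times> {..<m}) \<longrightarrow>
    det (mat (m * m) (m * m) (\<lambda>(l, k). hom_coeff X Y m (s l) k)) = 0"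
    unfolding det_mat_eq_0_iff by (intro allI impI exI[of _ "\<lambda>k. T $$ (k div m, k mod m)"]) blast
next
  assume dets: "\<forall>s. (\<forall>k<m * m. s k \<in> UNIV \<times> {..<m} \<times> {..<m}) \<longrightarrow>
    det (mat (m * m) (m * m) (\<lambda>(l, k). hom_coeff X Y m (s l) k)) = 0"
  show "\<not> Hom_zero X Y"
  proof
    assume zero: "Hom_zero X Y"
    have "\<exists>s. (\<forall>k<m * m. s k \<in> UNIV \<times> {..<m} \<times> {..<m}) \<and>
      det (mat (m * m) (m * m) (\<lambda>(l, k). hom_coeff X Y m (s l) k)) \<noteq> 0"
    proof (rule exists_nonsingular_rows)
      fix u :: "nat \<Rightarrow> 'k"
      assume u: "\<And>x. x \<in> UNIV \<times> {..<m} \<times> {..<m} \<Longrightarrow> (\<Sum>k<m * m. hom_coeff X Y m x k * u k) = 0"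
      let ?T = "mat m m (\<lambda>(i, j). u (i * m + j))"
      have Tk: "?T $$ (k div m, k mod m) = u k" if "k < m * m" for k
      proof -
        have "m > 0" using that by (cases m) auto
        then show ?thesis using that by (simp add: less_mult_imp_div_less)
      qed
      have "?T \<in> Hom X Y" using u Tk by (subst mem_Hom_iff_system[OF X Y]) auto
      then have T0: "?T = 0\<^sub>m m m" using zero by (auto simp: Hom_zero_iff[OF X Y])
      show "\<forall>k<m * m. u k = 0"
      proof (intro allI impI)
        fix k assume k: "k < m * m"
        then have "m > 0" by (cases m) auto
        then have "k div m < m" "k mod m < m" using k by (auto simp: less_mult_imp_div_less)
        then show "u k = 0" using Tk[OF k] T0 by simp
      qed
    qed
    with dets show False by blast
  qed
qed

text \<open>With one module fixed, every minor of the system is a polynomial in the other. Both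
  variables are needed, since two successive density arguments replace first the target and then the
  source.\<close>

lemma closedin_Hom_nonzero:
  fixes X :: "'a::ring_1 \<Rightarrow> 'k::field mat"
  assumes V: "V \<subseteq> modules scale m" and X: "X \<in> modules scale m"
  shows "closedin (zariski m V) {Y \<in> V. \<not> Hom_zero X Y}"
    and "closedin (zariski m V) {Y \<in> V. \<not> Hom_zero Y X}"
proof -
  let ?S = "{s. \<forall>k<m * m. s k \<in> (UNIV \<times> {..<m} \<times> {..<m} ::('a \<times> nat \<times> nat) set)}"
  let ?D = "\<lambda>X Y s. det (mat (m * m) (m * m) (\<lambda>(l, k). hom_coeff X Y m (s l) k))"
  have poly: "(\<lambda>Y. hom_coeff X Y m (s l) k) \<in> polyfuns m" "(\<lambda>Y. hom_coeff Y X m (s l) k) \<in> polyfuns m"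
    if "s \<in> ?S" "l < m * m" "k < m * m" for s l k
  proof -
    obtain a i j where s: "s l = (a, i, j)" by (cases "s l")
    have ij: "i < m" "j < m" using that(1,2) s by fastforce+
    have "m > 0" using that by (cases m) auto
    then have km: "k div m < m" "k mod m < m" using that(3) by (auto simp: less_mult_imp_div_less)
    have p: "(\<lambda>Y. if k mod m = j then Y a $$ (i, k div m) else 0) \<in> polyfuns m"
      "(\<lambda>Y. if k div m = i then Y a $$ (k mod m, j) else 0) \<in> polyfuns m"
      by (rule polyfuns_if, rule polyfuns.coord; use ij km in simp)+
    show "(\<lambda>Y. hom_coeff X Y m (s l) k) \<in> polyfuns m"
      unfolding s hom_coeff_def prod.case by (rule polyfuns_diff[OF polyfuns.const p(1)])
    show "(\<lambda>Y. hom_coeff Y X m (s l) k) \<in> polyfuns m"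
      unfolding s hom_coeff_def prod.case by (rule polyfuns_diff[OF p(2) polyfuns.const])
  qed
  have "\<not> Hom_zero X Y \<longleftrightarrow> (\<forall>f\<in>(\<lambda>s Y. ?D X Y s) ` ?S. f Y = 0)" if "Y \<in> V" for Y
    unfolding Hom_zero_iff_det[OF X subsetD[OF V that]] by simp
  then have "{Y \<in> V. \<not> Hom_zero X Y} = {Y \<in> V. \<forall>f\<in>(\<lambda>s Y. ?D X Y s) ` ?S. f Y = 0}"
    by (rule Collect_cong[OF conj_cong[OF refl]])
  moreover have "(\<lambda>s Y. ?D X Y s) ` ?S \<subseteq> polyfuns m"
    by (rule image_subsetI, rule polyfuns_det, rule poly(1))
  ultimately show "closedin (zariski m V) {Y \<in> V. \<not> Hom_zero X Y}"
    unfolding closedin_zariski by blast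
  have "\<not> Hom_zero Y X \<longleftrightarrow> (\<forall>f\<in>(\<lambda>s Y. ?D Y X s) ` ?S. f Y = 0)" if "Y \<in> V" for Y
    unfolding Hom_zero_iff_det[OF subsetD[OF V that] X] by simp
  then have "{Y \<in> V. \<not> Hom_zero Y X} = {Y \<in> V. \<forall>f\<in>(\<lambda>s Y. ?D Y X s) ` ?S. f Y = 0}"
    by (rule Collect_cong[OF conj_cong[OF refl]])
  moreover have "(\<lambda>s Y. ?D Y X s) ` ?S \<subseteq> polyfuns m"
    by (rule image_subsetI, rule polyfuns_det, rule poly(2))
  ultimately show "closedin (zariski m V) {Y \<in> V. \<not> Hom_zero Y X}"
    unfolding closedin_zariski by blast
qed

section \<open>Dense families of modules with a common brick\<close>

text \<open>Split off one set at a time; the empty cover is excluded because irreducible sets are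
  nonempty by definition.\<close>

lemma irreducible_in_finite_cover:
  assumes "irreducible_in T Z" "finite C" "\<And>c. c \<in> C \<Longrightarrow> closedin T (K c)" "Z \<subseteq> (\<Union>c\<in>C. K c)"
  shows "\<exists>c\<in>C. Z \<subseteq> K c"
  using assms(2-4)
proof (induction C rule: finite_induct)
  case empty
  then show ?case using assms(1) by (simp add: irreducible_in_def)
next
  case (insert c C)
  have "closedin T (\<Union>c\<in>C. K c)" using insert by (intro closedin_Union) auto
  moreover have "closedin T (K c)" "Z \<subseteq> K c \<union> (\<Union>c\<in>C. K c)" using insert by auto
  ultimately have "Z \<subseteq> K c \<or> Z \<subseteq> (\<Union>c\<in>C. K c)" using assms(1) unfolding irreducible_in_def by blast
  then show ?case using insert by auto
qed

theorem infinite_brick_classes_of_Hom_zero: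
  fixes V :: "('a::ring_1 \<Rightarrow> 'k::alg_closed_field mat) set"
  assumes V: "V \<subseteq> modules scale m" and m: "m > 0"
    and Z: "irreducible_in (zariski m V) Z" and XY: "X \<in> Z" "Y \<in> Z" "Hom_zero X Y"
  shows "\<exists>b>0. infinite (brick_classes scale b)"
proof (rule ccontr)
  assume "\<not> ?thesis"
  then have fin: "finite (brick_classes scale b)" if "b > 0" for b using that by blast
  define C where "C = (\<Union>b\<in>{0<..m}. brick_classes scale b)"
  have "finite C" unfolding C_def using fin by auto
  have ZV: "Z \<subseteq> V" using Z by (simp add: irreducible_in_def topspace_zariski)
  define U where "U c = {N \<in> Z. has_quotient N c \<and> has_submodule N c}" for c
  have cover: "Z \<subseteq> (\<Union>c\<in>C. U c)"
  proof
    fix N assume "N \<in> Z"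
    then have "N \<in> modules scale m" using ZV V by blast
    from brick_class_quotient_and_submodule[OF this m] \<open>N \<in> Z\<close> show "N \<in> (\<Union>c\<in>C. U c)"
      unfolding C_def U_def by blast
  qed
  \<comment> \<open>Density of \<open>U c\<close> in \<open>Z\<close>: otherwise each
    \<open>U c\<close> lies in a closed set missing part of \<open>Z\<close>, and these finitely
    many closed sets cover \<open>Z\<close>.\<close>
  have "\<exists>c\<in>C. \<forall>K. closedin (zariski m V) K \<longrightarrow> U c \<subseteq> K \<longrightarrow> Z \<subseteq> K"
  proof (rule ccontr)
    assume "\<not> ?thesis"
    then have "\<forall>c\<in>C. \<exists>K. closedin (zariski m V) K \<and> U c \<subseteq> K \<and> \<not> Z \<subseteq> K" by blast
    then obtain K where K: "\<And>c. c \<in> C \<Longrightarrow> closedin (zariski m V) (K c) \<and> U c \<subseteq> K c \<and> \<not> Z \<subseteq> K c"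
      by metis
    have "Z \<subseteq> (\<Union>c\<in>C. K c)" using cover K by blast
    from irreducible_in_finite_cover[OF Z \<open>finite C\<close> _ this] K show False by blast
  qed
  then obtain c where c: "c \<in> C" and dense: "\<And>K. closedin (zariski m V) K \<Longrightarrow> U c \<subseteq> K \<Longrightarrow> Z \<subseteq> K"
    by blast
  have UV: "U c \<subseteq> V" using ZV by (auto simp: U_def)
  have X: "X \<in> modules scale m" using XY ZV V by blast
  \<comment> \<open>\<open>Y\<close> witnesses that the closed condition fails somewhere on
    \<open>Z\<close>, so by density it fails at some \<open>N\<close> in \<open>U c\<close>.\<close>
  have "\<not> Z \<subseteq> {N \<in> V. \<not> Hom_zero X N}" using XY by blast
  with dense[OF closedin_Hom_nonzero(1)[OF V X]] UV obtain N where N: "N \<in> U c" "Hom_zero X N" by blast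
  then have N': "N \<in> modules scale m" using UV V by blast
  \<comment> \<open>With \<open>N\<close> fixed, \<open>X\<close> is now the witness, because
    \<open>Hom_zero X N\<close> has just been obtained.\<close>
  have "\<not> Z \<subseteq> {M \<in> V. \<not> Hom_zero M N}" using XY N(2) by blast
  with dense[OF closedin_Hom_nonzero(2)[OF V N']] UV obtain M where M: "M \<in> U c" "Hom_zero M N" by blast
  then have M': "M \<in> modules scale m" using UV V by blast
  obtain b where "c \<in> brick_classes scale b" using c by (auto simp: C_def)
  moreover have "has_quotient M c" "has_submodule N c" using M N by (auto simp: U_def)
  ultimately obtain P where "P \<in> Hom M N" "P \<noteq> 0\<^sub>m m m"
    using nonzero_Hom_through_class[OF _ M' N'] by blast
  with M(2) show False using Hom_zero_iff[OF M' N'] by blast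
qed

subsection \<open>Noetherianity\<close>

text \<open>The constants form a field: a sequence either starts with 0 or has its second term a
  multiple of its first.\<close>

lemma noetherian_const_funs: "noetherian_set (range (\<lambda>c (_::'x). c :: 'k::field))"
  unfolding noetherian_set_def
proof (intro allI impI)
  fix f :: "nat \<Rightarrow> 'x \<Rightarrow> 'k"
  assume "range f \<subseteq> range (\<lambda>c _. c)"
  then have "\<exists>c. f n = (\<lambda>_. c)" for n by blast
  then obtain c where c: "\<And>n. f n = (\<lambda>_. c n)" by metis
  show "\<exists>n. f n \<in> ideal_span (range (\<lambda>c _. c)) (f ` {..<n})"
  proof (cases "c 0 = 0")
    case True
    then have "f 0 = 0" using c[of 0] by (simp add: zero_fun_def)
    then show ?thesis by (metis ideal_span.zero)
  next
    case False
    have "(\<lambda>_. c 1 / c 0) * f 0 + 0 \<in> ideal_span (range (\<lambda>c _. c)) (f ` {..<1})"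
      by (intro ideal_span.intros) auto
    moreover have "(\<lambda>_. c 1 / c 0) * f 0 + 0 = f 1"
      using False by (auto simp: c times_fun_def)
    ultimately show ?thesis by metis
  qed
qed

lemma noetherian_ring_containing:
  fixes G :: "('x \<Rightarrow> 'k::field) set"
  assumes "finite G"
  shows "\<exists>R. subring_set R \<and> noetherian_set R \<and> range (\<lambda>c _. c) \<subseteq> R \<and> G \<subseteq> R"
  using assms
proof induction
  case empty
  have "subring_set (range (\<lambda>c (_::'x). c :: 'k))"
    unfolding subring_set_def by (auto simp: zero_fun_def one_fun_def fun_Compl_def plus_fun_def times_fun_def)
  then show ?case using noetherian_const_funs by blast
next
  case (insert g G)
  then obtain R where R: "subring_set R" "noetherian_set R" "range (\<lambda>c _. c) \<subseteq> R" "G \<subseteq> R" by blast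
  with subset_adjoin[OF R(1), of g] mem_adjoin[OF R(1), of g] show ?case
    by (intro exI[of _ "adjoin R g"]) (auto intro: subring_adjoin noetherian_adjoin)
qed

text \<open>There are coordinates for every algebra element, but on modules the entries are linear
  in that element. So each polynomial function agrees on \<open>V\<close> with a member of a
  Noetherian ring generated from finitely many entry functions.\<close>

lemma polyfuns_eventually_redundant:
  fixes scale :: "'k::field \<Rightarrow> 'a::ring_1 \<Rightarrow> 'a"
  assumes alg: "fd_algebra scale" and V: "V \<subseteq> modules scale m"
    and f: "\<And>n::nat. f n \<in> polyfuns m"
  shows "\<exists>n. \<forall>X\<in>V. (\<forall>i<n. f i X = 0) \<longrightarrow> f n X = 0"
proof -
  interpret fd_algebra scale by (rule alg)
  obtain B where B: "finite B" "span B = UNIV" using finite_dimensional by blast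
  let ?G = "(\<lambda>(b, i, j) (X :: 'a \<Rightarrow> 'k mat). X b $$ (i, j)) ` (B \<times> {..<m} \<times> {..<m})"
  have "finite ?G" using B(1) by auto
  from noetherian_ring_containing[OF this] obtain R :: "(('a \<Rightarrow> 'k mat) \<Rightarrow> 'k) set" where
    R: "subring_set R" "noetherian_set R" and cR: "range (\<lambda>c _. c) \<subseteq> R" and GR: "?G \<subseteq> R" by blast
  have Rops: "g + h \<in> R" "g * h \<in> R" if "g \<in> R" "h \<in> R" for g h
    using that R(1) by (auto simp: subring_set_def)
  have Rconst: "(\<lambda>_. c) \<in> R" for c using cR by auto
  have car: "X a \<in> carrier_mat m m" if "X \<in> V" for X a using that V modulesD(1) by blast
  have ex: "\<exists>g\<in>R. \<forall>X\<in>V. X a $$ (i, j) = g X" if ij: "i < m" "j < m" for a i j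
  proof -
    \<comment> \<open>The algebra elements whose entry function is represented in \<open>R\<close>:
      by linearity a subspace, and it contains the spanning set \<open>B\<close>.\<close>
    let ?W = "{a. \<exists>g\<in>R. \<forall>X\<in>V. X a $$ (i, j) = g X}"
    have "subspace ?W"
    proof (rule subspaceI)
      have "X 0 $$ (i, j) = 0" if "X \<in> V" for X
      proof -
        have "X 0 = 0 \<cdot>\<^sub>m X 0" using modulesD(3)[of X scale m 0 0] that V by (auto simp: scale_zero_left)
        from arg_cong[OF this, of "\<lambda>M. M $$ (i, j)"] show ?thesis using car[OF that, of 0] ij by simp
      qed
      then show "0 \<in> ?W" using Rconst[of 0] by (intro CollectI bexI[of _ "\<lambda>_. 0"]) auto
    next
      fix x y assume "x \<in> ?W" "y \<in> ?W"
      then obtain g h where gh: "g \<in> R" "h \<in> R" "\<forall>X\<in>V. X x $$ (i, j) = g X" "\<forall>X\<in>V. X y $$ (i, j) = h X" by auto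
      have "X (x + y) $$ (i, j) = (g + h) X" if "X \<in> V" for X
        using gh that modulesD(2)[of X scale m x y] V car[OF that, of x] car[OF that, of y] ij
        by (auto simp: plus_fun_def)
      then show "x + y \<in> ?W" using Rops(1)[OF gh(1,2)] by blast
    next
      fix c x assume "x \<in> ?W"
      then obtain g where g: "g \<in> R" "\<forall>X\<in>V. X x $$ (i, j) = g X" by auto
      have "X (scale c x) $$ (i, j) = ((\<lambda>_. c) * g) X" if "X \<in> V" for X
        using g that modulesD(3)[of X scale m c x] V car[OF that, of x] ij
        by (auto simp: times_fun_def)
      then show "scale c x \<in> ?W" using Rops(2)[OF Rconst g(1)] by blast
    qed
    moreover have "B \<subseteq> ?W"
    proof
      fix b assume "b \<in> B"
      then have "(\<lambda>X. X b $$ (i, j)) \<in> R" using GR ij by (intro subsetD[OF GR]) (auto intro!: image_eqI[of _ _ "(b, i, j)"])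
      then show "b \<in> ?W" by (intro CollectI bexI[of _ "\<lambda>X. X b $$ (i, j)"]) auto
    qed
    ultimately have "span B \<subseteq> ?W" by (intro span_minimal)
    then show ?thesis using B(2) by blast
  qed
  have rep: "\<exists>g\<in>R. \<forall>X\<in>V. h X = g X" if "h \<in> polyfuns m" for h
    using that
  proof induction
    case (const c)
    show ?case by (rule bexI[OF _ Rconst[of c]]) simp
  next
    case (coord i j a)
    then show ?case using ex by blast
  next
    case (add f g)
    then obtain f' g' where "f' \<in> R" "g' \<in> R" "\<forall>X\<in>V. f X = f' X" "\<forall>X\<in>V. g X = g' X" by blast
    then show ?case using Rops(1)[of f' g'] by (intro bexI[of _ "f' + g'"]) (auto simp: plus_fun_def)
  next
    case (mult f g)
    then obtain f' g' where "f' \<in> R" "g' \<in> R" "\<forall>X\<in>V. f X = f' X" "\<forall>X\<in>V. g X = g' X" by blast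
    then show ?case using Rops(2)[of f' g'] by (intro bexI[of _ "f' * g'"]) (auto simp: times_fun_def)
  qed
  have "\<forall>n. \<exists>g. g \<in> R \<and> (\<forall>X\<in>V. f n X = g X)" using rep f by blast
  then obtain g where g: "\<And>n. g n \<in> R" "\<And>n X. X \<in> V \<Longrightarrow> f n X = g n X" by metis
  then obtain n where n: "g n \<in> ideal_span R (g ` {..<n})"
    using R(2) unfolding noetherian_set_def by (metis image_subsetI)
  have "h X = 0" if "h \<in> ideal_span R (g ` {..<n})" "\<forall>i<n. g i X = 0" for h X
    using that by (induction) (auto simp: plus_fun_def times_fun_def zero_fun_def)
  from this[OF n] show ?thesis using g(2) by (intro exI[of _ n]) auto
qed

section \<open>Irreducible subsets and components\<close>

text \<open>If every infinite subset of \<open>S\<close> were reducible, one of two proper closed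
  pieces would again be infinite. Iterating gives a descending chain of infinite sets, each cut out
  by an equation not implied by the earlier ones, against Noetherianity.\<close>

lemma infinite_irreducible_subset:
  fixes scale :: "'k::field \<Rightarrow> 'a::ring_1 \<Rightarrow> 'a"
  assumes alg: "fd_algebra scale" and V: "V \<subseteq> modules scale m"
    and S: "S \<subseteq> V" "infinite S"
  shows "\<exists>T\<subseteq>S. infinite T \<and> irreducible_in (zariski m V) T"
proof (rule ccontr)
  assume no: "\<not> ?thesis"
  have cut: "\<exists>f\<in>polyfuns m. infinite {X \<in> T. f X = 0} \<and> (\<exists>x\<in>T. f x \<noteq> 0)" if T: "T \<subseteq> S" "infinite T" for T
  proof -
    have half: ?thesis if C: "closedin (zariski m V) C" "infinite (T \<inter> C)" "\<not> T \<subseteq> C" for C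
    proof -
      obtain F where F: "F \<subseteq> polyfuns m" "C = {X \<in> V. \<forall>f\<in>F. f X = 0}" using C(1) by (auto simp: closedin_zariski)
      obtain x where x: "x \<in> T" "x \<notin> C" using C(3) by blast
      then have "x \<in> V" using T(1) S(1) by blast
      then obtain f where f: "f \<in> F" "f x \<noteq> 0" using F(2) x(2) by auto
      have "T \<inter> C \<subseteq> {X \<in> T. f X = 0}" using f(1) F(2) by blast
      then have "infinite {X \<in> T. f X = 0}" using C(2) finite_subset by blast
      then show ?thesis using f x F(1) by blast
    qed
    have "\<not> irreducible_in (zariski m V) T" using no T by blast
    moreover have "T \<subseteq> topspace (zariski m V)" "T \<noteq> {}" using T S(1) by (auto simp: topspace_zariski)
    ultimately obtain C D where CD: "closedin (zariski m V) C" "closedin (zariski m V) D" "T \<subseteq> C \<union> D"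
      "\<not> T \<subseteq> C" "\<not> T \<subseteq> D" unfolding irreducible_in_def by blast
    have "T = T \<inter> C \<union> T \<inter> D" using CD(3) by blast
    then have "infinite (T \<inter> C) \<or> infinite (T \<inter> D)" using T(2) by (metis finite_UnI)
    then show ?thesis using half CD by blast
  qed
  \<comment> \<open>Choosing an equation for all sets at once, with the conditions as a premise,
    makes the descending chain a plain recursion.\<close>
  then have "\<forall>T. \<exists>f. T \<subseteq> S \<and> infinite T \<longrightarrow>
      f \<in> polyfuns m \<and> infinite {X \<in> T. f X = 0} \<and> (\<exists>x\<in>T. f x \<noteq> 0)" by (simp add: Bex_def)
  from choice[OF this] obtain f where "\<forall>T. T \<subseteq> S \<and> infinite T \<longrightarrow>
      f T \<in> polyfuns m \<and> infinite {X \<in> T. f T X = 0} \<and> (\<exists>x\<in>T. f T x \<noteq> 0)" ..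
  note f = this[THEN spec, THEN mp]
  define T where "T = rec_nat S (\<lambda>_ T. {X \<in> T. f T X = 0})"
  have T0: "T 0 = S" and TSuc: "T (Suc n) = {X \<in> T n. f (T n) X = 0}" for n
    by (simp_all add: T_def)
  have T: "T n \<subseteq> S \<and> infinite (T n)" for n
  proof (induction n)
    case 0
    then show ?case using S(2) T0 by simp
  next
    case (Suc n)
    then show ?case using f[OF Suc] unfolding TSuc by auto
  qed
  have van: "f (T i) x = 0" if "x \<in> T n" "i < n" for i n x
    using that by (induction n) (auto simp: TSuc less_Suc_eq)
  have "f (T n) \<in> polyfuns m" for n using f[OF T] by simp
  from polyfuns_eventually_redundant[OF alg V, of "\<lambda>n. f (T n)", OF this]
  obtain n where n: "\<And>X. X \<in> V \<Longrightarrow> (\<forall>i<n. f (T i) X = 0) \<Longrightarrow> f (T n) X = 0" by auto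
  \<comment> \<open>This point satisfies the first \<open>n\<close> equations by \<open>van\<close>,
    but not the next one.\<close>
  obtain x where x: "x \<in> T n" "f (T n) x \<noteq> 0" using f[OF T, of n] by auto
  have "x \<in> V" using x(1) T[of n] S(1) by auto
  with n[of x] van[OF x(1)] x(2) show False by simp
qed

lemma irreducible_in_subset_component:
  assumes A: "irreducible_in T A"
  shows "\<exists>Z\<in>irreducible_components T. A \<subseteq> Z"
proof -
  let ?F = "{Z. irreducible_in T Z \<and> A \<subseteq> Z}"
  have "\<exists>M\<in>?F. \<forall>X\<in>?F. M \<subseteq> X \<longrightarrow> X = M"
  proof (rule subset_Zorn_nonempty)
    fix \<C> assume ne: "\<C> \<noteq> {}" and chain: "subset.chain ?F \<C>"
    have irr: "irreducible_in T Z" "A \<subseteq> Z" if "Z \<in> \<C>" for Z using chain that unfolding subset_chain_def by auto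
    have lin: "Z1 \<subseteq> Z2 \<or> Z2 \<subseteq> Z1" if "Z1 \<in> \<C>" "Z2 \<in> \<C>" for Z1 Z2
      using chain that unfolding subset_chain_def by simp
    have "\<Union>\<C> \<subseteq> C \<or> \<Union>\<C> \<subseteq> D" if CD: "closedin T C" "closedin T D" "\<Union>\<C> \<subseteq> C \<union> D" for C D
    proof (rule ccontr)
      assume "\<not> ?thesis"
      then obtain Z1 Z2 where Z12: "Z1 \<in> \<C>" "\<not> Z1 \<subseteq> C" "Z2 \<in> \<C>" "\<not> Z2 \<subseteq> D" by blast
      \<comment> \<open>The larger of \<open>Z1\<close> and \<open>Z2\<close> is contained in
        neither \<open>C\<close> nor \<open>D\<close>, so irreducibility of one member of the chain
        is enough.\<close>
      have "\<exists>Z\<in>\<C>. \<not> Z \<subseteq> C \<and> \<not> Z \<subseteq> D"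
        using lin[OF Z12(1,3)] Z12 by (meson subset_trans)
      then obtain Z where Z: "Z \<in> \<C>" "\<not> Z \<subseteq> C" "\<not> Z \<subseteq> D" by blast
      have "Z \<subseteq> C \<union> D" using CD(3) Z(1) by blast
      with irr(1)[OF Z(1)] CD(1,2) have "Z \<subseteq> C \<or> Z \<subseteq> D" unfolding irreducible_in_def by simp
      with Z(2,3) show False by simp
    qed
    moreover obtain Z where Z: "Z \<in> \<C>" using ne by blast
    have "Z \<noteq> {}" using irr(1)[OF Z] by (simp add: irreducible_in_def)
    then have "\<Union>\<C> \<noteq> {}" using Z by blast
    moreover have "\<Union>\<C> \<subseteq> topspace T" using irr(1) by (intro Union_least) (simp add: irreducible_in_def)
    moreover have "A \<subseteq> \<Union>\<C>" using irr(2)[OF Z] Z by blast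
    ultimately show "\<Union>\<C> \<in> ?F" by (simp add: irreducible_in_def)
  qed (use A in auto)
  then obtain M where M: "M \<in> ?F" "\<forall>X\<in>?F. M \<subseteq> X \<longrightarrow> X = M" ..
  have "X = M" if "irreducible_in T X" "M \<subseteq> X" for X
  proof -
    have "X \<in> ?F" using M(1) that by auto
    with M(2) that(2) show ?thesis by blast
  qed
  with M(1) have "M \<in> irreducible_components T" by (simp add: irreducible_components_def)
  with M(1) show ?thesis by blast
qed

section \<open>Representation varieties\<close>

text \<open>The adjugate form shows that the entries are polynomials in those of \<open>g\<close> up
  to the factor \<open>1 / det g\<close>.\<close>

definition mat_inv :: "'k::field mat \<Rightarrow> 'k mat" where
  "mat_inv g = inverse (det g) \<cdot>\<^sub>m adj_mat g"

lemma mat_inv: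
  assumes g: "g \<in> carrier_mat m m" and d: "det g \<noteq> 0"
  shows "mat_inv g \<in> carrier_mat m m" "g * mat_inv g = 1\<^sub>m m" "mat_inv g * g = 1\<^sub>m m"
proof -
  note a = adj_mat[OF g]
  show "mat_inv g \<in> carrier_mat m m" using a(1) by (simp add: mat_inv_def)
  have one: "inverse (det g) \<cdot>\<^sub>m (det g \<cdot>\<^sub>m 1\<^sub>m m) = 1\<^sub>m m"
    using d by (intro eq_matI) auto
  show "g * mat_inv g = 1\<^sub>m m"
    unfolding mat_inv_def mult_smult_distrib[OF g a(1)] a(2) by (rule one)
  show "mat_inv g * g = 1\<^sub>m m"
    unfolding mat_inv_def mult_smult_assoc_mat[OF a(1) g] a(3) by (rule one)
qed

lemma mat_inv_unique:
  assumes g: "g \<in> carrier_mat m m" and h: "h \<in> carrier_mat m m" and gh: "g * h = 1\<^sub>m m"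
  shows "det g \<noteq> 0" "h = mat_inv g"
proof -
  have "det g * det h = 1" using det_mult[OF g h] gh by simp
  then show d: "det g \<noteq> 0" by auto
  note i = mat_inv[OF g d]
  have "h = mat_inv g * g * h" using i(3) h by simp
  also have "\<dots> = mat_inv g * (g * h)" by (rule assoc_mult_mat[OF i(1) g h])
  also have "\<dots> = mat_inv g" using gh i(1) by simp
  finally show "h = mat_inv g" .
qed

lemma conjugate_module:
  assumes X: "X \<in> modules scale m" and g: "g \<in> carrier_mat m m" and h: "h \<in> carrier_mat m m"
    and gh: "g * h = 1\<^sub>m m" "h * g = 1\<^sub>m m"
  shows "(\<lambda>a. g * X a * h) \<in> modules scale m" "mod_iso X (\<lambda>a. g * X a * h)"
proof -
  let ?Y = "\<lambda>a. g * X a * h"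
  note cX = modulesD(1)[OF X]
  have Yg: "?Y a * g = g * X a" for a
  proof -
    have "?Y a * g = g * X a * (h * g)" using g h cX[of a] by (simp add: assoc_mult_mat_dim)
    then show ?thesis using gh g cX[of a] by simp
  qed
  have "?Y (a * b) = ?Y a * ?Y b" for a b
  proof -
    have "?Y (a * b) = g * X a * (X b * h)"
      unfolding modulesD(4)[OF X] using g h cX[of a] cX[of b] by (simp add: assoc_mult_mat_dim)
    also have "\<dots> = ?Y a * g * (X b * h)" unfolding Yg ..
    also have "\<dots> = ?Y a * ?Y b" using g h cX[of a] cX[of b] by (simp add: assoc_mult_mat_dim)
    finally show ?thesis .
  qed
  moreover have "?Y (a + b) = ?Y a + ?Y b" for a b
    unfolding modulesD(2)[OF X] using g h cX[of a] cX[of b]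
    by (simp add: mult_add_distrib_mat[of _ m m _ m] add_mult_distrib_mat[of _ m m _ _ m])
  moreover have "?Y (scale k a) = k \<cdot>\<^sub>m ?Y a" for k a
    unfolding modulesD(3)[OF X] using g h cX[of a]
    by (simp add: mult_smult_distrib[of _ m m _ m] mult_smult_assoc_mat[of _ m m _ m])
  moreover have "?Y 1 = 1\<^sub>m m" unfolding modulesD(5)[OF X] using g h gh by simp
  moreover have "?Y a \<in> carrier_mat m m" for a using g h cX[of a] by simp
  ultimately show Y: "?Y \<in> modules scale m" by (simp add: modules_def)
  have "g \<in> Hom X ?Y" using g Yg by (simp add: mem_Hom_iff[OF X Y])
  then show "mod_iso X ?Y" using mod_isoI[OF X Y _ h gh(1)] by blast
qed

lemma rep_variety_subset_modules: "rep_variety scale n e d \<subseteq> modules scale (total_dim n d)"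
  by (auto simp: rep_variety_def)

lemma block_proj_carrier: "block_proj n d i \<in> carrier_mat (total_dim n d) (total_dim n d)"
  by (simp add: block_proj_def)

lemma orbit_subset_rep_variety:
  assumes X: "X \<in> rep_variety scale n e d"
  shows "orbit n d X \<subseteq> rep_variety scale n e d"
proof
  let ?m = "total_dim n d"
  have Xm: "X \<in> modules scale ?m" using X rep_variety_subset_modules by blast
  fix Y assume "Y \<in> orbit n d X"
  then obtain g h where gh: "Y = (\<lambda>a. g * X a * h)" "g \<in> GL n d" "h \<in> GL n d" "g * h = 1\<^sub>m ?m" "h * g = 1\<^sub>m ?m"
    by (auto simp: orbit_def)
  have c: "g \<in> carrier_mat ?m ?m" "h \<in> carrier_mat ?m ?m" using gh by (auto simp: GL_def)
  have "Y (e i) = block_proj n d i" if "i < n" for i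
  proof -
    have "Y (e i) = g * block_proj n d i * h" using X that by (simp add: gh(1) rep_variety_def)
    also have "\<dots> = block_proj n d i * g * h" using gh(2) that by (simp add: GL_def)
    also have "\<dots> = block_proj n d i * (g * h)" by (rule assoc_mult_mat[OF block_proj_carrier c])
    also have "\<dots> = block_proj n d i" unfolding gh(4) by (rule right_mult_one_mat[OF block_proj_carrier])
    finally show ?thesis .
  qed
  then show "Y \<in> rep_variety scale n e d"
    using conjugate_module(1)[OF Xm c gh(4,5)] by (simp add: rep_variety_def gh(1))
qed

lemma mem_GL_mat_inv:
  fixes g :: "'k::field mat"
  assumes g: "g \<in> carrier_mat (total_dim n d) (total_dim n d)" and det: "det g \<noteq> 0"
    and comm: "\<And>i. i < n \<Longrightarrow> g * block_proj n d i = block_proj n d i * g"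
  shows "g \<in> GL n d" "mat_inv g \<in> GL n d"
proof -
  let ?m = "total_dim n d"
  note i = mat_inv[OF g det]
  have dims: "dim_row g = ?m" "dim_row (mat_inv g) = ?m" "square_mat g" "square_mat (mat_inv g)" using g i(1) by auto
  have inv1: "invertible_mat g"
    unfolding invertible_mat_def inverts_mat_def using dims i by (intro conjI exI[of _ "mat_inv g"]) simp_all
  have inv2: "invertible_mat (mat_inv g)"
    unfolding invertible_mat_def inverts_mat_def using dims i by (intro conjI exI[of _ g]) simp_all
  show "g \<in> GL n d" using g inv1 comm by (simp add: GL_def)
  have "mat_inv g * block_proj n d j = block_proj n d j * mat_inv g" if "j < n" for j
  proof -
    let ?B = "block_proj n d j :: 'k mat"
    have B: "?B \<in> carrier_mat ?m ?m" by (rule block_proj_carrier)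
    have "mat_inv g * ?B = mat_inv g * ?B * (g * mat_inv g)"
      unfolding i(2) by (rule right_mult_one_mat[OF mult_carrier_mat[OF i(1) B], symmetric])
    also have "\<dots> = mat_inv g * (?B * g) * mat_inv g" using i(1) B g by (simp add: assoc_mult_mat_dim)
    also have "\<dots> = mat_inv g * (g * ?B) * mat_inv g" unfolding comm[OF that] ..
    also have "\<dots> = mat_inv g * g * ?B * mat_inv g" using i(1) B g by (simp add: assoc_mult_mat_dim)
    also have "\<dots> = ?B * mat_inv g" using i B by simp
    finally show ?thesis .
  qed
  then show "mat_inv g \<in> GL n d" using i(1) inv2 by (simp add: GL_def)
qed

text \<open>With the inverse eliminated, the conditions on \<open>g\<close> are linear apart from
  \<open>det g\<close> being nonzero; so a line joining two group elements leaves the group only at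
  roots of a polynomial.\<close>

lemma orbit_iff_mat_inv:
  "Y \<in> orbit n d X \<longleftrightarrow> (\<exists>g \<in> carrier_mat (total_dim n d) (total_dim n d). det g \<noteq> 0 \<and>
     (\<forall>i<n. g * block_proj n d i = block_proj n d i * g) \<and> Y = (\<lambda>a. g * X a * mat_inv g))"
  (is "_ = ?R")
proof
  assume "Y \<in> orbit n d X"
  then obtain g h where gh: "Y = (\<lambda>a. g * X a * h)" "g \<in> GL n d" "h \<in> GL n d" "g * h = 1\<^sub>m (total_dim n d)"
    by (auto simp: orbit_def)
  have c: "g \<in> carrier_mat (total_dim n d) (total_dim n d)" "h \<in> carrier_mat (total_dim n d) (total_dim n d)"
    using gh by (auto simp: GL_def)
  from mat_inv_unique[OF c gh(4)] gh c(1) show ?R by (auto simp: GL_def)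
next
  assume ?R
  then obtain g where g: "g \<in> carrier_mat (total_dim n d) (total_dim n d)" "det g \<noteq> 0"
    "\<And>i. i < n \<Longrightarrow> g * block_proj n d i = block_proj n d i * g" "Y = (\<lambda>a. g * X a * mat_inv g)" by blast
  from mem_GL_mat_inv[OF g(1-3)] mat_inv[OF g(1,2)] g(4) show "Y \<in> orbit n d X"
    unfolding orbit_def by blast
qed

subsection \<open>Components are stable under the group\<close>

definition is_poly :: "('k::comm_ring_1 \<Rightarrow> 'k) \<Rightarrow> bool" where
  "is_poly f \<longleftrightarrow> (\<exists>p. \<forall>t. f t = poly p t)"

lemma is_poly_const: "is_poly (\<lambda>_. c)"
  unfolding is_poly_def by (rule exI[of _ "[:c:]"]) simp

lemma is_poly_ident: "is_poly (\<lambda>t. t)"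
  unfolding is_poly_def by (rule exI[of _ "[:0, 1:]"]) simp

lemma is_poly_add: "is_poly f \<Longrightarrow> is_poly g \<Longrightarrow> is_poly (\<lambda>t. f t + g t)"
  unfolding is_poly_def by (metis poly_add)

lemma is_poly_diff: "is_poly f \<Longrightarrow> is_poly g \<Longrightarrow> is_poly (\<lambda>t. f t - g t)"
  unfolding is_poly_def by (metis poly_diff)

lemma is_poly_mult: "is_poly f \<Longrightarrow> is_poly g \<Longrightarrow> is_poly (\<lambda>t. f t * g t)"
  unfolding is_poly_def by (metis poly_mult)

lemma is_poly_sum: "(\<And>i. i \<in> I \<Longrightarrow> is_poly (f i)) \<Longrightarrow> is_poly (\<lambda>t. \<Sum>i\<in>I. f i t)"
  by (induction I rule: infinite_finite_induct) (auto intro: is_poly_const is_poly_add)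

lemma is_poly_prod: "(\<And>i. i \<in> I \<Longrightarrow> is_poly (f i)) \<Longrightarrow> is_poly (\<lambda>t. \<Prod>i\<in>I. f i t)"
  by (induction I rule: infinite_finite_induct) (auto intro: is_poly_const is_poly_mult)

lemma is_poly_det:
  assumes A: "\<And>t. A t \<in> carrier_mat m m" and p: "\<And>i j. i < m \<Longrightarrow> j < m \<Longrightarrow> is_poly (\<lambda>t. A t $$ (i, j))"
  shows "is_poly (\<lambda>t. det (A t))"
  unfolding det_def'[OF A]
proof (intro is_poly_sum is_poly_mult is_poly_const is_poly_prod p)
  fix \<pi> i assume "\<pi> \<in> {\<pi>. \<pi> permutes {0..<m}}" "i \<in> {0..<m}"
  then show "i < m" "\<pi> i < m" using permutes_in_image[of \<pi> "{0..<m}" i] by auto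
qed

lemma is_poly_adj_mat:
  assumes A: "\<And>t. A t \<in> carrier_mat m m" and p: "\<And>i j. i < m \<Longrightarrow> j < m \<Longrightarrow> is_poly (\<lambda>t. A t $$ (i, j))"
    and ij: "i < m" "j < m"
  shows "is_poly (\<lambda>t. adj_mat (A t) $$ (i, j))"
proof -
  have "adj_mat (A t) $$ (i, j) = (-1) ^ (j + i) * det (mat_delete (A t) j i)" for t
    using A[of t] ij by (simp add: adj_mat_def cofactor_def)
  moreover have "is_poly (\<lambda>t. det (mat_delete (A t) j i))"
  proof (rule is_poly_det)
    show "mat_delete (A t) j i \<in> carrier_mat (m - 1) (m - 1)" for t
      using A[of t] by (simp add: mat_delete_def)
  next
    fix k l assume kl: "k < m - 1" "l < m - 1"
    have "mat_delete (A t) j i $$ (k, l) = A t $$ (if k < j then k else Suc k, if l < i then l else Suc l)" for t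
      using A[of t] kl by (simp add: mat_delete_def)
    moreover have "is_poly (\<lambda>t. A t $$ (if k < j then k else Suc k, if l < i then l else Suc l))"
      using kl by (intro p) auto
    ultimately show "is_poly (\<lambda>t. mat_delete (A t) j i $$ (k, l))" by simp
  qed
  ultimately show ?thesis by (simp only:) (intro is_poly_mult is_poly_const)
qed

text \<open>A power of \<open>det (A t)\<close> clears the denominators of \<open>mat_inv\<close>: a
  coordinate has one factor, products add the exponents, and sums are brought to the common exponent
  \<open>N + N'\<close>.\<close>

lemma polyfuns_along_conjugation:
  fixes X :: "'a::ring_1 \<Rightarrow> 'k::field mat"
  assumes X: "X \<in> modules scale m" and A: "\<And>t. A t \<in> carrier_mat m m"
    and p: "\<And>i j. i < m \<Longrightarrow> j < m \<Longrightarrow> is_poly (\<lambda>t. A t $$ (i, j))" and f: "f \<in> polyfuns m"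
  shows "\<exists>N q. \<forall>t. det (A t) \<noteq> 0 \<longrightarrow>
    f (\<lambda>a. A t * X a * mat_inv (A t)) * det (A t) ^ N = poly q t"
  using f
proof induction
  case (const c)
  show ?case by (rule exI[of _ 0], rule exI[of _ "[:c:]"]) simp
next
  case (coord i j a)
  note adj = adj_mat(1)[OF A]
  have "(A t * X a * adj_mat (A t)) $$ (i, j) =
    (\<Sum>l<m. (\<Sum>k<m. A t $$ (i, k) * X a $$ (k, l)) * adj_mat (A t) $$ (l, j))" for t
    unfolding index_sum_prod[OF mult_carrier_mat[OF A modulesD(1)[OF X]] adj coord]
    by (intro sum.cong arg_cong2[of _ _ _ _ "(*)"] refl index_sum_prod[OF A modulesD(1)[OF X]] coord) auto
  moreover have "is_poly (\<lambda>t. \<Sum>l<m. (\<Sum>k<m. A t $$ (i, k) * X a $$ (k, l)) * adj_mat (A t) $$ (l, j))"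
    using coord by (intro is_poly_sum is_poly_mult is_poly_const p is_poly_adj_mat[OF A p]) auto
  ultimately obtain q where q: "\<And>t. (A t * X a * adj_mat (A t)) $$ (i, j) = poly q t"
    unfolding is_poly_def by auto
  have "(A t * X a * mat_inv (A t)) $$ (i, j) * det (A t) ^ 1 = poly q t" if "det (A t) \<noteq> 0" for t
  proof -
    have "A t * X a * mat_inv (A t) = inverse (det (A t)) \<cdot>\<^sub>m (A t * X a * adj_mat (A t))"
      unfolding mat_inv_def
      by (rule mult_smult_distrib[OF mult_carrier_mat[OF A modulesD(1)[OF X]] adj])
    then show ?thesis using that coord A[of t] adj[of t] by (simp add: q[symmetric])
  qed
  then show ?case by blast
next
  case (add f g)
  then obtain N q N' q' where *:
    "\<And>t. det (A t) \<noteq> 0 \<Longrightarrow> f (\<lambda>a. A t * X a * mat_inv (A t)) * det (A t) ^ N = poly q t"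
    "\<And>t. det (A t) \<noteq> 0 \<Longrightarrow> g (\<lambda>a. A t * X a * mat_inv (A t)) * det (A t) ^ N' = poly q' t" by blast
  obtain D where D: "\<And>t. det (A t) = poly D t" using is_poly_det[OF A p] unfolding is_poly_def by blast
  show ?case
    by (rule exI[of _ "N + N'"], rule exI[of _ "q * D ^ N' + q' * D ^ N"])
      (auto simp: *[symmetric] D[symmetric] power_add algebra_simps)
next
  case (mult f g)
  then obtain N q N' q' where *:
    "\<And>t. det (A t) \<noteq> 0 \<Longrightarrow> f (\<lambda>a. A t * X a * mat_inv (A t)) * det (A t) ^ N = poly q t"
    "\<And>t. det (A t) \<noteq> 0 \<Longrightarrow> g (\<lambda>a. A t * X a * mat_inv (A t)) * det (A t) ^ N' = poly q' t" by blast
  show ?case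
    by (rule exI[of _ "N + N'"], rule exI[of _ "q * q'"])
      (auto simp: *[symmetric] power_add algebra_simps)
qed

text \<open>Two elements of the group are joined by a line, all but finitely many points of which are invertible.\<close>

lemma orbit_irreducible:
  fixes X :: "'a::ring_1 \<Rightarrow> 'k::alg_closed_field mat"
  assumes X: "X \<in> rep_variety scale n e d"
    and C: "closedin (zariski (total_dim n d) (rep_variety scale n e d)) C"
    and D: "closedin (zariski (total_dim n d) (rep_variety scale n e d)) D"
    and sub: "orbit n d X \<subseteq> C \<union> D"
  shows "orbit n d X \<subseteq> C \<or> orbit n d X \<subseteq> D"
proof (rule ccontr)
  let ?m = "total_dim n d" and ?V = "rep_variety scale n e d"
  let ?B = "block_proj n d :: nat \<Rightarrow> 'k mat"
  have Xm: "X \<in> modules scale ?m" using X rep_variety_subset_modules by blast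
  note OV = orbit_subset_rep_variety[OF X]
  assume "\<not> ?thesis"
  then obtain Y1 Y2 where Y: "Y1 \<in> orbit n d X" "Y1 \<notin> C" "Y2 \<in> orbit n d X" "Y2 \<notin> D" by blast
  obtain F where F: "F \<subseteq> polyfuns ?m" "C = {X \<in> ?V. \<forall>f\<in>F. f X = 0}" using C by (auto simp: closedin_zariski)
  obtain F' where F': "F' \<subseteq> polyfuns ?m" "D = {X \<in> ?V. \<forall>f\<in>F'. f X = 0}" using D by (auto simp: closedin_zariski)
  obtain f1 where f1: "f1 \<in> F" "f1 Y1 \<noteq> 0" using Y(1,2) OV F(2) by blast
  obtain f2 where f2: "f2 \<in> F'" "f2 Y2 \<noteq> 0" using Y(3,4) OV F'(2) by blast
  obtain g where g: "g \<in> carrier_mat ?m ?m" "det g \<noteq> 0" "\<And>i. i < n \<Longrightarrow> g * ?B i = ?B i * g"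
    "Y1 = (\<lambda>a. g * X a * mat_inv g)" using Y(1) unfolding orbit_iff_mat_inv by blast
  obtain h where h: "h \<in> carrier_mat ?m ?m" "det h \<noteq> 0" "\<And>i. i < n \<Longrightarrow> h * ?B i = ?B i * h"
    "Y2 = (\<lambda>a. h * X a * mat_inv h)" using Y(3) unfolding orbit_iff_mat_inv by blast
  \<comment> \<open>Commuting with the block projections is linear, hence survives on the whole line
    through \<open>g\<close> and \<open>h\<close>; only invertibility can be lost.\<close>
  define A where "A t = (1 - t) \<cdot>\<^sub>m g + t \<cdot>\<^sub>m h" for t
  have A: "A t \<in> carrier_mat ?m ?m" for t using g h by (simp add: A_def)
  have p: "is_poly (\<lambda>t. A t $$ (i, j))" if "i < ?m" "j < ?m" for i j
  proof -
    have "A t $$ (i, j) = (1 - t) * g $$ (i, j) + t * h $$ (i, j)" for t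
      using g(1) h(1) that by (simp add: A_def)
    then show ?thesis
      by (simp only:) (intro is_poly_add is_poly_mult is_poly_diff is_poly_const is_poly_ident)
  qed
  have A0: "A 0 = g" and A1: "A 1 = h" using g(1) h(1) by (auto simp: A_def intro!: eq_matI)
  have comm: "A t * ?B i = ?B i * A t" if "i < n" for i t
  proof -
    note B = block_proj_carrier[of n d i, where 'a = 'k]
    have s: "(1 - t) \<cdot>\<^sub>m g \<in> carrier_mat ?m ?m" "t \<cdot>\<^sub>m h \<in> carrier_mat ?m ?m" using g(1) h(1) by auto
    show ?thesis unfolding A_def add_mult_distrib_mat[OF s B] mult_add_distrib_mat[OF B s]
        mult_smult_assoc_mat[OF g(1) B] mult_smult_assoc_mat[OF h(1) B]
        mult_smult_distrib[OF B g(1)] mult_smult_distrib[OF B h(1)] g(3)[OF that] h(3)[OF that] ..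
  qed
  define Y where "Y t = (\<lambda>a. A t * X a * mat_inv (A t))" for t
  obtain q where q: "\<And>t. det (A t) = poly q t" using is_poly_det[OF A p] unfolding is_poly_def by blast
  obtain N1 q1 where q1: "\<And>t. det (A t) \<noteq> 0 \<Longrightarrow> f1 (Y t) * det (A t) ^ N1 = poly q1 t"
    using polyfuns_along_conjugation[OF Xm A p, of f1] f1(1) F(1) unfolding Y_def by blast
  obtain N2 q2 where q2: "\<And>t. det (A t) \<noteq> 0 \<Longrightarrow> f2 (Y t) * det (A t) ^ N2 = poly q2 t"
    using polyfuns_along_conjugation[OF Xm A p, of f2] f2(1) F'(1) unfolding Y_def by blast
  have "poly q 0 \<noteq> 0" using q[of 0] A0 g(2) by simp
  moreover have "poly q1 0 \<noteq> 0" using q1[of 0] A0 g(2,4) f1(2) by (auto simp: Y_def)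
  moreover have "poly q2 1 \<noteq> 0" using q2[of 1] A1 h(2,4) f2(2) by (auto simp: Y_def)
  \<comment> \<open>Each factor is nonzero at 0 or at 1, so the product is a nonzero polynomial; any
    \<open>t\<close> off its finitely many roots gives an orbit point outside both closed
    sets.\<close>
  ultimately have "q * q1 * q2 \<noteq> 0" by auto
  then have "finite {t. poly (q * q1 * q2) t = 0}" by (rule poly_roots_finite)
  then have "{t. poly (q * q1 * q2) t = 0} \<noteq> UNIV" using infinite_UNIV_alg_closed by metis
  then obtain t where t: "poly q t \<noteq> 0" "poly q1 t \<noteq> 0" "poly q2 t \<noteq> 0" by auto
  then have dt: "det (A t) \<noteq> 0" using q by simp
  have Yt: "Y t \<in> orbit n d X" unfolding orbit_iff_mat_inv Y_def using A dt comm by blast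
  have "f1 (Y t) \<noteq> 0" "f2 (Y t) \<noteq> 0" using q1[OF dt] q2[OF dt] t by auto
  then have "Y t \<notin> C" "Y t \<notin> D" using F(2) F'(2) f1(1) f2(1) by auto
  with Yt sub show False by blast
qed

lemma polyfuns_conjugate:
  assumes g: "g \<in> carrier_mat m m" and h: "h \<in> carrier_mat m m" and f: "f \<in> polyfuns m"
  shows "\<exists>f'\<in>polyfuns m. \<forall>X. (\<forall>a. X a \<in> carrier_mat m m) \<longrightarrow> f (\<lambda>a. g * X a * h) = f' X"
  using f
proof induction
  case (const c)
  show ?case by (rule bexI[of _ "\<lambda>_. c"]) (auto intro: polyfuns.const)
next
  case (coord i j a)
  have "(g * X a * h) $$ (i, j) = (\<Sum>l<m. (\<Sum>k<m. g $$ (i, k) * X a $$ (k, l)) * h $$ (l, j))"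
    if "X a \<in> carrier_mat m m" for X
    unfolding index_sum_prod[OF mult_carrier_mat[OF g that] h coord]
    by (intro sum.cong arg_cong2[of _ _ _ _ "(*)"] refl index_sum_prod[OF g that] coord) auto
  moreover have "(\<lambda>X. \<Sum>l<m. (\<Sum>k<m. g $$ (i, k) * X a $$ (k, l)) * h $$ (l, j)) \<in> polyfuns m"
    by (intro polyfuns_sum polyfuns.mult polyfuns.const polyfuns.coord) auto
  ultimately show ?case by (intro bexI) auto
next
  case (add p q)
  from add.IH(1) obtain p' where p': "p' \<in> polyfuns m"
    "\<forall>X. (\<forall>a. X a \<in> carrier_mat m m) \<longrightarrow> p (\<lambda>a. g * X a * h) = p' X" ..
  from add.IH(2) obtain q' where q': "q' \<in> polyfuns m"
    "\<forall>X. (\<forall>a. X a \<in> carrier_mat m m) \<longrightarrow> q (\<lambda>a. g * X a * h) = q' X" ..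
  show ?case
    by (rule bexI[OF _ polyfuns.add[OF p'(1) q'(1)]]) (simp add: p'(2) q'(2))
next
  case (mult p q)
  from mult.IH(1) obtain p' where p': "p' \<in> polyfuns m"
    "\<forall>X. (\<forall>a. X a \<in> carrier_mat m m) \<longrightarrow> p (\<lambda>a. g * X a * h) = p' X" ..
  from mult.IH(2) obtain q' where q': "q' \<in> polyfuns m"
    "\<forall>X. (\<forall>a. X a \<in> carrier_mat m m) \<longrightarrow> q (\<lambda>a. g * X a * h) = q' X" ..
  show ?case
    by (rule bexI[OF _ polyfuns.mult[OF p'(1) q'(1)]]) (simp add: p'(2) q'(2))
qed

text \<open>The set is an intersection of preimages of \<open>C\<close>, one for each group element,
  and each element acts by polynomial maps.\<close>

lemma closedin_orbit_subset:
  fixes C :: "('a::ring_1 \<Rightarrow> 'k::field mat) set"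
  assumes C: "closedin (zariski (total_dim n d) (rep_variety scale n e d)) C"
  shows "closedin (zariski (total_dim n d) (rep_variety scale n e d))
    {X \<in> rep_variety scale n e d. orbit n d X \<subseteq> C}"
proof -
  let ?m = "total_dim n d" and ?V = "rep_variety scale n e d"
  obtain F where F: "F \<subseteq> polyfuns ?m" "C = {X \<in> ?V. \<forall>f\<in>F. f X = 0}" using C by (auto simp: closedin_zariski)
  define G :: "('k mat \<times> 'k mat) set" where "G = {(g, h). g \<in> GL n d \<and> h \<in> GL n d \<and> g * h = 1\<^sub>m ?m \<and> h * g = 1\<^sub>m ?m}"
  define act where "act x X = (\<lambda>a. fst x * X a * snd x)" for x and X :: "'a \<Rightarrow> 'k mat"
  have orbit: "orbit n d X = (\<lambda>x. act x X) ` G" for X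
  proof (intro equalityI subsetI)
    fix Y assume "Y \<in> orbit n d X"
    then obtain g h where "Y = (\<lambda>a. g * X a * h)" "(g, h) \<in> G" by (auto simp: orbit_def G_def)
    then show "Y \<in> (\<lambda>x. act x X) ` G" by (intro image_eqI[of _ _ "(g, h)"]) (simp_all add: act_def)
  next
    fix Y assume "Y \<in> (\<lambda>x. act x X) ` G"
    then obtain x where "x \<in> G" "Y = act x X" by auto
    then show "Y \<in> orbit n d X" unfolding orbit_def
      by (intro CollectI exI[of _ "fst x"] exI[of _ "snd x"]) (auto simp: G_def act_def)
  qed
  have "\<exists>f'\<in>polyfuns ?m. \<forall>X\<in>?V. f (act x X) = f' X" if "x \<in> G" "f \<in> F" for x f
  proof -
    have c: "fst x \<in> carrier_mat ?m ?m" "snd x \<in> carrier_mat ?m ?m"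
      using that(1) by (auto simp: G_def GL_def)
    from polyfuns_conjugate[OF c subsetD[OF F(1) that(2)]] obtain f' where
      f': "f' \<in> polyfuns ?m" "\<forall>X. (\<forall>a. X a \<in> carrier_mat ?m ?m) \<longrightarrow> f (\<lambda>a. fst x * X a * snd x) = f' X" ..
    have "f (act x X) = f' X" if "X \<in> ?V" for X
    proof -
      have "\<forall>a. X a \<in> carrier_mat ?m ?m" using that by (auto simp: rep_variety_def modulesD)
      with f'(2) show ?thesis by (simp add: act_def)
    qed
    with f'(1) show ?thesis by auto
  qed
  then have "\<forall>y\<in>G \<times> F. \<exists>f'. f' \<in> polyfuns ?m \<and> (\<forall>X\<in>?V. snd y (act (fst y) X) = f' X)" by fastforce
  from bchoice[OF this] obtain K where
    "\<forall>y\<in>G \<times> F. K y \<in> polyfuns ?m \<and> (\<forall>X\<in>?V. snd y (act (fst y) X) = K y X)" ..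
  then have K: "K (x, f) \<in> polyfuns ?m" "X \<in> ?V \<Longrightarrow> f (act x X) = K (x, f) X" if "x \<in> G" "f \<in> F" for x f X
    using that by auto
  have "orbit n d X \<subseteq> C \<longleftrightarrow> (\<forall>k\<in>K ` (G \<times> F). k X = 0)" if X: "X \<in> ?V" for X
  proof -
    have "orbit n d X \<subseteq> C \<longleftrightarrow> (\<forall>x\<in>G. \<forall>f\<in>F. f (act x X) = 0)"
      using orbit_subset_rep_variety[OF X] unfolding orbit F(2) by (simp add: image_subset_iff)
    also have "\<dots> \<longleftrightarrow> (\<forall>x\<in>G. \<forall>f\<in>F. K (x, f) X = 0)" using K(2)[OF _ _ X] by simp
    finally show ?thesis by simp
  qed
  then have "{X \<in> ?V. orbit n d X \<subseteq> C} = {X \<in> ?V. \<forall>k\<in>K ` (G \<times> F). k X = 0}"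
    by (rule Collect_cong[OF conj_cong[OF refl]])
  moreover have "K ` (G \<times> F) \<subseteq> polyfuns ?m" using K(1) by auto
  ultimately show ?thesis unfolding closedin_zariski by (intro exI[of _ "K ` (G \<times> F)"] conjI)
qed

text \<open>The union of the orbits through \<open>Z\<close> is again irreducible: each orbit lies
  in \<open>C\<close> or in \<open>D\<close>, and the points of either kind form a closed set.
  Maximality of \<open>Z\<close> then gives equality.\<close>

lemma component_orbit_stable:
  fixes scale :: "'k::alg_closed_field \<Rightarrow> 'a::ring_1 \<Rightarrow> 'a"
  assumes Z: "Z \<in> rep_components scale n e d" and X: "X \<in> Z"
  shows "orbit n d X \<subseteq> Z"
proof -
  let ?V = "rep_variety scale n e d"
  let ?T = "zariski (total_dim n d) ?V"
  have irr: "irreducible_in ?T Z" and max: "\<And>Z'. irreducible_in ?T Z' \<Longrightarrow> Z \<subseteq> Z' \<Longrightarrow> Z' = Z"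
    using Z by (auto simp: rep_components_def irreducible_components_def)
  have ZV: "Z \<subseteq> ?V" using irr by (simp add: irreducible_in_def topspace_zariski)
  let ?W = "\<Union>X\<in>Z. orbit n d X"
  have self: "X \<in> orbit n d X" if "X \<in> ?V" for X
    using orbit_iff_mod_iso[OF that that] mod_iso_refl[OF subsetD[OF rep_variety_subset_modules that]] by simp
  have sub: "X \<in> ?W" if "X \<in> Z" for X using self[of X] ZV that by auto
  then have "Z \<subseteq> ?W" by (rule subsetI)
  moreover have "irreducible_in ?T ?W"
    unfolding irreducible_in_def
  proof (intro conjI allI impI)
    show "?W \<subseteq> topspace ?T" unfolding topspace_zariski
    proof (rule UN_least)
      fix X assume "X \<in> Z"
      with ZV show "orbit n d X \<subseteq> ?V" by (intro orbit_subset_rep_variety) auto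
    qed
    show "?W \<noteq> {}" using sub[OF X] by auto
  next
    fix C D assume CD: "closedin ?T C \<and> closedin ?T D \<and> ?W \<subseteq> C \<union> D"
    let ?C = "{X \<in> ?V. orbit n d X \<subseteq> C}" and ?D = "{X \<in> ?V. orbit n d X \<subseteq> D}"
    have "Z \<subseteq> ?C \<union> ?D"
    proof
      fix X assume "X \<in> Z"
      then have X: "X \<in> ?V" "orbit n d X \<subseteq> C \<union> D" using ZV CD by auto
      from orbit_irreducible[OF X(1) conjunct1[OF CD] conjunct1[OF conjunct2[OF CD]] X(2)] X(1)
      show "X \<in> ?C \<union> ?D" by simp
    qed
    moreover have "closedin ?T ?C" "closedin ?T ?D" using CD by (simp_all add: closedin_orbit_subset)
    ultimately have "Z \<subseteq> ?C \<or> Z \<subseteq> ?D" using irr unfolding irreducible_in_def by simp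
    then show "?W \<subseteq> C \<or> ?W \<subseteq> D" by auto
  qed
  ultimately have "?W = Z" by (intro max)
  moreover have "orbit n d X \<subseteq> ?W" using X by (rule UN_upper)
  ultimately show ?thesis by simp
qed

subsection \<open>Every module is isomorphic to a point of a representation variety\<close>

text \<open>Used to read off blocks: after sorting, the positions with label below \<open>i\<close>
  are an initial segment, so their number is the start of block \<open>i\<close>.\<close>

lemma downward_closed_eq_lessThan:
  assumes "\<And>i j. j \<in> A \<Longrightarrow> i \<le> j \<Longrightarrow> i \<in> A" "finite (A :: nat set)"
  shows "A = {..<card A}"
proof (cases "A = {}")
  case False
  have "i \<in> A \<longleftrightarrow> i \<le> Max A" for i
    using assms(1)[OF Max_in[OF assms(2) False]] Max_ge[OF assms(2)] by blast
  then have "A = {..Max A}" by auto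
  then show ?thesis by (metis card_atMost lessThan_Suc_atMost)
qed simp

lemma exists_sorting_permutation:
  fixes l :: "nat \<Rightarrow> 'b::linorder"
  shows "\<exists>\<pi>. \<pi> ` {..<m} = {..<m} \<and> (\<forall>i j. i \<le> j \<longrightarrow> j < m \<longrightarrow> l (\<pi> i) \<le> l (\<pi> j))"
proof -
  let ?xs = "sort_key l [0..<m]"
  have len: "length ?xs = m" by simp
  have "(!) ?xs ` {..<m} = set ?xs" using len unfolding set_conv_nth by (auto simp del: set_sort)
  then have "(!) ?xs ` {..<m} = {..<m}" by (simp add: lessThan_atLeast0)
  moreover have "l (?xs ! i) \<le> l (?xs ! j)" if "i \<le> j" "j < m" for i j
    using sorted_nth_mono[OF sorted_sort_key[of l "[0..<m]"], of i j] that len by simp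
  ultimately show ?thesis by blast
qed

lemma module_zero:
  assumes X: "X \<in> modules scale m"
  shows "X 0 = 0\<^sub>m m m"
proof (rule eq_matI)
  fix i j assume "i < dim_row (0\<^sub>m m m :: 'b mat)" "j < dim_col (0\<^sub>m m m :: 'b mat)"
  then have ij: "i < m" "j < m" by auto
  have "X 0 $$ (i, j) = (X 0 + X 0) $$ (i, j)" using modulesD(2)[OF X, of 0 0] by simp
  also have "\<dots> = X 0 $$ (i, j) + X 0 $$ (i, j)"
    using ij carrier_matD[OF modulesD(1)[OF X, of 0]] by (intro index_add_mat(1)) auto
  finally have "X 0 $$ (i, j) = 0" by (simp only: add_cancel_right_right)
  then show "X 0 $$ (i, j) = 0\<^sub>m m m $$ (i, j)" using ij by simp
qed (use modulesD(1)[OF X, of 0] in auto)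

text \<open>Among the rows of the matrices \<open>X (e i)\<close>, which together have no common kernel, choose a basis
  and sort it by \<open>i\<close>.\<close>

lemma exists_rep_variety_point:
  fixes scale :: "'k::field \<Rightarrow> 'a::ring_1 \<Rightarrow> 'a"
  assumes e: "complete_primitive_orthogonal n e" and X: "X \<in> modules scale m"
  shows "\<exists>d Y. (\<forall>i\<ge>n. d i = 0) \<and> total_dim n d = m \<and> Y \<in> rep_variety scale n e d \<and> mod_iso X Y"
proof -
  note cX = modulesD(1)[OF X]
  have idem: "X (e i) * X (e j) = (if i = j then X (e i) else 0\<^sub>m m m)" if "i < n" "j < n" for i j
    using e that module_zero[OF X] unfolding modulesD(4)[OF X, symmetric]
    by (auto simp: complete_primitive_orthogonal_def primitive_idempotent_def idempotent_def)
  have ent: "X (\<Sum>i<k. e i) $$ (r, c) = (\<Sum>i<k. X (e i) $$ (r, c))" if "r < m" "c < m" for k r c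
  proof (induction k)
    case 0
    then show ?case using that module_zero[OF X] by simp
  next
    case (Suc k)
    then show ?case using that carrier_matD[OF cX[of "e k"]] by (simp add: modulesD(2)[OF X])
  qed
  have one: "(\<Sum>i<n. X (e i) $$ (r, c)) = (if r = c then 1 else 0)" if "r < m" "c < m" for r c
    using ent[OF that, of n] that e modulesD(5)[OF X] by (simp add: complete_primitive_orthogonal_def)
  \<comment> \<open>Rows are indexed by pairs of an idempotent and a row number, so that a selected
    row remembers its idempotent.\<close>
  define v where "v = (\<lambda>x k. X (e (fst x)) $$ (snd x, k))"
  have "\<exists>s. (\<forall>c<m. s c \<in> {..<n} \<times> {..<m}) \<and> det (mat m m (\<lambda>(c, k). v (s c) k)) \<noteq> 0"
  proof (rule exists_nonsingular_rows)
    fix u :: "nat \<Rightarrow> 'k"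
    assume u: "\<And>x. x \<in> {..<n} \<times> {..<m} \<Longrightarrow> (\<Sum>j<m. v x j * u j) = 0"
    show "\<forall>r<m. u r = 0"
    proof (intro allI impI)
      fix r assume r: "r < m"
      \<comment> \<open>The identity is the sum of the \<open>X (e i)\<close>, so a vector killed by
        all their rows is zero.\<close>
      have "u r = (\<Sum>c<m. (if r = c then 1 else 0) * u c)"
        using r by (simp add: if_distrib[of "\<lambda>x. x * _"] cong: if_cong)
      also have "\<dots> = (\<Sum>c<m. \<Sum>i<n. X (e i) $$ (r, c) * u c)"
        using r one by (intro sum.cong) (auto simp: sum_distrib_right[symmetric])
      also have "\<dots> = (\<Sum>i<n. \<Sum>c<m. v (i, r) c * u c)" by (subst sum.swap) (simp add: v_def)
      also have "\<dots> = 0" using u r by (intro sum.neutral) auto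
      finally show "u r = 0" .
    qed
  qed
  then obtain s where s: "\<forall>c<m. s c \<in> {..<n} \<times> {..<m}"
    "det (mat m m (\<lambda>(c, k). v (s c) k)) \<noteq> 0" by (elim exE conjE)
  obtain \<pi> where \<pi>: "\<pi> ` {..<m} = {..<m}" "\<forall>i j. i \<le> j \<longrightarrow> j < m \<longrightarrow> fst (s (\<pi> i)) \<le> fst (s (\<pi> j))"
    using exists_sorting_permutation[of m "\<lambda>c. fst (s c)"] by (elim exE conjE)
  \<comment> \<open>\<open>l c\<close> is the idempotent from which row \<open>c\<close> of the base
    change \<open>Q\<close> comes; after sorting it is weakly increasing.\<close>
  define l where "l c = fst (s (\<pi> c))" for c
  define Q where "Q = mat m m (\<lambda>(c, k). v (s (\<pi> c)) k)"
  have Q: "Q \<in> carrier_mat m m" by (simp add: Q_def)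
  have s\<pi>: "s (\<pi> c) \<in> {..<n} \<times> {..<m}" if "c < m" for c
  proof -
    have "\<pi> c \<in> \<pi> ` {..<m}" using that by simp
    then show ?thesis using s(1) unfolding \<pi>(1) by simp
  qed
  have detQ: "det Q \<noteq> 0"
  proof
    assume "det Q = 0"
    then have "\<exists>u. (\<exists>j<m. u j \<noteq> 0) \<and> (\<forall>c<m. (\<Sum>j<m. v (s (\<pi> c)) j * u j) = 0)"
      unfolding Q_def det_mat_eq_0_iff .
    then obtain u where "(\<exists>j<m. u j \<noteq> 0) \<and> (\<forall>c<m. (\<Sum>j<m. v (s (\<pi> c)) j * u j) = 0)" ..
    note u = conjunct1[OF this] conjunct2[OF this]
    have "(\<Sum>j<m. v (s c) j * u j) = 0" if "c < m" for c
    proof -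
      have "c \<in> \<pi> ` {..<m}" using that \<pi>(1) by simp
      then obtain c' where "c = \<pi> c'" "c' < m" by auto
      then show ?thesis using u(2) by simp
    qed
    with u(1) have "\<exists>u. (\<exists>j<m. u j \<noteq> 0) \<and> (\<forall>c<m. (\<Sum>j<m. v (s c) j * u j) = 0)"
      by (intro exI[of _ u]) simp
    with s(2) show False unfolding det_mat_eq_0_iff by simp
  qed
  define A where "A i = {c. c < m \<and> l c < i}" for i
  define d where "d i = card {c. c < m \<and> l c = i}" for i
  have ln: "l c < n" if "c < m" for c using s\<pi>[OF that] by (auto simp: l_def)
  have sumd: "(\<Sum>j<i. d j) = card (A i)" for i
  proof (induction i)
    case (Suc i)
    have "A (Suc i) = A i \<union> {c. c < m \<and> l c = i}" by (auto simp: A_def)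
    moreover have "card (A i \<union> {c. c < m \<and> l c = i}) = card (A i) + d i"
      unfolding d_def by (intro card_Un_disjoint) (auto simp: A_def)
    ultimately show ?case using Suc by simp
  qed (simp add: A_def)
  have Aeq: "A i = {..<card (A i)}" for i
  proof (rule downward_closed_eq_lessThan)
    show "finite (A i)" by (simp add: A_def)
    fix j k assume "k \<in> A i" "j \<le> k"
    then show "j \<in> A i" using \<pi>(2)[rule_format, of j k] by (auto simp: A_def l_def)
  qed
  have less: "c < (\<Sum>j<i. d j) \<longleftrightarrow> l c < i" if "c < m" for c i
  proof -
    have "c < (\<Sum>j<i. d j) \<longleftrightarrow> c \<in> A i" unfolding sumd by (subst Aeq) simp
    then show ?thesis using that by (simp add: A_def)
  qed
  have "A n = {..<m}" using ln by (auto simp: A_def)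
  then have total: "total_dim n d = m" by (simp add: total_dim_def sumd)
  \<comment> \<open>A normalization: with zeros beyond \<open>n\<close>, only finitely many
    dimension vectors have a given total dimension.\<close>
  have d0: "d i = 0" if "i \<ge> n" for i
  proof -
    have "{c. c < m \<and> l c = i} = {}" using ln that by fastforce
    then show ?thesis by (simp only: d_def card.empty)
  qed
  have block: "block_proj n d i $$ (c, k) = (if c = k \<and> l c = i then 1 else 0)" if "c < m" "k < m" for c k i
  proof -
    have "((\<Sum>j<i. d j) \<le> c \<and> c < (\<Sum>j<Suc i. d j)) \<longleftrightarrow> l c = i"
      using less[OF that(1), of i] less[OF that(1), of "Suc i"] by (simp only: not_less[symmetric] less_Suc_eq) auto
    then show ?thesis using that by (simp add: block_proj_def total)
  qed
  have B: "block_proj n d i \<in> carrier_mat m m" for i using block_proj_carrier[of n d i] total by simp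
  have QE: "Q * X (e i) = block_proj n d i * Q" if i: "i < n" for i
  proof (rule eq_matI)
    fix c k assume "c < dim_row (block_proj n d i * Q)" "k < dim_col (block_proj n d i * Q)"
    then have ck: "c < m" "k < m" using B[of i] Q by auto
    obtain r where r: "s (\<pi> c) = (l c, r)" "r < m" using s\<pi>[OF ck(1)] by (auto simp: l_def)
    \<comment> \<open>Row \<open>c\<close> of \<open>Q\<close> is a row of
      \<open>X (e (l c))\<close>. By orthogonality of the idempotents, right multiplication by
      \<open>X (e i)\<close> keeps it if \<open>l c = i\<close> and kills it otherwise, just as the
      block projection does from the left.\<close>
    have "(Q * X (e i)) $$ (c, k) = (\<Sum>x<m. X (e (l c)) $$ (r, x) * X (e i) $$ (x, k))"
      unfolding index_sum_prod[OF Q cX ck] using ck r by (intro sum.cong) (auto simp: Q_def v_def)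
    also have "\<dots> = (X (e (l c)) * X (e i)) $$ (r, k)"
      by (rule index_sum_prod[OF cX cX r(2) ck(2), symmetric])
    also have "\<dots> = (if l c = i then Q $$ (c, k) else 0)"
      unfolding idem[OF ln[OF ck(1)] i] using ck r by (auto simp: Q_def v_def)
    also have "\<dots> = (\<Sum>x<m. if x = c then (if l c = i then Q $$ (c, k) else 0) else 0)"
      using ck by simp
    also have "\<dots> = (\<Sum>x<m. block_proj n d i $$ (c, x) * Q $$ (x, k))"
      using ck by (intro sum.cong) (auto simp: block)
    also have "\<dots> = (block_proj n d i * Q) $$ (c, k)"
      by (rule index_sum_prod[OF B Q ck, symmetric])
    finally show "(Q * X (e i)) $$ (c, k) = (block_proj n d i * Q) $$ (c, k)" .
  qed (use Q B[of i] cX[of "e i"] in auto)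
  note inv = mat_inv[OF Q detQ]
  let ?Y = "\<lambda>a. Q * X a * mat_inv Q"
  note Y = conjugate_module[OF X Q inv]
  have "?Y (e i) = block_proj n d i" if "i < n" for i
  proof -
    have "?Y (e i) = block_proj n d i * (Q * mat_inv Q)"
      unfolding QE[OF that] by (rule assoc_mult_mat[OF B Q inv(1)])
    also have "\<dots> = block_proj n d i" unfolding inv(2) by (rule right_mult_one_mat[OF B])
    finally show ?thesis .
  qed
  then have "?Y \<in> rep_variety scale n e d" using Y(1) by (simp add: rep_variety_def total)
  with Y(2) total d0 show ?thesis by blast
qed

section \<open>From semibricks to orthogonal orbits, and the equivalence\<close>

theorem infinite_orthogonal_orbits_of_infinite_semibrick:
  fixes scale :: "'k::alg_closed_field \<Rightarrow> 'a::ring_1 \<Rightarrow> 'a"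
  assumes alg: "fd_algebra scale" and e: "complete_primitive_orthogonal n e"
    and S: "semibrick scale S" "infinite S" "S \<subseteq> modules scale m"
  shows "\<exists>d. total_dim n d = m \<and> (\<exists>Z\<in>rep_components scale n e d. \<exists>\<O>. infinite \<O> \<and>
    (\<forall>P\<in>\<O>. P \<subseteq> Z \<and> (\<exists>X\<in>Z. P = orbit n d X)) \<and>
    (\<forall>P\<in>\<O>. \<forall>Q\<in>\<O>. P \<noteq> Q \<longrightarrow> orthogonal_orbits P Q))"
proof -
  have "\<forall>X\<in>S. \<exists>d Y. (\<forall>i\<ge>n. d i = 0) \<and> total_dim n d = m \<and> Y \<in> rep_variety scale n e d \<and> mod_iso X Y"
    using exists_rep_variety_point[OF e] S(3) by blast
  then obtain D Y where DY: "\<And>X. X \<in> S \<Longrightarrow> (\<forall>i\<ge>n. D X i = 0) \<and> total_dim n (D X) = m \<and>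
      Y X \<in> rep_variety scale n e (D X) \<and> mod_iso X (Y X)" by metis
  have "D ` S \<subseteq> {f. \<forall>i. (i \<in> {..<n} \<longrightarrow> f i \<in> {..m}) \<and> (i \<notin> {..<n} \<longrightarrow> f i = 0)}"
  proof (intro image_subsetI CollectI allI conjI impI)
    fix X i assume X: "X \<in> S"
    {
      assume "i \<in> {..<n}"
      then have "D X i \<le> (\<Sum>j<n. D X j)" by (intro member_le_sum) auto
      then show "D X i \<in> {..m}" using DY[OF X] by (simp add: total_dim_def)
    next
      assume "i \<notin> {..<n}"
      then show "D X i = 0" using DY[OF X] by auto
    }
  qed
  moreover have "finite {f. \<forall>i. (i \<in> {..<n} \<longrightarrow> f i \<in> {..m}) \<and> (i \<notin> {..<n} \<longrightarrow> f i = 0)}"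
    by (rule finite_set_of_finite_funs) auto
  ultimately have "finite (D ` S)" by (rule finite_subset)
  \<comment> \<open>A semibrick of fixed dimension may spread over several dimension vectors;
    infinitely many members share one and so have representatives in one variety.\<close>
  from pigeonhole_infinite[OF S(2) this] obtain X0 where
    X0: "X0 \<in> S" "infinite {X \<in> S. D X = D X0}" by blast
  define d where "d = D X0"
  define S0 where "S0 = {X \<in> S. D X = d}"
  let ?V = "rep_variety scale n e d"
  have total: "total_dim n d = m" using DY[OF X0(1)] by (simp add: d_def)
  have V: "?V \<subseteq> modules scale m" using rep_variety_subset_modules[of scale n e d] total by simp
  have S0: "X \<in> S" "X \<in> modules scale m" "Y X \<in> ?V" "Y X \<in> modules scale m" "mod_iso X (Y X)"
    if "X \<in> S0" for X using that DY[of X] S(3) V by (auto simp: S0_def)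
  have niso: "\<not> mod_iso (Y X) (Y X')" and zero: "Hom_zero X X'"
    if XX: "X \<in> S0" "X' \<in> S0" "X \<noteq> X'" for X X'
  proof -
    have sb: "\<not> mod_iso X X'" "Hom_zero X X'" using S(1) S0(1)[OF XX(1)] S0(1)[OF XX(2)] XX(3)
      unfolding semibrick_def by blast+
    show "Hom_zero X X'" by (rule sb(2))
    note a = S0[OF XX(1)] and b = S0[OF XX(2)]
    show "\<not> mod_iso (Y X) (Y X')"
    proof
      assume i: "mod_iso (Y X) (Y X')"
      have "mod_iso X (Y X')" by (rule mod_iso_trans[OF a(2,4) b(4) a(5) i])
      then have "mod_iso X X'" by (rule mod_iso_trans[OF a(2) b(4) b(2) _ mod_iso_sym[OF b(2,4,5)]])
      with sb(1) show False ..
    qed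
  qed
  \<comment> \<open>The chosen points remain infinite in number because the bricks they represent
    are pairwise non-isomorphic.\<close>
  have "inj_on Y S0"
  proof (rule inj_onI, rule ccontr)
    fix X X' assume "X \<in> S0" "X' \<in> S0" "Y X = Y X'" "X \<noteq> X'"
    then show False using niso[of X X'] mod_iso_refl[OF S0(4)] by metis
  qed
  then have "infinite (Y ` S0)" using X0(2) by (simp add: finite_image_iff S0_def d_def)
  moreover have "Y ` S0 \<subseteq> ?V" using S0(3) by blast
  ultimately obtain T where T: "T \<subseteq> Y ` S0" "infinite T" "irreducible_in (zariski m ?V) T"
    using infinite_irreducible_subset[OF alg V] by blast
  from irreducible_in_subset_component[OF T(3)] obtain Z where Z: "Z \<in> rep_components scale n e d" "T \<subseteq> Z"
    unfolding rep_components_def total by blast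
  have TV: "T \<subseteq> ?V" using T(1) S0(3) by blast
  have orb: "mod_iso A P \<and> P \<in> modules scale m" if "A \<in> T" "P \<in> orbit n d A" for A P
  proof -
    have "A \<in> ?V" using TV that(1) by blast
    moreover from this have "P \<in> ?V" using orbit_subset_rep_variety that(2) by blast
    ultimately show ?thesis using orbit_iff_mod_iso that(2) V by blast
  qed
  have ortho: "Hom_zero P Q" if AB: "A \<in> T" "B \<in> T" "A \<noteq> B" "P \<in> orbit n d A" "Q \<in> orbit n d B" for A B P Q
  proof -
    obtain X X' where X: "X \<in> S0" "X' \<in> S0" "A = Y X" "B = Y X'" using T(1) AB(1,2) by blast
    note a = S0[OF X(1)] and b = S0[OF X(2)]
    note oP = orb[OF AB(1,4)] and oQ = orb[OF AB(2,5)]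
    have "mod_iso X P" using mod_iso_trans[OF a(2,4) _ a(5)] oP X(3) by blast
    moreover have "mod_iso X' Q" using mod_iso_trans[OF b(2,4) _ b(5)] oQ X(4) by blast
    moreover have "Hom_zero X X'" using zero[OF X(1,2)] AB(3) X(3,4) by blast
    ultimately show ?thesis using Hom_zero_iso[OF a(2) b(2)] oP oQ by blast
  qed
  have "inj_on (orbit n d) T"
  proof (rule inj_onI, rule ccontr)
    fix A B assume AB: "A \<in> T" "B \<in> T" "orbit n d A = orbit n d B" "A \<noteq> B"
    then have BV: "B \<in> ?V" using TV by blast
    then have "B \<in> orbit n d B" using orbit_iff_mod_iso[OF BV BV] mod_iso_refl V by blast
    then have "mod_iso A B" using orb[OF AB(1)] AB(3) by blast
    moreover obtain X X' where X: "X \<in> S0" "X' \<in> S0" "A = Y X" "B = Y X'" using T(1) AB(1,2) by blast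
    ultimately show False using niso[OF X(1,2)] AB(4) by blast
  qed
  then have "infinite (orbit n d ` T)" using T(2) by (simp add: finite_image_iff)
  moreover have "\<forall>P\<in>orbit n d ` T. P \<subseteq> Z \<and> (\<exists>X\<in>Z. P = orbit n d X)"
    using component_orbit_stable[OF Z(1)] Z(2) by blast
  moreover have "\<forall>P\<in>orbit n d ` T. \<forall>Q\<in>orbit n d ` T. P \<noteq> Q \<longrightarrow> orthogonal_orbits P Q"
    unfolding orthogonal_orbits_def using ortho by blast
  ultimately show ?thesis using Z(1) total by blast
qed

theorem mainTheorem5:
  fixes scale :: "'k::alg_closed_field \<Rightarrow> 'a::ring_1 \<Rightarrow> 'a"
    and n :: nat
    and e :: "nat \<Rightarrow> 'a"
  assumes "fd_algebra scale"
    and "connected_algebra TYPE('a)"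
    and "basic_algebra n e"
    and "algebra_rank scale = n"
  defines "S1 \<equiv> \<exists>d>0. infinite (brick_classes scale d)"
    and "S2 \<equiv> \<exists>d>0. \<exists>S. semibrick scale S \<and> infinite S \<and> S \<subseteq> modules scale d"
    and "S3 \<equiv> \<exists>d'>0. \<exists>d. total_dim n d = d' \<and>
           (\<exists>Z \<in> rep_components scale n e d. \<exists>X\<in>Z. \<exists>Y\<in>Z. Hom_zero X Y)"
    and "S4 \<equiv> \<exists>d'>0. \<exists>d. total_dim n d = d' \<and>
           (\<exists>Z \<in> rep_components scale n e d. \<exists>\<O>. infinite \<O> \<and>
              (\<forall>P\<in>\<O>. P \<subseteq> Z \<and> (\<exists>X\<in>Z. P = orbit n d X)) \<and>
              (\<forall>P\<in>\<O>. \<forall>Q\<in>\<O>. P \<noteq> Q \<longrightarrow> orthogonal_orbits P Q))"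
  shows "(S1 \<longleftrightarrow> S2) \<and> (S2 \<longleftrightarrow> S3) \<and> (S3 \<longleftrightarrow> S4)"
proof -
  have e: "complete_primitive_orthogonal n e" using assms(3) by (simp add: basic_algebra_def)
  have 12: "S2" if "S1"
    using that infinite_semibrick_of_infinite_brick_classes unfolding S1_def S2_def by blast
  have 21: "S1" if "S2"
    using that infinite_brick_classes_of_infinite_semibrick unfolding S1_def S2_def by blast
  have 24: "S4" if "S2"
  proof -
    from that obtain m S where m: "m > 0" and S: "semibrick scale S" "infinite S" "S \<subseteq> modules scale m"
      unfolding S2_def by (elim exE conjE)
    with infinite_orthogonal_orbits_of_infinite_semibrick[OF assms(1) e S] show ?thesis
      unfolding S4_def by (intro exI[of _ m] conjI)
  qed
  have 43: "S3" if "S4"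
  proof -
    from that obtain d' d Z \<O> where d: "d' > 0" "total_dim n d = d'" and Z: "Z \<in> rep_components scale n e d"
      and O: "infinite \<O>" "\<forall>P\<in>\<O>. P \<subseteq> Z \<and> (\<exists>X\<in>Z. P = orbit n d X)"
        "\<forall>P\<in>\<O>. \<forall>Q\<in>\<O>. P \<noteq> Q \<longrightarrow> orthogonal_orbits P Q"
      unfolding S4_def by (elim exE conjE bexE)
    \<comment> \<open>Two distinct orbits suffice: each contains its own base point, and these two
      points witness \<open>S3\<close>.\<close>
    have "\<exists>P\<in>\<O>. \<exists>Q\<in>\<O>. P \<noteq> Q"
    proof (rule ccontr)
      assume all_eq: "\<not> ?thesis"
      obtain P where "P \<in> \<O>" using infinite_imp_nonempty[OF O(1)] by auto
      with all_eq have "\<O> \<subseteq> {P}" by auto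
      then have "finite \<O>" by (rule finite_subset) simp
      with O(1) show False ..
    qed
    then obtain P Q where "P \<in> \<O>" "Q \<in> \<O>" "P \<noteq> Q" by (elim bexE)
    with O(3) have PQ: "P \<in> \<O>" "Q \<in> \<O>" "orthogonal_orbits P Q" by simp_all
    from O(2) PQ(1) obtain X where X: "X \<in> Z" "P = orbit n d X" by auto
    from O(2) PQ(2) obtain Y where Y: "Y \<in> Z" "Q = orbit n d Y" by auto
    note XY = X Y
    have "Z \<subseteq> rep_variety scale n e d"
      using Z by (auto simp: rep_components_def irreducible_components_def irreducible_in_def topspace_zariski)
    then have "W \<in> orbit n d W" if "W \<in> Z" for W
      using that orbit_iff_mod_iso[of W scale n e d W]
        mod_iso_refl[OF subsetD[OF rep_variety_subset_modules[of scale n e d]], of W] by auto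
    then have "Hom_zero X Y" using PQ(3) XY unfolding orthogonal_orbits_def by simp
    with d Z XY(1,3) show ?thesis
      unfolding S3_def by (intro exI[of _ d'] conjI exI[of _ d] bexI[of _ Z] bexI[of _ X] bexI[of _ Y])
  qed
  have 31: "S1" if "S3"
  proof -
    from that obtain d' d Z X Y where "d' > 0" "total_dim n d = d'" and Z: "Z \<in> rep_components scale n e d"
      and XY: "X \<in> Z" "Y \<in> Z" "Hom_zero X Y" unfolding S3_def by (elim exE conjE bexE)
    \<comment> \<open>Positivity matters: between modules of dimension zero \<open>Hom_zero\<close>
      holds trivially, without any brick.\<close>
    then have d: "total_dim n d > 0" by simp
    have "irreducible_in (zariski (total_dim n d) (rep_variety scale n e d)) Z"
      using Z by (simp add: rep_components_def irreducible_components_def)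
    from infinite_brick_classes_of_Hom_zero[OF rep_variety_subset_modules d this XY] show ?thesis
      unfolding S1_def .
  qed
  show ?thesis using 12 21 24 43 31 by blast
qed

end
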